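(* Let $G$ be a convex cocompact Fuchsian group of the second kind acting on the unit disk $\Delta$, let $\mathcal{F}$ be the Dirichlet domain of $G$ centered at $0$, and let $\mathcal{F}(\infty)=\overline{\mathcal{F}}\cap\partial\Delta$ be its boundary at infinity. Let $\mu\in M(G)$ be a $G$-compatible Beltrami coefficient. Suppose there exists a constant $C$ such that, for every $\xi\in\mathcal{F}(\infty)$ and every $0<r<1$, $$\iint_{B(\xi,r)}\frac{|\mu(z)|^{2}\chi_{\mathcal{F}}(z)}{1-|z|^{2}}\,dx\,dy\leq Cr.$$ Then $\mu\in CM^{*}(\Delta)$, i.e. $\dfrac{|\mu(z)|^{2}}{1-|z|^{2}}\,dx\,dy$ is a Carleson measure on $\Delta$.
   Context: $\Delta=\{z\in\mathbb{C}:|z|<1\}$ is the unit disk, $z=x+iy$, and $B(\xi,r)$ is the Euclidean disk with center $\xi$ and radius $r$. $\chi_A$ denotes the characteristic function of $A$. A Fuchsian group is a discrete group $G$ of Möbius transformations acting on $\Delta$. It is of the first kind if its limit set is the entire circle $\partial\Delta$, and of the second kind otherwise. It is convex cocompact if it is finitely generated and has no parabolic elements. For $g\in G$, $\mathcal{D}_{0}(g)$ is the closed hyperbolic half-plane containing $0$ bounded by the perpendicular bisector of the hyperbolic segment $[0,g(0)]_h$, i.e. $\mathcal{D}_0(g)=\{w\in\Delta:\rho(w,0)\le\rho(w,g(0))\}$, where $\rho$ is the hyperbolic distance on $\Delta$. The Dirichlet domain of $G$ centered at $0$ is $\mathcal{F}=\bigcap_{g\in G\setminus\{\mathrm{id}\}}\mathcal{D}_{0}(g)$.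 Its boundary at infinity is $\mathcal{F}(\infty)=\overline{\mathcal{F}}\cap\partial\Delta$, where the closure is taken in the Euclidean closed disk; the points of $\mathcal{F}(\infty)$ are those in the free edges of $\mathcal{F}$. $M(G)$ is the set of all $G$-compatible Beltrami coefficients: bounded measurable functions $\mu$ on $\Delta$ with $\|\mu\|_{\infty}<1$ (essential supremum norm) and $\mu(z)=\mu(g(z))\,\overline{g'(z)}/g'(z)$ for every $g\in G$ (identity of functions in $L^\infty(\Delta)$, i.e. for almost every $z$). A positive measure $\lambda$ on $\Delta$ is a Carleson measure on $\Delta$ if there is a constant $C'$ such that $\lambda(\Delta\cap B(\zeta,r))\le C'r$ for all $\zeta\in\partial\Delta$ and all $0<r<2$. $CM(\Delta)$ is the set of all Carleson measures on $\Delta$, and $\mu\in CM^{*}(\Delta)$ means that $\frac{|\mu|^{2}}{1-|z|^{2}}\,dx\,dy\in CM(\Delta)$. *)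

theory Defs
  imports
    "HOL-Complex_Analysis.Complex_Analysis"
    "HOL-Probability.Essential_Supremum"
    "HOL-Algebra.Bij"
    "HOL-Algebra.Generated_Groups"
begin

abbreviation unit_disk :: "complex set" (\<open>\<Delta>\<close>)
  where "\<Delta> \<equiv> ball 0 1"

subsection \<open>Fuchsian groups\<close>

text \<open>The orientation-preserving Moebius transformations preserving the unit disk are
  \<open>z \<mapsto> (a z + b) / (b' z + a')\<close> with \<open>\<bar>a\<bar>\<^sup>2 - \<bar>b\<bar>\<^sup>2 = 1\<close>, where a prime denotes complex
  conjugation. We let them act on the \<^emph>\<open>closed\<close> disk, on which the denominator does not vanish,
  as extensional functions. So they are elements of the library group
  \<^term>\<open>BijGroup (cball (0::complex) 1)\<close>, whose operation is composition and whose unit is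
  \<^term>\<open>\<lambda>z\<in>cball (0::complex) 1. z\<close>.\<close>

definition SU11 :: "(complex \<times> complex) set"
  where "SU11 = {(a, b). (cmod a)\<^sup>2 - (cmod b)\<^sup>2 = 1}"

definition disk_moebius :: "complex \<Rightarrow> complex \<Rightarrow> complex \<Rightarrow> complex"
  where "disk_moebius a b = (\<lambda>z\<in>cball 0 1. (a * z + b) / (cnj b * z + cnj a))"

definition moebius_disk_group :: "(complex \<Rightarrow> complex) set \<Rightarrow> bool"
  where "moebius_disk_group G \<longleftrightarrow>
    G \<subseteq> {disk_moebius a b | a b. (a, b) \<in> SU11} \<and> subgroup G (BijGroup (cball 0 1))"

text \<open>Discreteness is that of the group of matrices, with the topology of the matrix
  coefficients. The map from \<^const>\<open>SU11\<close> to transformations is two-to-one,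
  \<open>(a, b)\<close> and \<open>(-a, -b)\<close> inducing the same one, so passing to the full preimage does not
  affect discreteness.\<close>

definition fuchsian_group :: "(complex \<Rightarrow> complex) set \<Rightarrow> bool"
  where "fuchsian_group G \<longleftrightarrow>
    moebius_disk_group G \<and> discrete {(a, b). (a, b) \<in> SU11 \<and> disk_moebius a b \<in> G}"

definition limit_set :: "(complex \<Rightarrow> complex) set \<Rightarrow> complex set"
  where "limit_set G = {\<xi>. \<exists>z\<in>\<Delta>. \<xi> islimpt (\<lambda>g. g z) ` G}"

definition first_kind :: "(complex \<Rightarrow> complex) set \<Rightarrow> bool"
  where "first_kind G \<longleftrightarrow> limit_set G = sphere 0 1"

definition second_kind :: "(complex \<Rightarrow> complex) set \<Rightarrow> bool"
  where "second_kind G \<longleftrightarrow> \<not> first_kind G"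

text \<open>A Moebius transformation is parabolic if it has exactly one fixed point on the Riemann
  sphere. If it preserves the disk, its fixed points are symmetric with respect to the unit
  circle, so that a unique fixed point lies on the circle and no fixed point lies in the disk.\<close>

definition parabolic :: "(complex \<Rightarrow> complex) \<Rightarrow> bool"
  where "parabolic g \<longleftrightarrow> (\<exists>\<xi>\<in>sphere 0 1. {z \<in> cball 0 1. g z = z} = {\<xi>})"

definition finitely_generated :: "(complex \<Rightarrow> complex) set \<Rightarrow> bool"
  where "finitely_generated G \<longleftrightarrow>
    (\<exists>S. finite S \<and> S \<subseteq> G \<and> generate (BijGroup (cball 0 1)) S = G)"

definition convex_cocompact :: "(complex \<Rightarrow> complex) set \<Rightarrow> bool"
  where "convex_cocompact G \<longleftrightarrow> finitely_generated G \<and> (\<forall>g\<in>G. \<not> parabolic g)"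

subsection \<open>Dirichlet domain\<close>

text \<open>Hyperbolic distance of the disk, for the metric \<open>2 \<bar>dz\<bar> / (1 - \<bar>z\<bar>\<^sup>2)\<close> of curvature \<open>-1\<close>.\<close>

definition hyp_dist :: "complex \<Rightarrow> complex \<Rightarrow> real"
  where "hyp_dist z w = 2 * artanh (cmod ((z - w) / (1 - cnj w * z)))"

definition half_plane0 :: "(complex \<Rightarrow> complex) \<Rightarrow> complex set"
  where "half_plane0 g = {w \<in> \<Delta>. hyp_dist w 0 \<le> hyp_dist w (g 0)}"

text \<open>The intersection is taken inside \<open>\<Delta>\<close>, which only matters for the trivial group.\<close>

definition dirichlet_domain :: "(complex \<Rightarrow> complex) set \<Rightarrow> complex set"
  where "dirichlet_domain G = \<Delta> \<inter> (\<Inter>g\<in>G - {\<one>\<^bsub>BijGroup (cball 0 1)\<^esub>}. half_plane0 g)"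

definition boundary_at_infinity :: "complex set \<Rightarrow> complex set"
  where "boundary_at_infinity F = closure F \<inter> sphere 0 1"

subsection \<open>Beltrami coefficients and Carleson measures\<close>

text \<open>Beltrami coefficients are (representatives of) elements of \<open>L\<^sup>\<infinity>(\<Delta>)\<close>; their values off \<open>\<Delta>\<close>
  are irrelevant.\<close>

definition beltrami :: "(complex \<Rightarrow> complex) set \<Rightarrow> (complex \<Rightarrow> complex) set"
  where "beltrami G = {\<mu>.
    \<mu> \<in> borel_measurable (lebesgue_on \<Delta>) \<and>
    esssup (lebesgue_on \<Delta>) (\<lambda>z. ereal (cmod (\<mu> z))) < 1 \<and>
    (\<forall>g\<in>G. AE z in lebesgue_on \<Delta>. \<mu> z = \<mu> (g z) * cnj (deriv g z) / deriv g z)}"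

text \<open>Positive measures on \<open>\<Delta>\<close> are defined at least on all Borel subsets of \<open>\<Delta>\<close>.\<close>

definition CM :: "complex measure set"
  where "CM = {l. space l = \<Delta> \<and> sets (restrict_space borel \<Delta>) \<subseteq> sets l \<and>
    (\<exists>C'::real. \<forall>\<zeta>\<in>sphere 0 1. \<forall>r. 0 < r \<and> r < 2 \<longrightarrow>
      emeasure l (\<Delta> \<inter> ball \<zeta> r) \<le> ennreal (C' * r))}"

definition CM_star :: "(complex \<Rightarrow> complex) set"
  where "CM_star = {\<mu>. \<mu> \<in> borel_measurable (lebesgue_on \<Delta>) \<and>
    density (lebesgue_on \<Delta>) (\<lambda>z. ennreal ((cmod (\<mu> z))\<^sup>2 / (1 - (cmod z)\<^sup>2))) \<in> CM}"

end

theory Submission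
  imports Defs
begin

text \<open>
  Let \<open>m\<close> run through the group, and let \<open>a\<^sub>m\<close> be the diagonal entry of a matrix of \<open>m\<close>, so that
  \<open>1 - \<bar>m 0\<bar>\<^sup>2 = \<bar>a\<^sub>m\<bar>\<^sup>-\<^sup>2\<close>. The theorem rests on two facts about the Dirichlet domain \<open>F\<close>.

  \<^item> The closure of \<open>F\<close> contains no limit point. By compactness, \<open>\<bar>m'\<bar>\<close> is comparable to
    \<open>\<bar>a\<^sub>m\<bar>\<^sup>-\<^sup>2\<close> on \<open>F\<close>, uniformly in \<open>m\<close> (\<open>den_comparable\<close>): the tile \<open>m F\<close> is a copy of \<open>F\<close>,
    scaled by \<open>\<bar>a\<^sub>m\<bar>\<^sup>-\<^sup>2\<close> with bounded distortion.

  \<^item> A point \<open>w\<close> of \<open>F\<close> has distance at most \<open>K (1 - \<bar>w\<bar>)\<close> from the boundary at infinity of \<open>F\<close>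
    (\<open>near_ideal\<close>), since the sides of \<open>F\<close> are orthogonal to the circle.

  Fix a disk of radius \<open>r\<close> about a boundary point \<open>\<zeta>\<close>. The tiles cover the unit disk. Since
  \<open>\<bar>\<mu>\<bar>\<^sup>2 / (1 - \<bar>z\<bar>\<^sup>2) dx dy\<close> scales like \<open>\<bar>m'\<bar>\<close>, a tile with \<open>\<bar>a\<^sub>m\<bar>\<^sup>-\<^sup>2 \<le> r\<close> carries mass of order at most
  \<open>\<bar>a\<^sub>m\<bar>\<^sup>-\<^sup>2\<close>. For a larger tile, \<open>m\<^sup>-\<^sup>1\<close> takes its part in the disk into a disk of radius
  \<open>\<rho> = 8 r \<bar>a\<^sub>m\<bar>\<^sup>2\<close> about a point of \<open>F\<close> at distance at most \<open>\<rho>\<close> from the circle; by the second fact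
  the hypothesis applies to a comparable disk about an ideal point, and gives mass of order at most
  \<open>r\<close>. So the tile contributes at most a multiple of \<open>s\<^sub>m = min r (\<bar>a\<^sub>m\<bar>\<^sup>-\<^sup>2)\<close>
  (\<open>piece_mass_and_arc\<close>). The sum of the \<open>s\<^sub>m\<close> is controlled by length on the circle: near \<open>\<zeta>\<close> there
  is an arc of length comparable to \<open>s\<^sub>m\<close>, the image under \<open>m\<close> of an arc close to an ideal point, and
  these arcs overlap boundedly often because only finitely many group elements move some point at a
  given distance from the limit set to another such point (\<open>tame_overlap\<close>). All arcs lie within distance of order \<open>r\<close> from
  \<open>\<zeta>\<close>, so the sum is of order \<open>r\<close> (\<open>sum_radii_overlap_le\<close>).

  The first fact is where finite generation and the absence of parabolics enter. Suppose that \<open>\<xi>\<close> is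
  a limit point in the closure of \<open>F\<close>, and put \<open>\<xi>\<close> at infinity in the upper half-plane. Then the orbit
  of \<open>0\<close> stays below height \<open>1\<close>, but is horizontally unbounded. Join the orbit by the translates of
  the segments from \<open>0\<close> to \<open>t 0\<close>, for generators \<open>t\<close>. This graph is connected and of bounded height,
  so it has a highest point on each vertical line of one side, and infinitely many group elements
  \<open>m\<close> carry such points. Pulled back by \<open>m\<close>, the vertical ray above it is a ray from a point of one of
  finitely many segments to \<open>m\<^sup>-\<^sup>1 \<xi>\<close>, and it misses the graph. These endpoints are distinct: otherwise
  a nontrivial element fixes \<open>\<xi>\<close>, but a hyperbolic one would move \<open>0\<close> above height \<open>1\<close> and parabolic ones
  are excluded. By the pigeonhole principle three of the rays start on the same segment, on the same
  side, with no edge crossing the segment between their starting points. The connected graph cannot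
  enter the regions between these rays, so the orbit does not accumulate at the middle endpoint.
  This endpoint is an image of \<open>\<xi>\<close>, a contradiction (\<open>orbit_away\<close>).
\<close>

section \<open>Moebius transformations of the disk as matrices\<close>

type_synonym mat = "complex \<times> complex"

text \<open>\<open>\<bar>den m z\<bar>\<^sup>-\<^sup>2\<close> is the modulus of the derivative of \<open>mob m\<close> at \<open>z\<close>. Pairs are not
  restricted to \<^const>\<open>SU11\<close> here, so that the matrix identities below need few side conditions.\<close>

definition den :: "mat \<Rightarrow> complex \<Rightarrow> complex"
  where "den m z = cnj (snd m) * z + cnj (fst m)"

definition mob :: "mat \<Rightarrow> complex \<Rightarrow> complex"
  where "mob m z = (fst m * z + snd m) / den m z"

definition mmul :: "mat \<Rightarrow> mat \<Rightarrow> mat"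
  where "mmul p q = (fst p * fst q + snd p * cnj (snd q), fst p * snd q + snd p * cnj (fst q))"

definition minv :: "mat \<Rightarrow> mat"
  where "minv m = (cnj (fst m), - snd m)"

lemma SU11_iff: "m \<in> SU11 \<longleftrightarrow> (cmod (fst m))\<^sup>2 - (cmod (snd m))\<^sup>2 = 1"
  by (cases m) (simp add: SU11_def)

lemma SU11_cnj: "m \<in> SU11 \<longleftrightarrow> fst m * cnj (fst m) - snd m * cnj (snd m) = 1"
proof -
  have "fst m * cnj (fst m) - snd m * cnj (snd m) = of_real ((cmod (fst m))\<^sup>2 - (cmod (snd m))\<^sup>2)"
    by (metis complex_norm_square of_real_diff)
  then show ?thesis unfolding SU11_iff by (metis of_real_1 of_real_eq_iff)
qed

lemma SU11_cmod: assumes "m \<in> SU11"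
  shows "cmod (snd m) < cmod (fst m)" "1 \<le> cmod (fst m)"
proof -
  have *: "(cmod (fst m))\<^sup>2 = (cmod (snd m))\<^sup>2 + 1" using assms SU11_iff by simp
  then have "(cmod (snd m))\<^sup>2 < (cmod (fst m))\<^sup>2" by simp
  then show "cmod (snd m) < cmod (fst m)" using power_less_imp_less_base by fastforce
  have "1\<^sup>2 \<le> (cmod (fst m))\<^sup>2" using * by simp
  then show "1 \<le> cmod (fst m)" by (rule power2_le_imp_le) simp
qed

lemma den_lower: assumes "m \<in> SU11" shows "cmod (fst m) * (1 - cmod z) \<le> cmod (den m z)"
proof -
  have "cmod (den m z) \<ge> cmod (fst m) - cmod (snd m) * cmod z"
    unfolding den_def by (metis add.commute complex_mod_cnj norm_diff_ineq norm_mult)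
  moreover have "cmod (snd m) * cmod z \<le> cmod (fst m) * cmod z"
    using SU11_cmod[OF assms] by (intro mult_right_mono) auto
  ultimately show ?thesis by (simp add: algebra_simps)
qed

lemma den_upper: assumes "m \<in> SU11" "cmod z \<le> 1" shows "cmod (den m z) \<le> 2 * cmod (fst m)"
proof -
  have "cmod (den m z) \<le> cmod (snd m) * cmod z + cmod (fst m)"
    unfolding den_def by (metis complex_mod_cnj norm_mult norm_triangle_ineq)
  moreover have "cmod (snd m) * cmod z \<le> cmod (fst m) * 1"
    using SU11_cmod[OF assms(1)] assms(2) by (intro mult_mono) auto
  ultimately show ?thesis by simp
qed

lemma den_nz: assumes "m \<in> SU11" "cmod z \<le> 1" shows "den m z \<noteq> 0"
proof
  assume "den m z = 0"
  then have "cmod (fst m) = cmod (snd m) * cmod z"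
    unfolding den_def by (metis add_eq_0_iff complex_mod_cnj norm_minus_cancel norm_mult)
  also have "\<dots> \<le> cmod (snd m) * 1" using assms(2) by (intro mult_left_mono) auto
  finally show False using SU11_cmod[OF assms(1)] by simp
qed

lemma mmul_SU11: assumes "p \<in> SU11" "q \<in> SU11" shows "mmul p q \<in> SU11"
proof -
  have "fst (mmul p q) * cnj (fst (mmul p q)) - snd (mmul p q) * cnj (snd (mmul p q))
     = (fst p * cnj (fst p) - snd p * cnj (snd p)) * (fst q * cnj (fst q) - snd q * cnj (snd q))"
    by (simp add: mmul_def algebra_simps)
  then show ?thesis using assms unfolding SU11_cnj by simp
qed

lemma minv_SU11: "m \<in> SU11 \<Longrightarrow> minv m \<in> SU11"
  by (simp add: minv_def SU11_iff)

lemma one_SU11: "(1, 0) \<in> SU11"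
  by (simp add: SU11_def)

lemma mmul_minv: assumes "m \<in> SU11" shows "mmul m (minv m) = (1,0)" "mmul (minv m) m = (1,0)"
  using assms unfolding SU11_cnj mmul_def minv_def by (auto simp: algebra_simps)

lemma minv_minv [simp]: "minv (minv m) = m"
  by (simp add: minv_def)

lemma mmul_assoc: "mmul (mmul p q) r = mmul p (mmul q r)"
  by (simp add: mmul_def algebra_simps)

lemma mmul_one [simp]: "mmul (1,0) m = m" "mmul m (1,0) = m"
  by (simp_all add: mmul_def)

lemma mob_one [simp]: "mob (1,0) z = z"
  by (simp add: mob_def den_def)

lemma den_one [simp]: "den (1,0) z = 1"
  by (simp add: den_def)

lemma fst_minv [simp]: "fst (minv m) = cnj (fst m)"
  by (simp add: minv_def)

lemma mob_den: assumes "m \<in> SU11" "cmod z \<le> 1"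
  shows "mob m z * den m z = fst m * z + snd m"
  using den_nz[OF assms] by (simp add: mob_def)

lemma den_mmul: assumes "q \<in> SU11" "cmod z \<le> 1"
  shows "den (mmul p q) z = den p (mob q z) * den q z"
proof -
  have "den p (mob q z) * den q z = cnj (snd p) * (mob q z * den q z) + cnj (fst p) * den q z"
    by (simp add: den_def[of p] algebra_simps)
  also have "\<dots> = den (mmul p q) z"
    unfolding mob_den[OF assms] by (simp add: den_def mmul_def algebra_simps)
  finally show ?thesis by simp
qed

lemma mob_mmul: assumes "q \<in> SU11" "cmod z \<le> 1"
  shows "mob (mmul p q) z = mob p (mob q z)"
proof -
  have nz: "den q z \<noteq> 0" by (rule den_nz[OF assms])
  have "fst (mmul p q) * z + snd (mmul p q) = (fst p * mob q z + snd p) * den q z"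
  proof -
    have "(fst p * mob q z + snd p) * den q z = fst p * (mob q z * den q z) + snd p * den q z"
      by (simp add: algebra_simps)
    also have "\<dots> = fst (mmul p q) * z + snd (mmul p q)"
      unfolding mob_den[OF assms] by (simp add: den_def mmul_def algebra_simps)
    finally show ?thesis by simp
  qed
  then show ?thesis using nz unfolding mob_def[of "mmul p q"] den_mmul[OF assms]
    by (simp add: mob_def)
qed

lemma mob_minus: "mob (- m) z = mob m z" "den (- m) z = - den m z"
proof -
  have d: "den (- m) z = - den m z" by (simp add: den_def)
  have "fst (- m) * z + snd (- m) = - (fst m * z + snd m)" by simp
  then show "mob (- m) z = mob m z" unfolding mob_def d by (simp only: minus_divide_divide)
  show "den (- m) z = - den m z" by (rule d)
qed

text \<open>Together with \<open>mob_dist\<close> this identity is behind all estimates: the boundary distance scales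
  by the derivative, and chords by the geometric mean of the derivatives at their ends.\<close>

lemma one_minus_mob: assumes "m \<in> SU11" "cmod z \<le> 1"
  shows "1 - (cmod (mob m z))\<^sup>2 = (1 - (cmod z)\<^sup>2) / (cmod (den m z))\<^sup>2"
proof -
  have nz: "den m z \<noteq> 0" by (rule den_nz[OF assms])
  have "den m z * cnj (den m z) - (fst m * z + snd m) * cnj (fst m * z + snd m)
     = (fst m * cnj (fst m) - snd m * cnj (snd m)) * (1 - z * cnj z)"
    by (simp add: den_def algebra_simps)
  also have "\<dots> = 1 - z * cnj z" using assms(1) SU11_cnj by simp
  finally have "of_real ((cmod (den m z))\<^sup>2 - (cmod (fst m * z + snd m))\<^sup>2) = (of_real (1 - (cmod z)\<^sup>2)::complex)"
    by (simp only: complex_norm_square of_real_diff of_real_1)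
  then have "(cmod (den m z))\<^sup>2 - (cmod (fst m * z + snd m))\<^sup>2 = 1 - (cmod z)\<^sup>2"
    using of_real_eq_iff by blast
  then show ?thesis using nz unfolding mob_def
    by (simp add: norm_divide power_divide field_simps)
qed

lemma mob_le_1: assumes "m \<in> SU11" "cmod z \<le> 1" shows "cmod (mob m z) \<le> 1"
proof -
  have "0 \<le> 1 - (cmod (mob m z))\<^sup>2" unfolding one_minus_mob[OF assms]
    using assms(2) by (simp add: abs_square_le_1)
  then show ?thesis by (simp add: abs_square_le_1)
qed

lemma mob_less_1: assumes "m \<in> SU11" "cmod z < 1" shows "cmod (mob m z) < 1"
proof -
  have "0 < 1 - (cmod (mob m z))\<^sup>2" unfolding one_minus_mob[OF assms(1) less_imp_le[OF assms(2)]]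
    using assms den_nz[of m z] by (simp add: abs_square_less_1)
  then show ?thesis by (simp add: abs_square_less_1)
qed

lemma mob_eq_1: assumes "m \<in> SU11" "cmod z = 1" shows "cmod (mob m z) = 1"
proof -
  have "0 = 1 - (cmod (mob m z))\<^sup>2" using one_minus_mob[of m z] assms by simp
  then have "(cmod (mob m z))\<^sup>2 = 1" by simp
  then show ?thesis using norm_ge_zero[of "mob m z"] unfolding power2_eq_1_iff by linarith
qed

lemma mob_diff: assumes "m \<in> SU11" "cmod z \<le> 1" "cmod w \<le> 1"
  shows "mob m z - mob m w = (z - w) / (den m z * den m w)"
proof -
  have nz: "den m z \<noteq> 0" "den m w \<noteq> 0" using assms den_nz by auto
  have "(fst m * z + snd m) * den m w - (fst m * w + snd m) * den m z
     = (fst m * cnj (fst m) - snd m * cnj (snd m)) * (z - w)"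
    by (simp add: den_def algebra_simps)
  also have "\<dots> = z - w" using assms(1) SU11_cnj by simp
  finally show ?thesis using nz unfolding mob_def by (simp add: field_simps)
qed

lemma mob_dist: assumes "m \<in> SU11" "cmod z \<le> 1" "cmod w \<le> 1"
  shows "cmod (mob m z - mob m w) = cmod (z - w) / (cmod (den m z) * cmod (den m w))"
  unfolding mob_diff[OF assms] by (simp add: norm_divide norm_mult)

lemma mob_minv: assumes "m \<in> SU11" "cmod z \<le> 1"
  shows "mob m (mob (minv m) z) = z" "mob (minv m) (mob m z) = z"
  using mob_mmul[OF minv_SU11[OF assms(1)] assms(2), of m]
    mob_mmul[OF assms, of "minv m"] mmul_minv[OF assms(1)] by auto

lemma den_minv: assumes "m \<in> SU11" "cmod z \<le> 1"
  shows "den (minv m) (mob m z) * den m z = 1"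
  using den_mmul[OF assms, of "minv m"] mmul_minv[OF assms(1)] by simp

lemma continuous_den: "continuous_on S (den m)"
  unfolding den_def by (intro continuous_intros)

lemma continuous_mob: assumes "m \<in> SU11" shows "continuous_on (cball 0 1) (mob m)"
  unfolding mob_def by (intro continuous_intros continuous_den) (use den_nz[OF assms] in auto)

lemma mob_0: "mob m 0 = snd m / cnj (fst m)"
  by (simp add: mob_def den_def)

text \<open>Only matrices of bounded size move a point of a compact part of the disk into another compact
  part. With local finiteness this makes the group act properly discontinuously.\<close>

lemma fst_bounded_if_mob_bounded:
  assumes m: "m \<in> SU11" and w: "cmod w \<le> \<rho>" "\<rho> < 1" and R: "cmod (mob m w) \<le> R" "R < 1"
  shows "cmod (fst m) \<le> 1 / ((1 - R\<^sup>2) * (1 - \<rho>)\<^sup>2)"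
proof -
  have w1: "cmod w \<le> 1" using w by simp
  have "0 \<le> R" using R(1) norm_ge_zero order_trans by blast
  then have R2: "1 - R\<^sup>2 > 0" using R(2) by (simp add: abs_square_less_1)
  have d: "cmod (den m w) > 0" using den_nz[OF m w1] by simp
  have "1 - R\<^sup>2 \<le> 1 - (cmod (mob m w))\<^sup>2" using R(1) by (simp add: power_mono)
  also have "\<dots> \<le> 1 / (cmod (den m w))\<^sup>2" unfolding one_minus_mob[OF m w1]
    by (intro divide_right_mono) auto
  finally have "(1 - R\<^sup>2) * (cmod (den m w))\<^sup>2 \<le> 1" using d by (simp add: field_simps)
  moreover have "cmod (fst m) * (1 - \<rho>) \<le> cmod (den m w)"
  proof -
    have "cmod (fst m) * (1 - \<rho>) \<le> cmod (fst m) * (1 - cmod w)" using w(1) by (intro mult_left_mono) auto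
    then show ?thesis using den_lower[OF m, of w] by simp
  qed
  then have "(cmod (fst m) * (1 - \<rho>))\<^sup>2 \<le> (cmod (den m w))\<^sup>2"
    using w(2) by (intro power_mono) auto
  then have "(1 - R\<^sup>2) * (cmod (fst m) * (1 - \<rho>))\<^sup>2 \<le> (1 - R\<^sup>2) * (cmod (den m w))\<^sup>2"
    using R2 by (intro mult_left_mono) auto
  ultimately have "(cmod (fst m))\<^sup>2 * ((1 - R\<^sup>2) * (1 - \<rho>)\<^sup>2) \<le> 1"
    by (simp add: power_mult_distrib mult.assoc mult.left_commute)
  then have "(cmod (fst m))\<^sup>2 \<le> 1 / ((1 - R\<^sup>2) * (1 - \<rho>)\<^sup>2)" using R2 w(2) by (simp add: field_simps)
  moreover have "cmod (fst m) \<le> (cmod (fst m))\<^sup>2" using SU11_cmod(2)[OF m] by (intro self_le_power) auto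
  ultimately show ?thesis by simp
qed

text \<open>For \<open>\<bar>z\<bar> = 1\<close> the last factor is the distance of \<open>z\<close> from the orbit point \<open>m\<^sup>-\<^sup>1 0\<close>. So a point
  far from the orbit of \<open>0\<close> is one where \<open>den m\<close> has its maximal order \<open>\<bar>fst m\<bar>\<close>.\<close>

lemma den_via_orbit: assumes "m \<in> SU11"
  shows "cmod (den m z) = cmod (fst m) * cmod (1 - cnj (mob (minv m) 0) * z)"
proof -
  have "fst m \<noteq> 0" using SU11_cmod[OF assms] by auto
  then have "den m z = cnj (fst m) * (1 - cnj (mob (minv m) 0) * z)"
    unfolding mob_0 den_def by (simp add: minv_def field_simps)
  then show ?thesis by (simp add: norm_mult)
qed

lemma cmod_one_minus_cnj: assumes "cmod z = 1" shows "cmod (1 - cnj p * z) = cmod (z - p)"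
proof -
  have "z * cnj z = 1" using assms by (metis complex_norm_square of_real_1 one_power2)
  then have "1 - cnj p * z = z * cnj (z - p)" by (simp add: algebra_simps)
  then have "cmod (1 - cnj p * z) = cmod z * cmod (cnj (z - p))" by (metis norm_mult)
  then show ?thesis unfolding complex_mod_cnj using assms by simp
qed

section \<open>Half-plane coordinates centred at a boundary point\<close>

text \<open>The Cayley map of the disk onto the upper half-plane that takes \<open>\<eta>\<close> to infinity and \<open>0\<close> to \<open>\<i>\<close>.
  Its imaginary part is the Poisson kernel, whose level sets are the horocycles at \<open>\<eta>\<close>; the level
  sets of its real part are the geodesics that end at \<open>\<eta>\<close>.\<close>

definition cay :: "complex \<Rightarrow> complex \<Rightarrow> complex"
  where "cay \<eta> z = \<i> * (\<eta> + z) / (\<eta> - z)"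

lemma cmod1_Re_Im: assumes "cmod \<eta> = 1" shows "(Re \<eta>)\<^sup>2 + (Im \<eta>)\<^sup>2 = 1"
  using assms by (metis cmod_power2 one_power2)

lemma cay_eq: assumes "cmod \<eta> = 1" "z \<noteq> \<eta>"
  shows "Im (cay \<eta> z) = (1 - (cmod z)\<^sup>2) / (cmod (\<eta> - z))\<^sup>2"
    and "Re (cay \<eta> z) = 2 * (Im \<eta> * Re z - Re \<eta> * Im z) / (cmod (\<eta> - z))\<^sup>2"
proof -
  have nz: "\<eta> - z \<noteq> 0" using assms by auto
  have 1: "(Re \<eta>)\<^sup>2 + (Im \<eta>)\<^sup>2 = 1" by (rule cmod1_Re_Im[OF assms(1)])
  have c: "cay \<eta> z = (\<i> * (\<eta> + z) * cnj (\<eta> - z)) / of_real ((cmod (\<eta> - z))\<^sup>2)"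
    unfolding cay_def using nz by (subst complex_norm_square) (simp add: divide_simps)
  have "Im (\<i> * (\<eta> + z) * cnj (\<eta> - z)) = 1 - (cmod z)\<^sup>2"
    using 1 unfolding cmod_power2 by (simp add: power2_eq_square algebra_simps)
  then show "Im (cay \<eta> z) = (1 - (cmod z)\<^sup>2) / (cmod (\<eta> - z))\<^sup>2"
    unfolding c Im_divide_of_real by simp
  have "Re (\<i> * (\<eta> + z) * cnj (\<eta> - z)) = 2 * (Im \<eta> * Re z - Re \<eta> * Im z)"
    by (simp add: algebra_simps)
  then show "Re (cay \<eta> z) = 2 * (Im \<eta> * Re z - Re \<eta> * Im z) / (cmod (\<eta> - z))\<^sup>2"
    unfolding c Re_divide_of_real by simp
qed

lemma cay_plus_i: assumes "z \<noteq> \<eta>" "cmod \<eta> = 1"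
  shows "(Re (cay \<eta> z))\<^sup>2 + (Im (cay \<eta> z) + 1)\<^sup>2 = 4 / (cmod (\<eta> - z))\<^sup>2"
proof -
  have "cay \<eta> z + \<i> = 2 * \<i> * \<eta> / (\<eta> - z)" using assms by (simp add: cay_def field_simps)
  then have "(cmod (cay \<eta> z + \<i>))\<^sup>2 = 4 / (cmod (\<eta> - z))\<^sup>2"
    using assms by (simp add: norm_divide norm_mult power_divide)
  then show ?thesis by (simp add: cmod_power2)
qed

text \<open>Both sides vanish on the real diameter, which is a half-circle orthogonal to the real axis in
  the half-plane; the identity compares the signs on its two sides.\<close>

lemma cay_Im: assumes "cmod \<eta> = 1" "z \<noteq> \<eta>"
  shows "Im \<eta> * ((Re (cay \<eta> z))\<^sup>2 + (Im (cay \<eta> z))\<^sup>2 - 1) - 2 * Re \<eta> * Re (cay \<eta> z)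
    = Im z * (4 / (cmod (\<eta> - z))\<^sup>2)"
proof -
  define d where "d = (cmod (\<eta> - z))\<^sup>2"
  have d: "d > 0" using assms by (simp add: d_def)
  have 1: "(Re \<eta>)\<^sup>2 + (Im \<eta>)\<^sup>2 = 1" by (rule cmod1_Re_Im[OF assms(1)])
  have "(Re (cay \<eta> z))\<^sup>2 + (Im (cay \<eta> z))\<^sup>2 - 1 = 4 / d - 2 * Im (cay \<eta> z) - 2"
    using cay_plus_i[OF assms(2,1)] unfolding d_def[symmetric] by (simp add: power2_eq_square algebra_simps)
  also have "\<dots> = (4 - 2 * (1 - (cmod z)\<^sup>2) - 2 * d) / d"
    using d unfolding cay_eq(1)[OF assms] d_def[symmetric] by (simp add: field_simps)
  also have "4 - 2 * (1 - (cmod z)\<^sup>2) - 2 * d = 4 * (Re \<eta> * Re z + Im \<eta> * Im z)"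
    using 1 unfolding d_def cmod_power2 by (simp add: power2_eq_square algebra_simps)
  finally have e: "(Re (cay \<eta> z))\<^sup>2 + (Im (cay \<eta> z))\<^sup>2 - 1 = 4 * (Re \<eta> * Re z + Im \<eta> * Im z) / d" .
  have "Im \<eta> * (4 * (Re \<eta> * Re z + Im \<eta> * Im z)) - 2 * Re \<eta> * (2 * (Im \<eta> * Re z - Re \<eta> * Im z))
     = 4 * Im z * ((Re \<eta>)\<^sup>2 + (Im \<eta>)\<^sup>2)" by (simp add: power2_eq_square algebra_simps)
  then have f: "Im \<eta> * (4 * (Re \<eta> * Re z + Im \<eta> * Im z)) - 2 * Re \<eta> * (2 * (Im \<eta> * Re z - Re \<eta> * Im z)) = 4 * Im z"
    using 1 by simp
  have "Im \<eta> * (4 * (Re \<eta> * Re z + Im \<eta> * Im z) / d) - 2 * Re \<eta> * (2 * (Im \<eta> * Re z - Re \<eta> * Im z) / d)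
     = (Im \<eta> * (4 * (Re \<eta> * Re z + Im \<eta> * Im z)) - 2 * Re \<eta> * (2 * (Im \<eta> * Re z - Re \<eta> * Im z))) / d"
    by (simp only: diff_divide_distrib times_divide_eq_right)
  also have "\<dots> = Im z * (4 / d)" unfolding f by simp
  finally show ?thesis unfolding e unfolding cay_eq(2)[OF assms] d_def[symmetric] .
qed

lemma cay_Im_pos: assumes "cmod \<eta> = 1" "cmod z < 1" shows "Im (cay \<eta> z) > 0"
proof -
  have "z \<noteq> \<eta>" using assms by auto
  then show ?thesis using assms by (simp add: cay_eq abs_square_less_1)
qed

lemma cay_zero: "cmod \<eta> = 1 \<Longrightarrow> cay \<eta> 0 = \<i>"
  by (auto simp: cay_def)

lemma continuous_cay: assumes "cmod \<eta> = 1" "\<eta> \<notin> S" shows "continuous_on S (cay \<eta>)"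
  unfolding cay_def using assms by (intro continuous_intros) auto

lemma cay_rotate: assumes "cmod u = 1" shows "cay (u * \<eta>) (u * z) = cay \<eta> z"
proof -
  have "u \<noteq> 0" using assms by auto
  moreover have "cay (u * \<eta>) (u * z) = (u * (\<i> * (\<eta> + z))) / (u * (\<eta> - z))"
    by (simp add: cay_def algebra_simps)
  ultimately show ?thesis by (simp add: cay_def)
qed

text \<open>A conformal map of the half-plane that fixes infinity is affine; its factor is
  \<open>1 / \<bar>m' \<eta>\<bar>\<close>. In particular \<open>m\<close> maps the geodesics that end at \<open>\<eta>\<close> to those that end at
  \<open>m \<eta>\<close>.\<close>

lemma cay_mob: assumes "m \<in> SU11" "cmod \<eta> = 1" "cmod z \<le> 1" "z \<noteq> \<eta>"
  shows "cay (mob m \<eta>) (mob m z)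
    = of_real ((cmod (den m \<eta>))\<^sup>2) * cay \<eta> z + of_real (2 * Im (fst m * cnj (snd m) * \<eta>))"
proof -
  define a b where "a = fst m" and "b = snd m"
  define dz de where "dz = den m z" and "de = den m \<eta>"
  have nz: "dz \<noteq> 0" "de \<noteq> 0" unfolding dz_def de_def using den_nz[OF assms(1)] assms by auto
  have s: "a * cnj a - b * cnj b = 1" using assms(1) unfolding SU11_cnj a_def b_def .
  have ee: "\<eta> * cnj \<eta> = 1" using assms(2) by (metis complex_norm_square of_real_1 one_power2)
  have N: "of_real ((cmod de)\<^sup>2) = de * cnj de" by (rule complex_norm_square)
  have k: "of_real (2 * Im (a * cnj b * \<eta>)) = - \<i> * (a * cnj b * \<eta> - cnj a * b * cnj \<eta>)"
  proof -
    have "a * cnj b * \<eta> - cnj (a * cnj b * \<eta>) = of_real (2 * Im (a * cnj b * \<eta>)) * \<i>"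
      unfolding complex_diff_cnj by (simp only: ac_simps)
    moreover have "cnj (a * cnj b * \<eta>) = cnj a * b * cnj \<eta>" by simp
    ultimately have e: "a * cnj b * \<eta> - cnj a * b * cnj \<eta> = of_real (2 * Im (a * cnj b * \<eta>)) * \<i>"
      by (simp only:)
    have "- \<i> * (of_real t * \<i>) = of_real t" for t by (simp add: complex_eq_iff)
    then show ?thesis unfolding e by (simp only:)
  qed
  have D: "mob m \<eta> - mob m z = (\<eta> - z) / (de * dz)"
    unfolding de_def dz_def using mob_diff[of m \<eta> z] assms by simp
  have S: "mob m \<eta> + mob m z = ((a * \<eta> + b) * dz + (a * z + b) * de) / (de * dz)"
    using nz unfolding mob_def a_def b_def dz_def de_def by (simp add: field_simps)
  have "cay (mob m \<eta>) (mob m z) = \<i> * ((a * \<eta> + b) * dz + (a * z + b) * de) / (\<eta> - z)"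
    unfolding cay_def D S using nz by simp
  moreover have "(a * \<eta> + b) * dz + (a * z + b) * de = de * cnj de * (\<eta> + z)
      - (a * cnj b * \<eta> - cnj a * b * cnj \<eta>) * (\<eta> - z)"
    (is "?l = ?r")
  proof -
    have "?r = (cnj b * \<eta> + cnj a) * (b * cnj \<eta> + a) * (\<eta> + z)
      - (a * cnj b * \<eta> - cnj a * b * cnj \<eta>) * (\<eta> - z)"
      by (simp add: de_def den_def a_def b_def)
    also have "\<dots> = b * cnj b * \<eta> * (\<eta> * cnj \<eta>) + b * cnj b * (\<eta> * cnj \<eta>) * z
       + 2 * a * cnj b * \<eta> * z + a * cnj a * (\<eta> + z) + 2 * cnj a * b * (\<eta> * cnj \<eta>)"
      by (simp add: algebra_simps)
    also have "\<dots> = ?l" unfolding ee by (simp add: dz_def de_def den_def a_def b_def algebra_simps)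
    finally show ?thesis by simp
  qed
  ultimately have "cay (mob m \<eta>) (mob m z) = \<i> * (de * cnj de * (\<eta> + z)
      - (a * cnj b * \<eta> - cnj a * b * cnj \<eta>) * (\<eta> - z)) / (\<eta> - z)" by simp
  also have "\<dots> = de * cnj de * cay \<eta> z - \<i> * (a * cnj b * \<eta> - cnj a * b * cnj \<eta>)"
  proof -
    have "\<eta> - z \<noteq> 0" using assms by auto
    then have "\<i> * (A * (\<eta> + z) - B * (\<eta> - z)) / (\<eta> - z) = A * (\<i> * (\<eta> + z) / (\<eta> - z)) - \<i> * B" for A B
      by (simp add: divide_simps) (simp add: algebra_simps)
    then show ?thesis unfolding cay_def .
  qed
  finally show ?thesis using N k unfolding a_def b_def de_def by simp
qed

subsection \<open>Three crosscuts from a diameter\<close>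

lemma cay_real_mono: assumes "cmod \<eta> = 1" "Im \<eta> > 0" "-1 \<le> x" "x < y" "y \<le> 1"
  shows "Re (cay \<eta> (of_real x)) < Re (cay \<eta> (of_real y))"
proof -
  have 1: "(Re \<eta>)\<^sup>2 + (Im \<eta>)\<^sup>2 = 1" by (rule cmod1_Re_Im[OF assms(1)])
  have ne: "of_real t \<noteq> \<eta>" for t using assms(2) by auto
  have d: "(cmod (\<eta> - of_real t))\<^sup>2 = 1 + t\<^sup>2 - 2 * t * Re \<eta>" for t
    using 1 unfolding cmod_power2 by (simp add: power2_eq_square algebra_simps)
  have dp: "1 + t\<^sup>2 - 2 * t * Re \<eta> > 0" for t unfolding d[symmetric] using ne[of t] by simp
  have xy: "x * y < 1"
  proof -
    have "(1 - x * y) * 2 = (1 - x) * (1 + y) + (1 + x) * (1 - y)" by (simp add: algebra_simps)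
    moreover have "(1 - x) * (1 + y) > 0" using assms by (intro mult_pos_pos) auto
    moreover have "(1 + x) * (1 - y) \<ge> 0" using assms by (intro mult_nonneg_nonneg) auto
    ultimately have "(1 - x * y) * 2 > 0" by linarith
    then show ?thesis by simp
  qed
  have "y * (1 + x\<^sup>2 - 2 * x * Re \<eta>) - x * (1 + y\<^sup>2 - 2 * y * Re \<eta>) = (y - x) * (1 - x * y)"
    by (simp add: power2_eq_square algebra_simps)
  moreover have "(y - x) * (1 - x * y) > 0" using assms(4) xy by simp
  ultimately have "x * (1 + y\<^sup>2 - 2 * y * Re \<eta>) < y * (1 + x\<^sup>2 - 2 * x * Re \<eta>)" by linarith
  then have "2 * Im \<eta> * x * (1 + y\<^sup>2 - 2 * y * Re \<eta>) < 2 * Im \<eta> * y * (1 + x\<^sup>2 - 2 * x * Re \<eta>)"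
    using assms(2) by (simp add: mult.assoc)
  then show ?thesis using dp[of x] dp[of y] unfolding cay_eq(2)[OF assms(1) ne] d
    by (simp add: divide_simps)
qed

text \<open>In the half-plane the diameter is a half-circle, and the side \<open>Im z > 0\<close> is its outside. On a
  vertical line through a point of the half-circle, the outside is the part above that point.\<close>

lemma cay_above_diameter: assumes "cmod \<eta> = 1" "Im \<eta> > 0" "cmod z < 1" "Im z > 0" "\<bar>q\<bar> < 1"
    and "Re (cay \<eta> z) = Re (cay \<eta> (of_real q))"
  shows "Im (cay \<eta> z) > Im (cay \<eta> (of_real q))"
proof -
  have ne: "z \<noteq> \<eta>" "of_real q \<noteq> \<eta>" using assms by auto
  have "Im z * (4 / (cmod (\<eta> - z))\<^sup>2) > 0" using assms ne by simp
  then have "Im \<eta> * ((Im (cay \<eta> (of_real q)))\<^sup>2) < Im \<eta> * ((Im (cay \<eta> z))\<^sup>2)"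
    using cay_Im[OF assms(1) ne(1)] cay_Im[OF assms(1) ne(2)] unfolding assms(6)
    by (simp add: algebra_simps)
  then have "(Im (cay \<eta> (of_real q)))\<^sup>2 < (Im (cay \<eta> z))\<^sup>2" using assms(2) by simp
  then show ?thesis using cay_Im_pos[OF assms(1,3)] by (meson less_imp_le power_less_imp_less_base)
qed

text \<open>The real coordinate of \<open>cay \<eta>\<close> maps the open upper half-circle minus \<open>\<eta>\<close> onto the outside of the
  interval onto which it maps the diameter, with the points to the right of \<open>\<eta>\<close> going above the
  interval.\<close>

lemma cay_order: assumes "cmod \<eta> = 1" "cmod \<zeta> = 1" "Im \<eta> > 0" "Im \<zeta> > 0" "\<bar>q\<bar> < 1"
  shows "Re \<eta> < Re \<zeta> \<Longrightarrow> Re (cay \<eta> (of_real q)) < Re (cay \<eta> \<zeta>)"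
    and "Re \<zeta> < Re \<eta> \<Longrightarrow> Re (cay \<eta> \<zeta>) < Re (cay \<eta> (of_real q))"
proof -
  define X where "X = (\<lambda>z. Re (cay \<eta> z))"
  have ne1: "1 \<noteq> \<eta>" "-1 \<noteq> \<eta>" using assms by auto
  have q1: "of_real q \<noteq> \<eta>" using assms by auto
  have 1: "(Re \<eta>)\<^sup>2 + (Im \<eta>)\<^sup>2 = 1" "(Re \<zeta>)\<^sup>2 + (Im \<zeta>)\<^sup>2 = 1" using cmod1_Re_Im assms by auto
  have q: "X (-1) < X (of_real q)" "X (of_real q) < X 1"
    using cay_real_mono[OF assms(1,3), of "-1" q] cay_real_mono[OF assms(1,3), of q 1] assms(5)
    unfolding X_def by auto
  have r: "Im \<eta> * ((X 1)\<^sup>2 - 1) = 2 * Re \<eta> * X 1" "Im \<eta> * ((X (-1))\<^sup>2 - 1) = 2 * Re \<eta> * X (-1)"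
    using cay_Im[OF assms(1), of 1] cay_Im[OF assms(1), of "-1"] ne1 unfolding X_def
    by (simp_all add: cay_eq(1)[OF assms(1)])
  have "X 1 = 2 * Im \<eta> / (cmod (\<eta> - 1))\<^sup>2" "X (-1) = - (2 * Im \<eta>) / (cmod (\<eta> - (-1)))\<^sup>2"
    using cay_eq(2)[OF assms(1), of 1] cay_eq(2)[OF assms(1), of "-1"] ne1 unfolding X_def by auto
  moreover have "(cmod (\<eta> - 1))\<^sup>2 > 0" "(cmod (\<eta> - (-1)))\<^sup>2 > 0" using ne1
    by (simp_all only: zero_less_power2 norm_eq_zero right_minus_eq)
  ultimately have sgn1: "X 1 > 0" "X (-1) < 0" using assms(3)
    by (metis divide_pos_pos zero_less_mult_iff zero_less_numeral, metis divide_neg_pos neg_less_0_iff_less zero_less_mult_iff zero_less_numeral)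
  have *: "X \<zeta> > X 1 \<or> X \<zeta> < X (-1)" if "\<zeta> \<noteq> \<eta>"
  proof -
    have "Im \<zeta> * (4 / (cmod (\<eta> - \<zeta>))\<^sup>2) > 0" using that assms by simp
    moreover have "Im (cay \<eta> \<zeta>) = 0" using cay_eq(1)[OF assms(1) that] assms(2) by simp
    ultimately have g: "Im \<eta> * ((X \<zeta>)\<^sup>2 - 1) > 2 * Re \<eta> * X \<zeta>"
      using cay_Im[OF assms(1) that] unfolding X_def by simp
    have d: "Im \<eta> * ((X 1)\<^sup>2 - (X (-1))\<^sup>2) = 2 * Re \<eta> * (X 1 - X (-1))"
      using r by (simp add: algebra_simps)
    then have "(X 1 - X (-1)) * (Im \<eta> * (X 1 + X (-1)) - 2 * Re \<eta>) = 0"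
      by (simp add: power2_eq_square algebra_simps)
    then have sm: "Im \<eta> * (X 1 + X (-1)) = 2 * Re \<eta>" using sgn1 by simp
    have "(Im \<eta> * (X 1 + X (-1))) * X 1 = Im \<eta> * ((X 1)\<^sup>2 - 1)" using r sm by simp
    then have "Im \<eta> * (X 1 * X (-1) + 1) = 0" by (simp add: power2_eq_square algebra_simps)
    then have pr: "X 1 * X (-1) = -1" using assms(3) by simp
    have "Im \<eta> * ((X \<zeta> - X 1) * (X \<zeta> - X (-1)))
        = Im \<eta> * ((X \<zeta>)\<^sup>2 + X 1 * X (-1)) - Im \<eta> * (X 1 + X (-1)) * X \<zeta>"
      by (simp add: power2_eq_square algebra_simps)
    also have "\<dots> > 0" unfolding sm pr using g by simp
    finally have "(X \<zeta> - X 1) * (X \<zeta> - X (-1)) > 0" using assms(3) by (simp add: zero_less_mult_iff)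
    then show ?thesis using sgn1 by (auto simp: zero_less_mult_iff)
  qed
  \<comment> \<open>The cotangent decreases along the upper half-circle.\<close>
  have cross: "Im b * Re a < Re b * Im a"
    if "(Re a)\<^sup>2 + (Im a)\<^sup>2 = 1" "(Re b)\<^sup>2 + (Im b)\<^sup>2 = 1" "Im a > 0" "Im b > 0" "Re a < Re b" for a b
  proof -
    have sq: "(Re b * Im a)\<^sup>2 - (Im b * Re a)\<^sup>2 = (Re b)\<^sup>2 - (Re a)\<^sup>2"
    proof -
      have i: "(Im a)\<^sup>2 = 1 - (Re a)\<^sup>2" "(Im b)\<^sup>2 = 1 - (Re b)\<^sup>2" using that by auto
      show ?thesis unfolding power_mult_distrib i by (simp add: algebra_simps)
    qed
    consider "Re a \<ge> 0" | "Re a < 0" "Re b \<ge> 0" | "Re b < 0" using that by linarith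
    then show ?thesis
    proof cases
      case 1
      then have "(Re a)\<^sup>2 < (Re b)\<^sup>2" using that by (intro power_strict_mono) auto
      then have "(Im b * Re a)\<^sup>2 < (Re b * Im a)\<^sup>2" using sq by linarith
      then show ?thesis by (rule power_less_imp_less_base) (use 1 that in auto)
    next
      case 2
      have "Im b * Re a < 0" using 2 that by (simp add: mult_pos_neg)
      moreover have "Re b * Im a \<ge> 0" using 2 that by simp
      ultimately show ?thesis by linarith
    next
      case 3
      then have "(- Re b)\<^sup>2 < (- Re a)\<^sup>2" using that by (intro power_strict_mono) auto
      then have "(- (Re b * Im a))\<^sup>2 < (- (Im b * Re a))\<^sup>2" using sq by (simp only: power2_minus)
      then have "- (Re b * Im a) < - (Im b * Re a)"
        by (rule power_less_imp_less_base) (use 3 that in \<open>simp add: mult_pos_neg less_imp_le\<close>)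
      then show ?thesis by simp
    qed
  qed
  have cX: "X \<zeta> = 2 * (Im \<eta> * Re \<zeta> - Re \<eta> * Im \<zeta>) / (cmod (\<eta> - \<zeta>))\<^sup>2" if "\<zeta> \<noteq> \<eta>"
    unfolding X_def by (rule cay_eq(2)[OF assms(1) that])
  {
    assume l: "Re \<eta> < Re \<zeta>"
    then have ne: "\<zeta> \<noteq> \<eta>" by auto
    have "Im \<eta> * Re \<zeta> - Re \<eta> * Im \<zeta> > 0" using cross[OF 1 assms(3,4) l] by (simp add: mult.commute)
    then have "X \<zeta> > 0" using cX[OF ne] ne by simp
    then show "Re (cay \<eta> (of_real q)) < Re (cay \<eta> \<zeta>)" using *[OF ne] q sgn1 unfolding X_def by auto
  next
    assume l: "Re \<zeta> < Re \<eta>"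
    then have ne: "\<zeta> \<noteq> \<eta>" by auto
    have "Im \<eta> * Re \<zeta> - Re \<eta> * Im \<zeta> < 0" using cross[OF 1(2,1) assms(4,3) l] by (simp add: mult.commute)
    then have "X \<zeta> < 0" using cX[OF ne] ne by (simp add: divide_neg_pos)
    then show "Re (cay \<eta> \<zeta>) < Re (cay \<eta> (of_real q))" using *[OF ne] q sgn1 unfolding X_def by auto
  }
qed

text \<open>The part of the upper half-disk between the hyperbolic ray from \<open>q1\<close> to \<open>\<eta>1\<close> and the one
  from \<open>q2\<close> to \<open>\<eta>2\<close>. If the rays cross, it is the part beyond the crossing; the same three
  inequalities describe both cases, so no case distinction arises.\<close>

definition between_rays :: "complex \<Rightarrow> real \<Rightarrow> complex \<Rightarrow> real \<Rightarrow> complex set"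
  where "between_rays \<eta>1 q1 \<eta>2 q2 = {z\<in>\<Delta>. Im z > 0 \<and> Re (cay \<eta>1 z) > Re (cay \<eta>1 (of_real q1))
     \<and> Re (cay \<eta>2 z) < Re (cay \<eta>2 (of_real q2))}"

definition ray :: "complex \<Rightarrow> complex \<Rightarrow> complex set"
  where "ray \<eta> q = {z\<in>\<Delta>. Re (cay \<eta> z) = Re (cay \<eta> q) \<and> Im (cay \<eta> z) > Im (cay \<eta> q)}"

text \<open>The boundary of the region inside the disk consists of parts of the two rays and of the part
  of the diameter between \<open>q1\<close> and \<open>q2\<close>, so a connected set that avoids these cannot leave it.\<close>

lemma connected_between_rays:
  assumes \<eta>: "cmod \<eta>1 = 1" "Im \<eta>1 > 0" "cmod \<eta>2 = 1" "Im \<eta>2 > 0" and q: "\<bar>q1\<bar> < 1" "\<bar>q2\<bar> < 1"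
    and C: "connected C" "C \<subseteq> \<Delta>" and meets: "C \<inter> between_rays \<eta>1 q1 \<eta>2 q2 \<noteq> {}"
    and rays: "C \<inter> ray \<eta>1 (of_real q1) = {}" "C \<inter> ray \<eta>2 (of_real q2) = {}"
    and base: "\<And>x. q1 \<le> x \<Longrightarrow> x \<le> q2 \<Longrightarrow> of_real x \<notin> C"
  shows "C \<subseteq> between_rays \<eta>1 q1 \<eta>2 q2"
proof (rule ccontr)
  \<comment> \<open>The region is the set where \<open>f\<close> is positive.\<close>
  define f where "f = (\<lambda>z. min (Im z) (min (Re (cay \<eta>1 z) - Re (cay \<eta>1 (of_real q1)))
     (Re (cay \<eta>2 (of_real q2)) - Re (cay \<eta>2 z))))"
  have R: "z \<in> between_rays \<eta>1 q1 \<eta>2 q2 \<longleftrightarrow> f z > 0" if "z \<in> \<Delta>" for z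
    using that unfolding between_rays_def f_def by auto
  assume "\<not> C \<subseteq> between_rays \<eta>1 q1 \<eta>2 q2"
  then obtain z0 where z0: "z0 \<in> C" "f z0 \<le> 0" using R C(2) by (meson linorder_not_le subset_iff)
  obtain z1 where z1: "z1 \<in> C" "f z1 > 0" using meets R C(2) by blast
  have "continuous_on C (cay \<eta>1)" "continuous_on C (cay \<eta>2)"
    using \<eta> C(2) by (auto intro!: continuous_cay)
  then have "continuous_on C f" unfolding f_def by (intro continuous_intros)
  then have "connected (f ` C)" using C(1) connected_continuous_image by blast
  then have "0 \<in> f ` C" using z0 z1
    by (meson connectedD_interval image_eqI less_imp_le)
  then obtain z where z: "z \<in> C" "f z = 0" by auto
  have zD: "cmod z < 1" using z C(2) by auto
  have ge: "Im z \<ge> 0" "Re (cay \<eta>1 z) \<ge> Re (cay \<eta>1 (of_real q1))" "Re (cay \<eta>2 (of_real q2)) \<ge> Re (cay \<eta>2 z)"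
    using z(2) unfolding f_def by linarith+
  show False
  proof (cases "Im z = 0")
    case True
    define x where "x = Re z"
    have zx: "z = of_real x" using True by (simp add: x_def complex_eq_iff)
    have x: "\<bar>x\<bar> < 1" using zD unfolding zx by simp
    have "q1 \<le> x" using ge(2) cay_real_mono[OF \<eta>(1,2), of x q1] x q unfolding zx by force
    moreover have "x \<le> q2" using ge(3) cay_real_mono[OF \<eta>(3,4), of q2 x] x q unfolding zx by force
    ultimately show False using base z(1) zx by auto
  next
    case False
    then have pos: "Im z > 0" using ge by simp
    have "Re (cay \<eta>1 z) = Re (cay \<eta>1 (of_real q1)) \<or> Re (cay \<eta>2 z) = Re (cay \<eta>2 (of_real q2))"
      using z(2) pos unfolding f_def by (auto simp: min_def split: if_splits)
    then show False
    proof
      assume e: "Re (cay \<eta>1 z) = Re (cay \<eta>1 (of_real q1))"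
      have "z \<in> ray \<eta>1 (of_real q1)" unfolding ray_def
        using e cay_above_diameter[OF \<eta>(1,2) zD pos q(1) e] zD by auto
      then show False using rays z by auto
    next
      assume e: "Re (cay \<eta>2 z) = Re (cay \<eta>2 (of_real q2))"
      have "z \<in> ray \<eta>2 (of_real q2)" unfolding ray_def
        using e cay_above_diameter[OF \<eta>(3,4) zD pos q(2) e] zD by auto
      then show False using rays z by auto
    qed
  qed
qed

section \<open>Finitely generated groups of matrices without parabolics\<close>

text \<open>The full preimage of a Fuchsian group in \<^const>\<open>SU11\<close>. Every transformation is represented by
  a matrix and its negative.\<close>

locale fuchsian_matrices =
  fixes M :: "mat set"
  assumes M_subset: "M \<subseteq> SU11" and one_M: "(1,0) \<in> M"
    and mmul_M: "p \<in> M \<Longrightarrow> q \<in> M \<Longrightarrow> mmul p q \<in> M"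
    and minv_M: "m \<in> M \<Longrightarrow> minv m \<in> M"
    and finite_M: "finite {m \<in> M. cmod (fst m) \<le> R}"
begin

lemma M_SU: "m \<in> M \<Longrightarrow> m \<in> SU11"
  using M_subset by auto

lemma countable_M: "countable M"
proof -
  have "M = (\<Union>n. {m \<in> M. cmod (fst m) \<le> real n})" using real_arch_simple by auto
  moreover have "countable (\<Union>n. {m \<in> M. cmod (fst m) \<le> real n})"
    using finite_M by (intro countable_UN) (auto intro: countable_finite)
  ultimately show ?thesis by simp
qed

end

inductive_set words :: "mat set \<Rightarrow> mat set" for T where
  one: "(1,0) \<in> words T"
| mul: "m \<in> words T \<Longrightarrow> t \<in> T \<Longrightarrow> mmul m t \<in> words T"
| inv: "m \<in> words T \<Longrightarrow> t \<in> T \<Longrightarrow> mmul m (minv t) \<in> words T"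

text \<open>An element that fixes \<open>\<xi>\<close> with derivative of modulus one is parabolic or the identity; this is
  the form in which the absence of parabolics is used. The identity is among the generators, so that
  every orbit point is an end of an edge below.\<close>

locale fg_fuchsian_matrices = fuchsian_matrices +
  fixes T :: "mat set"
  assumes finite_T: "finite T" and T_subset: "T \<subseteq> M" and one_T: "(1,0) \<in> T"
    and generated: "M \<subseteq> words T"
    and no_parabolic: "\<lbrakk>m \<in> M; cmod \<xi> = 1; mob m \<xi> = \<xi>; cmod (den m \<xi>) = 1\<rbrakk> \<Longrightarrow> m = (1,0) \<or> m = - (1,0)"
begin

text \<open>The edges join the orbit of \<open>0\<close> along the generators. They are geodesic, because \<open>seg t\<close> lies on a
  diameter.\<close>

definition seg :: "mat \<Rightarrow> complex set"
  where "seg t = closed_segment 0 (mob t 0)"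

definition edge :: "mat \<Rightarrow> mat \<Rightarrow> complex set"
  where "edge m t = mob m ` seg t"

definition edge_radius :: real
  where "edge_radius = Max ((\<lambda>t. cmod (mob t 0)) ` T)"

lemma T_M: "t \<in> T \<Longrightarrow> t \<in> M"
  using T_subset by auto

lemma edge_radius: "edge_radius < 1" "t \<in> T \<Longrightarrow> w \<in> seg t \<Longrightarrow> cmod w \<le> edge_radius"
proof -
  have ne: "T \<noteq> {}" using one_T by auto
  have "cmod (mob t 0) < 1" if "t \<in> T" for t using mob_less_1[of t 0] M_SU T_M that by auto
  then show "edge_radius < 1" unfolding edge_radius_def using ne finite_T by (subst Max_less_iff) auto
  assume t: "t \<in> T" "w \<in> seg t"
  have "cmod w \<le> cmod (mob t 0)" using t(2) unfolding seg_def
    using segment_bound(1)[of w 0 "mob t 0"] by simp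
  also have "\<dots> \<le> edge_radius" unfolding edge_radius_def using finite_T t by (intro Max_ge) auto
  finally show "cmod w \<le> edge_radius" .
qed

lemma edge_disk: assumes "m \<in> M" "t \<in> T" shows "edge m t \<subseteq> \<Delta>"
proof
  fix z assume "z \<in> edge m t"
  then obtain w where w: "w \<in> seg t" "z = mob m w" by (auto simp: edge_def)
  have "cmod w < 1" using edge_radius(1) edge_radius(2)[OF assms(2) w(1)] by simp
  then show "z \<in> \<Delta>" using mob_less_1[OF M_SU[OF assms(1)]] w by auto
qed

lemma seg_cball: "t \<in> T \<Longrightarrow> seg t \<subseteq> cball 0 1"
  using edge_radius(1) edge_radius(2)[of t] by (meson less_imp_le mem_cball_0 order_trans subsetI)

lemma edge_compact: assumes "m \<in> M" "t \<in> T" shows "compact (edge m t)" "connected (edge m t)"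
proof -
  have "continuous_on (seg t) (mob m)"
    using continuous_mob[OF M_SU[OF assms(1)]] seg_cball[OF assms(2)] continuous_on_subset by blast
  then show "compact (edge m t)" "connected (edge m t)" unfolding edge_def
    using compact_continuous_image[of "seg t" "mob m"] connected_continuous_image[of "seg t" "mob m"]
    by (auto simp: seg_def)
qed

lemma edge_mmul: assumes "p \<in> M" "m \<in> M" "t \<in> T" shows "edge (mmul p m) t = mob p ` edge m t"
proof -
  have "mob (mmul p m) w = mob p (mob m w)" if "w \<in> seg t" for w
    using mob_mmul[OF M_SU[OF assms(2)], of w p] that seg_cball[OF assms(3)] by auto
  then show ?thesis by (auto simp: edge_def image_image)
qed

lemma edge_ends: "mob m 0 \<in> edge m t" "mob m (mob t 0) \<in> edge m t"
  by (auto simp: edge_def seg_def)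

text \<open>Connectedness of the graph, in the form in which it is applied: the generators link all orbit
  points, so a set that no edge leaves contains all of them or none.\<close>

lemma orbit_separation:
  assumes "\<And>m t. m \<in> M \<Longrightarrow> t \<in> T \<Longrightarrow> edge m t \<subseteq> A \<or> edge m t \<inter> A = {}" and "m \<in> M"
  shows "mob m 0 \<in> A \<longleftrightarrow> 0 \<in> A"
proof -
  have step: "mob (mmul m t) 0 \<in> A \<longleftrightarrow> mob m 0 \<in> A" if "m \<in> M" "t \<in> T" for m t
    using assms(1)[OF that] edge_ends[of m t] mob_mmul[OF M_SU[OF T_M[OF that(2)]], of 0 m] by auto
  have "m \<in> M \<and> (mob m 0 \<in> A \<longleftrightarrow> 0 \<in> A)" if "m \<in> words T" for m
    using that
  proof induction
    case one
    then show ?case using one_M by simp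
  next
    case (mul m t)
    then show ?case using step mmul_M T_M by auto
  next
    case (inv m t)
    have "mmul (mmul m (minv t)) t = m" using inv mmul_minv M_SU T_M by (simp add: mmul_assoc)
    then show ?case using step[of "mmul m (minv t)" t] inv mmul_M minv_M T_M by auto
  qed
  then show ?thesis using generated assms(2) by blast
qed

lemma finite_edges: assumes "R < 1"
  shows "finite {(m, t). m \<in> M \<and> t \<in> T \<and> edge m t \<inter> cball 0 R \<noteq> {}}"
proof -
  define B where "B = 1 / ((1 - R\<^sup>2) * (1 - edge_radius)\<^sup>2)"
  have *: "cmod (fst m) \<le> B" if m: "m \<in> M" "t \<in> T" and ne: "edge m t \<inter> cball 0 R \<noteq> {}" for m t
  proof -
    obtain w where w: "w \<in> seg t" "cmod (mob m w) \<le> R" using ne by (auto simp: edge_def)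
    have wr: "cmod w \<le> edge_radius" using edge_radius w m by auto
    show ?thesis unfolding B_def by (rule fst_bounded_if_mob_bounded[OF M_SU[OF m(1)] wr edge_radius(1) w(2) assms])
  qed
  then have "{(m, t). m \<in> M \<and> t \<in> T \<and> edge m t \<inter> cball 0 R \<noteq> {}} \<subseteq> {m \<in> M. cmod (fst m) \<le> B} \<times> T"
    using * by blast
  then show ?thesis using finite_M finite_T by (meson finite_SigmaI finite_subset)
qed

text \<open>Two geodesics that meet twice coincide. Here the edge is parametrised by \<open>x = mob m (s p)\<close>, and
  \<open>Im (cnj u * x)\<close> is \<open>\<alpha> (1 + s\<^sup>2 c) + s \<beta>\<close> up to a positive factor; two zeros \<open>s\<close> in \<open>[0, 1]\<close>, where
  \<open>c < 1\<close>, force \<open>\<alpha> = \<beta> = 0\<close>.\<close>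

lemma edge_diameter: assumes "m \<in> M" "t \<in> T" "z \<in> edge m t" "z' \<in> edge m t" "z \<noteq> z'"
    "Im (cnj u * z) = 0" "Im (cnj u * z') = 0" "y \<in> edge m t"
  shows "Im (cnj u * y) = 0"
proof -
  define p where "p = mob t 0"
  define c where "c = (cmod p)\<^sup>2"
  have p1: "cmod p < 1" using edge_radius(1) edge_radius(2)[OF assms(2), of p] by (simp add: seg_def p_def)
  then have c: "0 \<le> c" "c < 1" by (simp_all add: c_def abs_square_less_1)
  define a b where "a = fst m" and "b = snd m"
  define \<alpha> \<beta> where "\<alpha> = Im (cnj u * (a * b))" and "\<beta> = Im (cnj u * (a\<^sup>2 * p + b\<^sup>2 * cnj p))"
  have par: "\<exists>s. 0 \<le> s \<and> s \<le> 1 \<and> x = mob m (of_real s * p) \<and>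
      (Im (cnj u * x) = 0 \<longleftrightarrow> \<alpha> * (1 + s\<^sup>2 * c) + s * \<beta> = 0)" if x: "x \<in> edge m t" for x
  proof -
    obtain w where w: "w \<in> closed_segment 0 p" "x = mob m w"
      using x unfolding edge_def seg_def p_def[symmetric] by blast
    from w(1) obtain s where "0 \<le> s" "s \<le> 1" "w = (1 - s) *\<^sub>R 0 + s *\<^sub>R p"
      unfolding in_segment by blast
    then have s: "0 \<le> s" "s \<le> 1" "w = of_real s * p" by (simp_all add: scaleR_conv_of_real)
    have w1: "cmod w \<le> 1" using w(1) edge_radius(1) edge_radius(2)[OF assms(2), of w] by (simp add: seg_def p_def)
    define d where "d = den m w"
    have d: "d \<noteq> 0" unfolding d_def by (rule den_nz[OF M_SU[OF assms(1)] w1])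
    have "x = (a * w + b) * cnj d / of_real ((cmod d)\<^sup>2)"
      unfolding w(2) mob_def a_def b_def d_def[symmetric] complex_norm_square using d by simp
    then have "cnj u * x = (cnj u * ((a * w + b) * cnj d)) / of_real ((cmod d)\<^sup>2)" by simp
    then have "Im (cnj u * x) = Im (cnj u * ((a * w + b) * cnj d)) / (cmod d)\<^sup>2" by (metis Im_divide_of_real)
    moreover have "(a * w + b) * cnj d = of_real (1 + s\<^sup>2 * c) * (a * b) + of_real s * (a\<^sup>2 * p + b\<^sup>2 * cnj p)"
    proof -
      have "complex_of_real c = p * cnj p" unfolding c_def by (rule complex_norm_square)
      then show ?thesis unfolding d_def den_def s(3) a_def[symmetric] b_def[symmetric]
        by (simp add: algebra_simps power2_eq_square)
    qed
    moreover have "Im (cnj u * (of_real (1 + s\<^sup>2 * c) * (a * b) + of_real s * (a\<^sup>2 * p + b\<^sup>2 * cnj p)))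
        = \<alpha> * (1 + s\<^sup>2 * c) + s * \<beta>"
    proof -
      have "Im (v * (of_real x * A + of_real y * B)) = Im (v * A) * x + y * Im (v * B)" for v A B x y
        by (simp add: algebra_simps)
      then show ?thesis unfolding \<alpha>_def \<beta>_def .
    qed
    ultimately have "Im (cnj u * x) = (\<alpha> * (1 + s\<^sup>2 * c) + s * \<beta>) / (cmod d)\<^sup>2" by simp
    then have "Im (cnj u * x) = 0 \<longleftrightarrow> \<alpha> * (1 + s\<^sup>2 * c) + s * \<beta> = 0" using d by simp
    moreover have "x = mob m (of_real s * p)" using s(3) w(2) by simp
    ultimately show ?thesis using s(1,2) by blast
  qed
  obtain s where s: "0 \<le> s" "s \<le> 1" "z = mob m (of_real s * p)" "\<alpha> * (1 + s\<^sup>2 * c) + s * \<beta> = 0"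
    using par[OF assms(3)] assms(6) by blast
  obtain r where r: "0 \<le> r" "r \<le> 1" "z' = mob m (of_real r * p)" "\<alpha> * (1 + r\<^sup>2 * c) + r * \<beta> = 0"
    using par[OF assms(4)] assms(7) by blast
  have sr: "s \<noteq> r" using s r assms(5) by auto
  have "s * r \<le> 1" using s r by (simp add: mult_le_one)
  then have "s * r * c < 1" using c s r 
    by (meson le_less_trans mult_left_le_one_le mult_nonneg_nonneg)
  have "\<alpha> * ((r - s) * (1 - s * r * c)) = r * (\<alpha> * (1 + s\<^sup>2 * c) + s * \<beta>) - s * (\<alpha> * (1 + r\<^sup>2 * c) + r * \<beta>)"
    by (simp add: power2_eq_square algebra_simps)
  also have "\<dots> = 0" using s(4) r(4) by simp
  finally have \<alpha>0: "\<alpha> = 0" using sr \<open>s * r * c < 1\<close> by simp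
  then have "\<beta> = 0" using s(4) r(4) sr by auto
  then show ?thesis using par[OF assms(8)] \<alpha>0 by fastforce
qed

end

section \<open>Highest points of the edge graph\<close>

context fg_fuchsian_matrices
begin

text \<open>The unit direction of \<open>seg t\<close>; the value \<open>1\<close> for a generator that fixes \<open>0\<close> is arbitrary, as its
  segment is a point.\<close>

definition edge_dir :: "mat \<Rightarrow> complex"
  where "edge_dir t = (if mob t 0 = 0 then 1 else sgn (mob t 0))"

lemma edge_dir: "cmod (edge_dir t) = 1" "mob t 0 = of_real (cmod (mob t 0)) * edge_dir t"
  by (simp add: edge_dir_def norm_sgn) (simp add: edge_dir_def sgn_eq)

lemma seg_edge_dir: assumes "w \<in> seg t"
  shows "\<exists>s. 0 \<le> s \<and> w = of_real s * edge_dir t"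
proof -
  obtain s where s: "0 \<le> s" "w = (1 - s) *\<^sub>R 0 + s *\<^sub>R mob t 0"
    using assms unfolding seg_def in_segment by blast
  then have "w = of_real s * mob t 0" by (simp add: scaleR_conv_of_real)
  also have "\<dots> = of_real s * (of_real (cmod (mob t 0)) * edge_dir t)" by (rule arg_cong[OF edge_dir(2)])
  finally have "w = of_real (s * cmod (mob t 0)) * edge_dir t" by simp
  moreover have "0 \<le> s * cmod (mob t 0)" using s(1) by simp
  ultimately show ?thesis by blast
qed

text \<open>The points where \<open>seg t\<close> meets an edge transversally.\<close>

definition crossings :: "mat \<Rightarrow> complex set"
  where "crossings t = {w \<in> seg t. \<exists>m\<in>M. \<exists>t'\<in>T. w \<in> edge m t' \<and> (\<exists>z\<in>edge m t'. Im (cnj (edge_dir t) * z) \<noteq> 0)}"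

lemma finite_crossings: assumes "t \<in> T" shows "finite (crossings t)"
proof -
  define S where "S = {(m, t'). m \<in> M \<and> t' \<in> T \<and> edge m t' \<inter> cball 0 edge_radius \<noteq> {}}"
  define f where "f = (\<lambda>(m, t'). {w \<in> edge m t'. Im (cnj (edge_dir t) * w) = 0 \<and> (\<exists>z\<in>edge m t'. Im (cnj (edge_dir t) * z) \<noteq> 0)})"
  have "crossings t \<subseteq> (\<Union>p\<in>S. f p)"
  proof
    fix w assume w: "w \<in> crossings t"
    then obtain m t' where mt: "w \<in> seg t" "m \<in> M" "t' \<in> T" "w \<in> edge m t'"
      "\<exists>z\<in>edge m t'. Im (cnj (edge_dir t) * z) \<noteq> 0" unfolding crossings_def by blast
    obtain s where s: "w = of_real s * edge_dir t" using seg_edge_dir[OF mt(1)] by auto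
    have "cnj (edge_dir t) * w = of_real s * (edge_dir t * cnj (edge_dir t))" unfolding s by simp
    also have "\<dots> = of_real s" using edge_dir(1)[of t] by (metis complex_norm_square mult.right_neutral of_real_1 one_power2)
    finally have "Im (cnj (edge_dir t) * w) = 0" by simp
    then have "w \<in> f (m, t')" unfolding f_def using mt by simp
    moreover have "w \<in> cball 0 edge_radius" using edge_radius(2)[OF assms mt(1)] by simp
    then have "(m, t') \<in> S" unfolding S_def using mt by blast
    ultimately show "w \<in> (\<Union>p\<in>S. f p)" by blast
  qed
  moreover have "finite (f p)" if pS: "p \<in> S" for p
  proof -
    obtain m t' where p: "p = (m, t')" "m \<in> M" "t' \<in> T" using pS unfolding S_def by blast
    have "z = w" if zw': "z \<in> f p" "w \<in> f p" for z w
    proof (rule ccontr)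
      assume "z \<noteq> w"
      obtain y where y: "y \<in> edge m t'" "Im (cnj (edge_dir t) * y) \<noteq> 0" using zw'(1) unfolding f_def p(1) by auto
      have zw: "z \<in> edge m t'" "Im (cnj (edge_dir t) * z) = 0" "w \<in> edge m t'" "Im (cnj (edge_dir t) * w) = 0"
        using zw' unfolding f_def p(1) by simp_all
      show False using edge_diameter[OF p(2,3) zw(1,3) \<open>z \<noteq> w\<close> zw(2,4) y(1)] y(2) by simp
    qed
    then have "f p \<subseteq> {z}" if "z \<in> f p" for z using that by blast
    then show ?thesis by (metis empty_subsetI finite.emptyI finite_insert finite_subset subset_antisym subsetI)
  qed
  moreover have "finite S" unfolding S_def by (rule finite_edges[OF edge_radius(1)])
  ultimately show ?thesis by (meson finite_UN finite_subset)
qed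

end

text \<open>The condition on \<open>\<xi>\<close> means that the open horoball at \<open>\<xi>\<close> whose boundary contains \<open>0\<close> contains no orbit
  point, equivalently that \<open>\<xi>\<close> lies in the closure of the Dirichlet domain.\<close>

locale empty_horoball = fg_fuchsian_matrices +
  fixes \<xi> :: complex
  assumes \<xi>: "cmod \<xi> = 1" and horo: "m \<in> M \<Longrightarrow> 1 \<le> cmod (den m \<xi>)"
begin

definition eta :: "mat \<Rightarrow> complex"
  where "eta m = mob (minv m) \<xi>"

lemma eta: assumes "m \<in> M"
  shows "cmod (eta m) = 1" "mob m (eta m) = \<xi>" "0 < cmod (den m (eta m))" "cmod (den m (eta m)) \<le> 1"
proof -
  note SU = M_SU[OF assms] M_SU[OF minv_M[OF assms]]
  show e1: "cmod (eta m) = 1" unfolding eta_def using mob_eq_1[OF SU(2) \<xi>] .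
  show "mob m (eta m) = \<xi>" unfolding eta_def using mob_minv(1)[OF SU(1)] \<xi> by simp
  show "0 < cmod (den m (eta m))" using den_nz[OF SU(1)] e1 by simp
  have "den m (eta m) * den (minv m) \<xi> = 1" using den_minv[OF SU(2), of \<xi>] \<xi> unfolding eta_def by simp
  then have "cmod (den m (eta m)) * cmod (den (minv m) \<xi>) = 1" by (metis norm_mult norm_one)
  moreover have "cmod (den m (eta m)) * 1 \<le> cmod (den m (eta m)) * cmod (den (minv m) \<xi>)"
    using horo[OF minv_M[OF assms]] by (intro mult_left_mono) auto
  ultimately show "cmod (den m (eta m)) \<le> 1" by simp
qed

text \<open>The factor \<open>N\<close> is \<open>\<bar>(m\<^sup>-\<^sup>1)' \<xi>\<bar>\<close>, which the horoball condition bounds by \<open>1\<close>.\<close>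

lemma cay_pull: assumes "m \<in> M"
  obtains N \<beta> :: real where "0 < N" "N \<le> 1"
    "\<And>z. z \<in> \<Delta> \<Longrightarrow> cay \<xi> (mob m z) = of_real N * cay (eta m) z + of_real \<beta>"
proof -
  have "cay \<xi> (mob m z) = of_real ((cmod (den m (eta m)))\<^sup>2) * cay (eta m) z
    + of_real (2 * Im (fst m * cnj (snd m) * eta m))" if "z \<in> \<Delta>" for z
  proof -
    have "cmod z \<le> 1" "z \<noteq> eta m" using that eta(1)[OF assms] by auto
    then show ?thesis using cay_mob[OF M_SU[OF assms] eta(1)[OF assms], of z]
      unfolding eta(2)[OF assms] by blast
  qed
  moreover have "(cmod (den m (eta m)))\<^sup>2 \<le> 1" using eta(4)[OF assms] by (simp add: abs_square_le_1)
  moreover have "0 < (cmod (den m (eta m)))\<^sup>2" using eta(3)[OF assms] by simp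
  ultimately show thesis using that by blast
qed

lemma height_orbit: assumes "m \<in> M" shows "Im (cay \<xi> (mob m 0)) \<le> 1"
proof -
  obtain N \<beta> where N: "0 < N" "N \<le> 1" "\<And>z. z \<in> \<Delta> \<Longrightarrow> cay \<xi> (mob m z) = of_real N * cay (eta m) z + of_real \<beta>"
    using cay_pull[OF assms] by metis
  show ?thesis using N(3)[of 0] N(2) cay_zero[OF eta(1)[OF assms]] by simp
qed

lemma height_edge: assumes "m \<in> M" "t \<in> T" "z \<in> edge m t"
  shows "Im (cay \<xi> z) \<le> 1 / (1 - edge_radius)\<^sup>2"
proof -
  obtain N \<beta> where N: "0 < N" "N \<le> 1" "\<And>z. z \<in> \<Delta> \<Longrightarrow> cay \<xi> (mob m z) = of_real N * cay (eta m) z + of_real \<beta>"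
    using cay_pull[OF assms(1)] by metis
  obtain w where w: "w \<in> seg t" "z = mob m w" using assms(3) unfolding edge_def by blast
  have wr: "cmod w \<le> edge_radius" "cmod w < 1" using edge_radius(1) edge_radius(2)[OF assms(2) w(1)] by auto
  note e = eta(1)[OF assms(1)]
  have ne: "w \<noteq> eta m" using wr e by auto
  have p: "Im (cay (eta m) w) > 0" using cay_Im_pos[OF e wr(2)] .
  have "Im (cay \<xi> z) = N * Im (cay (eta m) w)" using N(3)[of w] wr w by simp
  also have "\<dots> \<le> Im (cay (eta m) w)" using p N by simp
  also have "\<dots> = (1 - (cmod w)\<^sup>2) / (cmod (eta m - w))\<^sup>2" by (rule cay_eq(1)[OF e ne])
  also have "\<dots> \<le> 1 / (1 - edge_radius)\<^sup>2"
  proof (rule frac_le)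
    have "1 - edge_radius \<le> cmod (eta m - w)" using norm_triangle_ineq2[of "eta m" w] e wr by simp
    then show "(1 - edge_radius)\<^sup>2 \<le> (cmod (eta m - w))\<^sup>2" using edge_radius(1) by (intro power_mono) auto
  qed (use edge_radius(1) in auto)
  finally show ?thesis .
qed

text \<open>Orbit points close to \<open>\<xi>\<close> are close to infinity in the half-plane, but their height is bounded.\<close>

lemma unbounded_orbit:
  assumes acc: "\<And>e. e > 0 \<Longrightarrow> \<exists>m\<in>M. cmod (mob m 0 - \<xi>) < e" and "B \<ge> 0"
  shows "\<exists>m\<in>M. B < \<bar>Re (cay \<xi> (mob m 0))\<bar>"
proof -
  have "1 / (B + 2) > 0" using assms(2) by simp
  then obtain m where m: "m \<in> M" "cmod (mob m 0 - \<xi>) < 1 / (B + 2)" using acc by blast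
  define z where "z = mob m 0"
  have z1: "cmod z < 1" unfolding z_def using mob_less_1[OF M_SU[OF m(1)]] by simp
  have d: "0 < cmod (\<xi> - z)" "cmod (\<xi> - z) < 1 / (B + 2)" using z1 \<xi> m(2) unfolding z_def
    by (auto simp: norm_minus_commute)
  have "1 / (B + 2) \<le> 1" using assms(2) by simp
  then have "1 \<le> cmod (\<xi> + z)" using norm_triangle_ineq2[of "2 * \<xi>" "\<xi> - z"] d \<xi> by (simp add: norm_mult)
  then have "1 / cmod (\<xi> - z) \<le> cmod (cay \<xi> z)" unfolding cay_def norm_divide norm_mult
    by (intro divide_right_mono) auto
  moreover have "B + 2 < 1 / cmod (\<xi> - z)" using d assms(2) by (simp add: field_simps)
  ultimately have "B + 2 < cmod (cay \<xi> z)" by simp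
  also have "\<dots> \<le> \<bar>Re (cay \<xi> z)\<bar> + \<bar>Im (cay \<xi> z)\<bar>" by (rule cmod_le)
  also have "\<bar>Im (cay \<xi> z)\<bar> \<le> 1" using height_orbit[OF m(1)] cay_Im_pos[OF \<xi> z1] unfolding z_def by simp
  finally have "B < \<bar>Re (cay \<xi> z)\<bar>" by simp
  then show ?thesis using m(1) unfolding z_def by blast
qed

lemma unbounded_orbit_sided:
  assumes acc: "\<And>e. e > 0 \<Longrightarrow> \<exists>m\<in>M. cmod (mob m 0 - \<xi>) < e"
  obtains \<sigma> :: real where "\<sigma> = 1 \<or> \<sigma> = -1" "\<And>B. \<exists>m\<in>M. B < \<sigma> * Re (cay \<xi> (mob m 0))"
proof (rule ccontr)
  assume no: "\<not> thesis"
  have n1: "\<exists>B. \<forall>m\<in>M. \<not> B < 1 * Re (cay \<xi> (mob m 0))" using no that[of 1] by blast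
  have n2: "\<exists>B. \<forall>m\<in>M. \<not> B < (-1) * Re (cay \<xi> (mob m 0))" using no that[of "-1"] by blast
  obtain B1 where B1: "\<And>m. m \<in> M \<Longrightarrow> Re (cay \<xi> (mob m 0)) \<le> B1"
    using n1 by (auto simp: not_less)
  obtain B2 where B2: "\<And>m. m \<in> M \<Longrightarrow> - Re (cay \<xi> (mob m 0)) \<le> B2"
    using n2 by (auto simp: not_less)
  obtain m where "m \<in> M" "\<bar>B1\<bar> + \<bar>B2\<bar> < \<bar>Re (cay \<xi> (mob m 0))\<bar>"
    using unbounded_orbit[OF acc, of "\<bar>B1\<bar> + \<bar>B2\<bar>"] by auto
  then show False using B1[of m] B2[of m] by linarith
qed

lemma continuous_cay_disk: "continuous_on \<Delta> (cay \<xi>)"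
  using continuous_cay[OF \<xi>] \<xi> by simp

text \<open>By connectedness of the graph, a vertical line that no edge meets would have the whole orbit on
  one side.\<close>

lemma line_meets_edge:
  assumes "\<sigma> = 1 \<or> \<sigma> = (-1::real)" "\<And>B. \<exists>m\<in>M. B < \<sigma> * Re (cay \<xi> (mob m 0))" and "x > 0"
  shows "\<exists>m\<in>M. \<exists>t\<in>T. \<exists>z\<in>edge m t. \<sigma> * Re (cay \<xi> z) = x"
proof (rule ccontr)
  assume no: "\<not> ?thesis"
  define A where "A = {z. \<sigma> * Re (cay \<xi> z) < x}"
  have "edge m t \<subseteq> A \<or> edge m t \<inter> A = {}" if mt: "m \<in> M" "t \<in> T" for m t
  proof (rule ccontr)
    define f where "f = (\<lambda>z. \<sigma> * Re (cay \<xi> z))"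
    assume "\<not> (edge m t \<subseteq> A \<or> edge m t \<inter> A = {})"
    then obtain z0 z1 where z: "z0 \<in> edge m t" "f z0 < x" "z1 \<in> edge m t" "x \<le> f z1"
      unfolding A_def f_def by fastforce
    have "continuous_on (edge m t) f" unfolding f_def
      using continuous_on_subset[OF continuous_cay_disk edge_disk[OF mt]] by (intro continuous_intros)
    then have "connected (f ` edge m t)" using edge_compact(2)[OF mt] connected_continuous_image by blast
    then have "x \<in> f ` edge m t" using z by (meson connectedD_interval image_eqI less_imp_le)
    then show False using no mt unfolding f_def by blast
  qed
  then have "mob m 0 \<in> A \<longleftrightarrow> 0 \<in> A" if "m \<in> M" for m using orbit_separation that by blast
  moreover have "0 \<in> A" using assms cay_zero[OF \<xi>] by (simp add: A_def)
  ultimately have "\<sigma> * Re (cay \<xi> (mob m 0)) < x" if "m \<in> M" for m using that unfolding A_def by blast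
  then show False using assms(2)[of x] by fastforce
qed

text \<open>A highest point exists because the edge points of a vertical line above a given height lie in a
  compact part of the disk, which only finitely many edges meet.\<close>

lemma top_edge:
  assumes "\<sigma> = 1 \<or> \<sigma> = (-1::real)" "\<And>B. \<exists>m\<in>M. B < \<sigma> * Re (cay \<xi> (mob m 0))" and "x > 0"
  obtains m t w where "m \<in> M" "t \<in> T" "w \<in> seg t" "\<sigma> * Re (cay \<xi> (mob m w)) = x"
    "\<And>m' t' z. m' \<in> M \<Longrightarrow> t' \<in> T \<Longrightarrow> z \<in> edge m' t' \<Longrightarrow> \<sigma> * Re (cay \<xi> z) = x \<Longrightarrow>
       Im (cay \<xi> z) \<le> Im (cay \<xi> (mob m w))"
proof -
  obtain m0 t0 z0 where z0: "m0 \<in> M" "t0 \<in> T" "z0 \<in> edge m0 t0" "\<sigma> * Re (cay \<xi> z0) = x"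
    using line_meets_edge[OF assms] by blast
  define y0 where "y0 = Im (cay \<xi> z0)"
  have z0D: "cmod z0 < 1" using edge_disk[OF z0(1,2)] z0(3) by auto
  have y0: "y0 > 0" unfolding y0_def using cay_Im_pos[OF \<xi> z0D] .
  define H where "H = 1 / (1 - edge_radius)\<^sup>2"
  \<comment> \<open>\<open>H\<close> bounds the height of all edges. On the part of the line with height between \<open>y0\<close> and \<open>H\<close>, the
    squared distance from \<open>\<xi>\<close> is at least \<open>c\<close>, by \<open>cay_plus_i\<close>.\<close>
  define c where "c = 4 / (x\<^sup>2 + (H + 1)\<^sup>2)"
  have H0: "H > 0" unfolding H_def using edge_radius(1) by simp
  then have "(H + 1)\<^sup>2 > 0" by simp
  then have den0: "x\<^sup>2 + (H + 1)\<^sup>2 > 0" by (smt (verit) zero_le_power2)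
  have c0: "c > 0" unfolding c_def using den0 by simp
  define R where "R = sqrt (1 - y0 * c)"
  have R: "cmod z \<le> R" if "z \<in> \<Delta>" "\<sigma> * Re (cay \<xi> z) = x" "y0 \<le> Im (cay \<xi> z)" "Im (cay \<xi> z) \<le> H" for z
  proof -
    have ne: "z \<noteq> \<xi>" using that(1) \<xi> by auto
    define d where "d = (cmod (\<xi> - z))\<^sup>2"
    have d: "d > 0" using ne by (simp add: d_def)
    have "(Re (cay \<xi> z))\<^sup>2 = x\<^sup>2" using that(2) assms(1) by auto
    then have "4 / d = x\<^sup>2 + (Im (cay \<xi> z) + 1)\<^sup>2" using cay_plus_i[OF ne \<xi>] unfolding d_def by simp
    also have "\<dots> \<le> x\<^sup>2 + (H + 1)\<^sup>2" using that y0 by (intro add_left_mono power_mono) auto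
    finally have cd: "c \<le> d" unfolding c_def using d den0 by (simp add: field_simps)
    have "y0 * c \<le> Im (cay \<xi> z) * d" using cd that y0 c0 by (intro mult_mono) auto
    also have "\<dots> = 1 - (cmod z)\<^sup>2" using d unfolding cay_eq(1)[OF \<xi> ne] d_def by simp
    finally show ?thesis unfolding R_def by (simp add: real_le_rsqrt)
  qed
  have R1: "R < 1"
  proof -
    have "y0 * c > 0" using y0 c0 by simp
    then show ?thesis unfolding R_def by (simp add: real_sqrt_lt_1_iff)
  qed
  define S where "S = {(m, t). m \<in> M \<and> t \<in> T \<and> edge m t \<inter> cball 0 R \<noteq> {}}"
  have finS: "finite S" unfolding S_def by (rule finite_edges[OF R1])
  define E where "E = (\<Union>(m,t)\<in>S. edge m t)"
  have Ec: "compact E" unfolding E_def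
    using finS by (intro compact_UN) (auto simp: S_def intro: edge_compact)
  have ED: "E \<subseteq> \<Delta>" unfolding E_def S_def using edge_disk by blast
  have contE: "continuous_on E (cay \<xi>)" using continuous_on_subset[OF continuous_cay_disk ED] .
  define K where "K = E \<inter> {z. \<sigma> * Re (cay \<xi> z) = x \<and> y0 \<le> Im (cay \<xi> z)}"
  have "K = E \<inter> (cay \<xi> -` {w. \<sigma> * Re w = x \<and> y0 \<le> Im w})" unfolding K_def by auto
  moreover have "closed {w. \<sigma> * Re w = x \<and> y0 \<le> Im w}"
    by (intro closed_Collect_conj closed_Collect_eq closed_Collect_le continuous_intros)
  ultimately have "closed K" 
    using continuous_closed_preimage[OF contE compact_imp_closed[OF Ec]] by metis
  moreover have "K \<subseteq> E" by (auto simp: K_def)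
  ultimately have Kc: "compact K" using Ec by (metis closed_Int_compact inf.absorb_iff1)
  have inK: "z \<in> K" if "m \<in> M" "t \<in> T" "z \<in> edge m t" "\<sigma> * Re (cay \<xi> z) = x" "y0 \<le> Im (cay \<xi> z)" for m t z
  proof -
    have "z \<in> cball 0 R" using R[of z] edge_disk[OF that(1,2)] height_edge[OF that(1-3)] that H_def by auto
    then have "(m, t) \<in> S" unfolding S_def using that by blast
    then show ?thesis unfolding K_def E_def using that by auto
  qed
  have "z0 \<in> K" using inK[OF z0] by (simp add: y0_def)
  moreover have "continuous_on K (\<lambda>z. Im (cay \<xi> z))"
    using continuous_on_subset[OF contE \<open>K \<subseteq> E\<close>] by (intro continuous_intros)
  ultimately obtain z where z: "z \<in> K" "\<And>y. y \<in> K \<Longrightarrow> Im (cay \<xi> y) \<le> Im (cay \<xi> z)"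
    using continuous_attains_sup[OF Kc] by blast
  obtain m t where mt: "(m, t) \<in> S" "z \<in> edge m t" using z(1) unfolding K_def E_def by auto
  then obtain w where w: "w \<in> seg t" "z = mob m w" unfolding edge_def by blast
  have mt': "m \<in> M" "t \<in> T" using mt(1) unfolding S_def by auto
  have zx: "\<sigma> * Re (cay \<xi> z) = x" "y0 \<le> Im (cay \<xi> z)" using z(1) unfolding K_def by auto
  show thesis
  proof (rule that[OF mt' w(1)])
    show "\<sigma> * Re (cay \<xi> (mob m w)) = x" using zx w by simp
    fix m' t' y assume y: "m' \<in> M" "t' \<in> T" "y \<in> edge m' t'" "\<sigma> * Re (cay \<xi> y) = x"
    show "Im (cay \<xi> y) \<le> Im (cay \<xi> (mob m w))"
    proof (cases "y0 \<le> Im (cay \<xi> y)")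
      case True
      then show ?thesis using z(2) inK[OF y] w by blast
    next
      case False
      then show ?thesis using zx w by simp
    qed
  qed
qed

text \<open>Otherwise \<open>m m'\<^sup>-\<^sup>1\<close> would be a nontrivial element that fixes \<open>\<xi>\<close>. The horoball condition for it
  and its inverse makes its derivative at \<open>\<xi>\<close> unimodular, so it would be parabolic.\<close>

lemma eta_inj_up_to_sign: assumes "m \<in> M" "m' \<in> M" "eta m = eta m'" shows "m = m' \<or> m = - m'"
proof -
  define h where "h = mmul m (minv m')"
  have hM: "h \<in> M" unfolding h_def using assms mmul_M minv_M by blast
  have "mob h \<xi> = mob m (eta m')" unfolding h_def eta_def
    using mob_mmul[OF M_SU[OF minv_M[OF assms(2)]], of \<xi> m] \<xi> by simp
  then have fixed: "mob h \<xi> = \<xi>" using eta(2)[OF assms(1)] assms(3) by simp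
  have "den (minv h) \<xi> * den h \<xi> = 1" using den_minv[OF M_SU[OF hM], of \<xi>] fixed \<xi> by simp
  then have pr: "cmod (den (minv h) \<xi>) * cmod (den h \<xi>) = 1" by (metis norm_mult norm_one)
  have ge: "1 \<le> cmod (den (minv h) \<xi>)" "1 \<le> cmod (den h \<xi>)" using horo hM minv_M by auto
  have "1 * cmod (den h \<xi>) \<le> cmod (den (minv h) \<xi>) * cmod (den h \<xi>)" using ge by (intro mult_right_mono) auto
  then have "cmod (den h \<xi>) = 1" using pr ge by simp
  then have "h = (1,0) \<or> h = - (1,0)" using no_parabolic[OF hM \<xi> fixed] by simp
  moreover have "mmul h m' = m" unfolding h_def using mmul_minv M_SU assms by (simp add: mmul_assoc)
  moreover have "mmul (- (1,0)) m' = - m'" by (simp add: mmul_def prod_eq_iff)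
  ultimately show ?thesis by auto
qed

end

section \<open>Limit points have no empty horoballs\<close>

lemma infinite_three_ordered: assumes "infinite (S::real set)"
  obtains a b c where "a \<in> S" "b \<in> S" "c \<in> S" "a < b" "b < c"
proof -
  obtain F where F: "F \<subseteq> S" "finite F" "card F = 3" using infinite_arbitrarily_large[OF assms] by metis
  define xs where "xs = sorted_list_of_set F"
  have len: "length xs = 3" and sx: "set xs = F" and st: "sorted_wrt (<) xs"
    unfolding xs_def using F by auto
  have "xs ! 0 < xs ! 1" "xs ! 1 < xs ! 2" using st len by (auto simp: sorted_wrt_iff_nth_less)
  moreover have "xs ! 0 \<in> S" "xs ! 1 \<in> S" "xs ! 2 \<in> S" using sx F len by (metis nth_mem subsetD zero_less_numeral,
     metis nth_mem subsetD one_less_numeral_iff semiring_norm(77), metis nth_mem subsetD lessI numeral_3_eq_3 numeral_2_eq_2)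
  ultimately show thesis using that by blast
qed

lemma cnj_mult_self: "cmod u = 1 \<Longrightarrow> u * cnj u = 1"
  by (metis complex_norm_square of_real_1 one_power2)

context empty_horoball
begin

text \<open>A top point is recorded by its preimage \<open>w\<close> on one of the finitely many segments \<open>seg t\<close>,
  which is what the pigeonhole argument below needs.\<close>

definition top_point :: "mat \<Rightarrow> mat \<Rightarrow> complex \<Rightarrow> bool"
  where "top_point m t w \<longleftrightarrow> m \<in> M \<and> t \<in> T \<and> w \<in> seg t \<and> w \<notin> crossings t \<and>
    (\<forall>m'\<in>M. \<forall>t'\<in>T. \<forall>z\<in>edge m' t'. Re (cay \<xi> z) = Re (cay \<xi> (mob m w)) \<longrightarrow>
       Im (cay \<xi> z) \<le> Im (cay \<xi> (mob m w)))"

lemma seg_real: assumes "t \<in> T" "w \<in> seg t"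
  shows "w = of_real (Re (cnj (edge_dir t) * w)) * edge_dir t" "\<bar>Re (cnj (edge_dir t) * w)\<bar> < 1"
proof -
  obtain s where s: "w = of_real s * edge_dir t" using seg_edge_dir[OF assms(2)] by auto
  have e: "cnj (edge_dir t) * w = of_real s" using cnj_mult_self[OF edge_dir(1)[of t]] unfolding s by (simp add: mult.left_commute mult.commute)
  show "w = of_real (Re (cnj (edge_dir t) * w)) * edge_dir t" unfolding e using s by simp
  have "cmod w < 1" using edge_radius(1) edge_radius(2)[OF assms] by simp
  then show "\<bar>Re (cnj (edge_dir t) * w)\<bar> < 1" unfolding e using s edge_dir(1)[of t] by (simp add: norm_mult)
qed

text \<open>Finitely many edges only cover a bounded horizontal range. Beyond it, all but countably many
  vertical lines avoid the crossings, and the highest point on such a line is a new top point.\<close>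

lemma many_top_points:
  assumes acc: "\<And>e. e > 0 \<Longrightarrow> \<exists>m\<in>M. cmod (mob m 0 - \<xi>) < e"
  shows "infinite {m. \<exists>t w. top_point m t w}"
proof
  assume fin: "finite {m. \<exists>t w. top_point m t w}" (is "finite ?D")
  obtain \<sigma> :: real where \<sigma>: "\<sigma> = 1 \<or> \<sigma> = -1" "\<And>B. \<exists>m\<in>M. B < \<sigma> * Re (cay \<xi> (mob m 0))"
    using unbounded_orbit_sided[OF acc] by metis
  define E where "E = (\<Union>m\<in>?D \<inter> M. \<Union>t\<in>T. edge m t)"
  have Ec: "compact E" unfolding E_def
    using fin finite_T by (intro compact_UN) (auto intro: edge_compact)
  have ED: "E \<subseteq> \<Delta>" unfolding E_def using edge_disk by blast
  have "continuous_on E (\<lambda>z. \<sigma> * Re (cay \<xi> z))"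
    using continuous_on_subset[OF continuous_cay_disk ED] by (intro continuous_intros)
  then have "bounded ((\<lambda>z. \<sigma> * Re (cay \<xi> z)) ` E)"
    using Ec compact_continuous_image compact_imp_bounded by blast
  then obtain B where B: "\<And>z. z \<in> E \<Longrightarrow> \<bar>\<sigma> * Re (cay \<xi> z)\<bar> \<le> B" unfolding bounded_iff by auto
  define bad where "bad = (\<Union>m\<in>M. \<Union>t\<in>T. (\<lambda>w. \<sigma> * Re (cay \<xi> (mob m w))) ` crossings t)"
  have "countable bad" unfolding bad_def
    using countable_M finite_T finite_crossings
    by (intro countable_UN countable_image) (auto intro: countable_finite)
  define b where "b = max B 0"
  have "uncountable {b<..<b + 1}" by (rule uncountable_open_interval[THEN iffD2]) simp
  then have "\<not> {b<..<b + 1} \<subseteq> bad" using \<open>countable bad\<close> countable_subset by blast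
  then obtain x where "x \<in> {b<..<b + 1}" "x \<notin> bad" by blast
  then have x: "x > b" "x \<notin> bad" by auto
  have x0: "x > 0" using x unfolding b_def by simp
  obtain m t w where mtw: "m \<in> M" "t \<in> T" "w \<in> seg t" "\<sigma> * Re (cay \<xi> (mob m w)) = x"
    "\<And>m' t' z. m' \<in> M \<Longrightarrow> t' \<in> T \<Longrightarrow> z \<in> edge m' t' \<Longrightarrow> \<sigma> * Re (cay \<xi> z) = x \<Longrightarrow>
       Im (cay \<xi> z) \<le> Im (cay \<xi> (mob m w))"
    using top_edge[OF \<sigma> x0] by metis
  have "w \<notin> crossings t" using x(2) mtw unfolding bad_def by blast
  moreover have "Re (cay \<xi> z) = Re (cay \<xi> (mob m w)) \<Longrightarrow> \<sigma> * Re (cay \<xi> z) = x" for z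
    using mtw(4) by simp
  ultimately have "top_point m t w" unfolding top_point_def using mtw by blast
  then have "m \<in> ?D" by blast
  then have "mob m w \<in> E" unfolding E_def using mtw(1-3) unfolding edge_def by blast
  then have "x \<le> B" using B mtw(4) by force
  then show False using x(1) unfolding b_def by simp
qed

text \<open>The graph is invariant, so pulling back by \<open>m\<close> turns the vertical ray above the top point,
  which misses all edges, into a ray from \<open>w\<close> to \<open>eta m\<close> that misses all edges.\<close>

lemma top_point_ray: assumes "top_point m t w" "m' \<in> M" "t' \<in> T" "z \<in> edge m' t'"
    "Re (cay (eta m) z) = Re (cay (eta m) w)"
  shows "Im (cay (eta m) z) \<le> Im (cay (eta m) w)"
proof -
  have m: "m \<in> M" "t \<in> T" "w \<in> seg t" using assms(1) unfolding top_point_def by auto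
  obtain N \<beta> where N: "0 < N" "\<And>z. z \<in> \<Delta> \<Longrightarrow> cay \<xi> (mob m z) = of_real N * cay (eta m) z + of_real \<beta>"
    using cay_pull[OF m(1)] by metis
  have w: "w \<in> \<Delta>" using edge_radius(1) edge_radius(2)[OF m(2,3)] by simp
  have z: "z \<in> \<Delta>" using edge_disk[OF assms(2,3)] assms(4) by auto
  have "mob m z \<in> edge (mmul m m') t'" unfolding edge_mmul[OF m(1) assms(2,3)] using assms(4) by blast
  moreover have "Re (cay \<xi> (mob m z)) = Re (cay \<xi> (mob m w))" using N(2)[OF z] N(2)[OF w] assms(5) by simp
  ultimately have "Im (cay \<xi> (mob m z)) \<le> Im (cay \<xi> (mob m w))"
    using assms(1,3) mmul_M[OF m(1) assms(2)] unfolding top_point_def by blast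
  then show ?thesis using N(2)[OF z] N(2)[OF w] N(1) by simp
qed

text \<open>An edge that enters the region between the two rays stays in it: the rays miss all edges, and an
  edge through the base either crosses it, which is excluded, or lies on the diameter. As \<open>0\<close>
  is outside, so is the whole orbit. The unit vector \<open>v\<close> turns the diameter into the real one, with
  the endpoints of the rays on its upper side.\<close>

lemma orbit_avoids:
  assumes tp: "top_point m1 t w1" "top_point m2 t w2" and v: "v = edge_dir t \<or> v = - edge_dir t"
    and side: "Im (cnj v * eta m1) > 0" "Im (cnj v * eta m2) > 0"
    and cross: "\<And>c. c \<in> crossings t \<Longrightarrow> Re (cnj (edge_dir t) * c) < Re (cnj (edge_dir t) * w1) \<longleftrightarrow> Re (cnj (edge_dir t) * c) < Re (cnj (edge_dir t) * w2)"
    and m: "m \<in> M"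
  shows "cnj v * mob m 0 \<notin> between_rays (cnj v * eta m1) (Re (cnj v * w1)) (cnj v * eta m2) (Re (cnj v * w2))"
proof -
  define q1 q2 where "q1 = Re (cnj v * w1)" and "q2 = Re (cnj v * w2)"
  define \<eta>1 \<eta>2 where "\<eta>1 = cnj v * eta m1" and "\<eta>2 = cnj v * eta m2"
  have mt: "m1 \<in> M" "m2 \<in> M" "t \<in> T" "w1 \<in> seg t" "w2 \<in> seg t" "w1 \<notin> crossings t" "w2 \<notin> crossings t"
    using tp unfolding top_point_def by auto
  define u where "u = edge_dir t"
  have u1: "cmod u = 1" unfolding u_def by (rule edge_dir)
  have v1: "cmod v = 1" "cmod (cnj v) = 1" using v edge_dir(1)[of t] by auto
  have vv: "v * cnj v = 1" by (rule cnj_mult_self[OF v1(1)])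
  have q: "\<bar>q1\<bar> < 1" "\<bar>q2\<bar> < 1" "w1 = of_real q1 * v" "w2 = of_real q2 * v"
    using seg_real[OF mt(3,4)] seg_real[OF mt(3,5)] v unfolding q1_def q2_def
    by (auto simp del: times_complex.sel)
  have e: "cmod \<eta>1 = 1" "cmod \<eta>2 = 1" using eta(1) mt v1 by (auto simp: \<eta>1_def \<eta>2_def norm_mult)
  have rot1: "cay \<eta>1 (cnj v * z) = cay (eta m1) z" for z unfolding \<eta>1_def by (rule cay_rotate[OF v1(2)])
  have rot2: "cay \<eta>2 (cnj v * z) = cay (eta m2) z" for z unfolding \<eta>2_def by (rule cay_rotate[OF v1(2)])
  have vw: "cnj v * w1 = of_real q1" "cnj v * w2 = of_real q2" using vv unfolding q(3,4)
    by (simp_all add: mult.left_commute mult.commute)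
  define A where "A = {z. cnj v * z \<in> between_rays \<eta>1 q1 \<eta>2 q2}"
  have "edge m t' \<subseteq> A \<or> edge m t' \<inter> A = {}" if mt': "m \<in> M" "t' \<in> T" for m t'
  proof (cases "edge m t' \<inter> A = {}")
    case False
    define C where "C = (*) (cnj v) ` edge m t'"
    have "connected C" unfolding C_def
      by (intro connected_continuous_image edge_compact[OF mt'] continuous_intros)
    moreover have "C \<subseteq> \<Delta>" unfolding C_def using edge_disk[OF mt'] v1 by (auto simp: norm_mult)
    moreover have meets: "C \<inter> between_rays \<eta>1 q1 \<eta>2 q2 \<noteq> {}" using False unfolding C_def A_def by auto
    moreover have "C \<inter> ray \<eta>1 (of_real q1) = {}"
    proof -
      have False if "z \<in> edge m t'" "cnj v * z \<in> ray \<eta>1 (of_real q1)" for z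
        using that top_point_ray[OF tp(1) mt' that(1)] unfolding ray_def vw(1)[symmetric] by (simp add: rot1)
      then show ?thesis unfolding C_def by blast
    qed
    moreover have "C \<inter> ray \<eta>2 (of_real q2) = {}"
    proof -
      have False if "z \<in> edge m t'" "cnj v * z \<in> ray \<eta>2 (of_real q2)" for z
        using that top_point_ray[OF tp(2) mt' that(1)] unfolding ray_def vw(2)[symmetric] by (simp add: rot2)
      then show ?thesis unfolding C_def by blast
    qed
    moreover have "of_real x \<notin> C" if x: "q1 \<le> x" "x \<le> q2" for x
    proof
      assume "of_real x \<in> C"
      then obtain z where z: "z \<in> edge m t'" "of_real x = cnj v * z" unfolding C_def by blast
      have zx: "z = of_real x * v" using vv unfolding z(2) by (simp add: mult.left_commute mult.commute)
      have "z \<in> closed_segment w1 w2"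
      proof (cases "q1 = q2")
        case True
        then have "z = w1" using x zx q by simp
        then show ?thesis by simp
      next
        case False
        then have lt: "q1 < q2" using x by simp
        define s where "s = (x - q1) / (q2 - q1)"
        have "s * (q2 - q1) = x - q1" unfolding s_def using lt by simp
        then have "x = (1 - s) * q1 + s * q2" by (simp add: algebra_simps)
        moreover have "0 \<le> s" "s \<le> 1" unfolding s_def using x lt by (auto simp: divide_simps)
        ultimately have s: "0 \<le> s" "s \<le> 1" "x = (1 - s) * q1 + s * q2" by auto
        have "z = (1 - s) *\<^sub>R w1 + s *\<^sub>R w2" unfolding zx s(3) q(3,4)
          by (simp add: scaleR_conv_of_real algebra_simps)
        then show ?thesis unfolding in_segment using s by blast
      qed
      moreover have "closed_segment w1 w2 \<subseteq> seg t" using mt(4,5) unfolding seg_def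
        by (simp add: closed_segment_subset)
      ultimately have zs: "z \<in> seg t" by blast
      obtain y where y: "y \<in> edge m t'" "cnj v * y \<in> between_rays \<eta>1 q1 \<eta>2 q2"
        using meets unfolding C_def by blast
      have "Im (cnj v * y) > 0" using y(2) unfolding between_rays_def by simp
      then have "Im (cnj u * y) \<noteq> 0" using v unfolding u_def by auto
      then have zc: "z \<in> crossings t" unfolding crossings_def using zs mt' z(1) y(1) unfolding u_def by blast
      have "z \<noteq> w1" "z \<noteq> w2" using zc mt by auto
      then have "q1 < x" "x < q2" using x zx q by (auto simp: less_le)
      moreover have "Re (cnj u * z) = x \<and> Re (cnj u * w1) = q1 \<and> Re (cnj u * w2) = q2
         \<or> Re (cnj u * z) = - x \<and> Re (cnj u * w1) = - q1 \<and> Re (cnj u * w2) = - q2"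
      proof -
        have "Re (cnj v * z) = x" using z(2) by (metis Re_complex_of_real)
        moreover have "(\<forall>y. Re (cnj u * y) = Re (cnj v * y)) \<or> (\<forall>y. Re (cnj u * y) = - Re (cnj v * y))"
          using v unfolding u_def by (auto simp del: times_complex.sel)
        ultimately show ?thesis unfolding q1_def q2_def by metis
      qed
      ultimately show False using cross[OF zc] unfolding u_def by auto
    qed
    ultimately have "C \<subseteq> between_rays \<eta>1 q1 \<eta>2 q2"
      using connected_between_rays[OF e(1) _ e(2) _ q(1,2)] side unfolding \<eta>1_def[symmetric] \<eta>2_def[symmetric] by blast
    then show ?thesis unfolding C_def A_def by blast
  qed simp
  then have "mob m 0 \<in> A \<longleftrightarrow> 0 \<in> A" using orbit_separation[OF _ m] by blast
  moreover have "0 \<notin> A" unfolding A_def between_rays_def by simp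
  ultimately show ?thesis unfolding A_def q1_def q2_def \<eta>1_def \<eta>2_def by simp
qed

text \<open>Among infinitely many top points, three have rays that start on the same segment, end on the same
  side and have no crossing between their starting points. The regions between consecutive rays and
  the middle ray together fill a neighbourhood of the middle endpoint \<open>eta m2\<close> in the disk, and all
  of them avoid the orbit. But if the orbit accumulated at \<open>\<xi>\<close>, it would accumulate at
  \<open>eta m2\<close>, too.\<close>

theorem orbit_away: "\<exists>e>0. \<forall>m\<in>M. e \<le> cmod (mob m 0 - \<xi>)"
proof (rule ccontr)
  assume "\<not> ?thesis"
  then have acc: "e > 0 \<Longrightarrow> \<exists>m\<in>M. cmod (mob m 0 - \<xi>) < e" for e
    by (auto simp: not_le)
  define D where "D = {m. \<exists>t w. top_point m t w}"
  have infD: "infinite D" unfolding D_def using many_top_points acc by blast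
  have "\<forall>m\<in>D. \<exists>t w. top_point m t w" by (simp add: D_def)
  then obtain tt ww where tw: "\<And>m. m \<in> D \<Longrightarrow> top_point m (tt m) (ww m)" by metis
  have DM: "D \<subseteq> M" and tT: "\<And>m. m \<in> D \<Longrightarrow> tt m \<in> T" using tw unfolding top_point_def by blast+
  \<comment> \<open>The segment, the position of \<open>w\<close> relative to its crossings, and the side on which the ray
    ends.\<close>
  define pat where "pat = (\<lambda>m. (tt m, {c \<in> crossings (tt m). Re (cnj (edge_dir (tt m)) * c) < Re (cnj (edge_dir (tt m)) * ww m)},
     sgn (Im (cnj (edge_dir (tt m)) * eta m))))"
  have "pat ` D \<subseteq> T \<times> Pow (\<Union>t\<in>T. crossings t) \<times> {-1, 0, 1}"
  proof (rule image_subsetI)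
    fix m assume m: "m \<in> D"
    have "sgn x \<in> {-1, 0, 1::real}" for x by (simp add: sgn_if)
    moreover have "{c \<in> crossings (tt m). P c} \<in> Pow (\<Union>t\<in>T. crossings t)" for P using tT[OF m] by blast
    ultimately show "pat m \<in> T \<times> Pow (\<Union>t\<in>T. crossings t) \<times> {-1, 0, 1}"
      unfolding pat_def using tT[OF m] by blast
  qed
  moreover have "finite (T \<times> Pow (\<Union>t\<in>T. crossings t) \<times> {-1, 0, 1::real})"
    using finite_T finite_crossings by auto
  ultimately have "finite (pat ` D)" by (rule finite_subset)
  then obtain m0 where m0: "m0 \<in> D" "infinite {m \<in> D. pat m = pat m0}"
    using pigeonhole_infinite[OF infD] by blast
  define J where "J = {m \<in> D. pat m = pat m0}"
  define t where "t = tt m0"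
  define s where "s = sgn (Im (cnj (edge_dir t) * eta m0))"
  have Jp: "m \<in> D" "pat m = pat m0" "tt m = t" if "m \<in> J" for m
  proof -
    show D: "m \<in> D" and p: "pat m = pat m0" using that unfolding J_def by simp_all
    have "fst (pat m) = fst (pat m0)" using p by simp
    then show "tt m = t" unfolding pat_def t_def fst_conv .
  qed
  have J: "top_point m t (ww m)" "m \<in> M" "sgn (Im (cnj (edge_dir t) * eta m)) = s" if "m \<in> J" for m
  proof -
    note p = Jp[OF that]
    show "top_point m t (ww m)" using tw[OF p(1)] p(3) by simp
    show "m \<in> M" using p(1) DM by blast
    show "sgn (Im (cnj (edge_dir t) * eta m)) = s" using p unfolding pat_def s_def t_def
      by (simp del: times_complex.sel)
  qed
  have cross: "Re (cnj (edge_dir t) * c) < Re (cnj (edge_dir t) * ww m) \<longleftrightarrow> Re (cnj (edge_dir t) * c) < Re (cnj (edge_dir t) * ww m')"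
    if "m \<in> J" "m' \<in> J" "c \<in> crossings t" for m m' c
  proof -
    have "fst (snd (pat m)) = fst (snd (pat m'))" using Jp(2)[OF that(1)] Jp(2)[OF that(2)] by simp
    then have "{c \<in> crossings t. Re (cnj (edge_dir t) * c) < Re (cnj (edge_dir t) * ww m)}
      = {c \<in> crossings t. Re (cnj (edge_dir t) * c) < Re (cnj (edge_dir t) * ww m')}"
      unfolding pat_def fst_conv snd_conv Jp(3)[OF that(1)] Jp(3)[OF that(2)] .
    then show ?thesis using that(3) by blast
  qed
  have infeta: "infinite (eta ` J)"
  proof
    assume "finite (eta ` J)"
    then obtain m1 where m1: "m1 \<in> J" "infinite {m \<in> J. eta m = eta m1}"
      using pigeonhole_infinite[of J eta] m0(2) unfolding J_def by blast
    have "{m \<in> J. eta m = eta m1} \<subseteq> {m1, - m1}"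
    proof
      fix m assume "m \<in> {m \<in> J. eta m = eta m1}"
      then have "m \<in> J" "eta m = eta m1" by simp_all
      then have "m = m1 \<or> m = - m1" by (intro eta_inj_up_to_sign J(2) m1(1))
      then show "m \<in> {m1, - m1}" by simp
    qed
    then show False using m1(2) finite_subset by blast
  qed
  have u1: "cmod (edge_dir t) = 1" by (rule edge_dir)
  define v where "v = of_real s * edge_dir t"
  \<comment> \<open>Only two points of the circle lie on the diameter itself.\<close>
  have "s \<noteq> 0"
  proof
    assume s0: "s = 0"
    have "eta ` J \<subseteq> {edge_dir t, - edge_dir t}"
    proof
      fix z assume "z \<in> eta ` J"
      then obtain m where m: "m \<in> J" "z = eta m" by blast
      define x where "x = Re (cnj (edge_dir t) * z)"
      have "Im (cnj (edge_dir t) * z) = 0" using J(3)[OF m(1)] s0 m(2) by (simp only: sgn_zero_iff)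
      then have e: "cnj (edge_dir t) * z = of_real x" by (simp add: x_def complex_eq_iff)
      have "cmod (cnj (edge_dir t) * z) = 1" using u1 eta(1)[OF J(2)[OF m(1)]] m(2) by (simp add: norm_mult)
      then have "\<bar>x\<bar> = 1" unfolding e by simp
      moreover have "z = of_real x * edge_dir t"
        using cnj_mult_self[OF u1] e by (metis mult.assoc mult.commute mult.right_neutral)
      ultimately show "z \<in> {edge_dir t, - edge_dir t}" by (auto simp: abs_if split: if_splits)
    qed
    then show False using infeta finite_subset by blast
  qed
  then have s: "s = 1 \<or> s = -1" unfolding s_def by (simp add: sgn_if split: if_splits)
  then have v: "v = edge_dir t \<or> v = - edge_dir t" by (auto simp: v_def)
  have v1: "cmod v = 1" "cmod (cnj v) = 1" using v u1 by auto
  have side: "Im (cnj v * eta m) > 0" if "m \<in> J" for m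
  proof -
    have "Im (cnj v * eta m) = s * Im (cnj (edge_dir t) * eta m)" by (simp add: v_def algebra_simps)
    also have "\<dots> = \<bar>Im (cnj (edge_dir t) * eta m)\<bar>" unfolding J(3)[OF that, symmetric] by (simp only: linordered_idom_class.abs_sgn mult.commute)
    finally show ?thesis using J(3)[OF that] \<open>s \<noteq> 0\<close> by auto
  qed
  have n1: "cmod (cnj v * eta m) = 1" if "m \<in> J" for m using v1 eta(1)[OF J(2)[OF that]] by (simp add: norm_mult)
  define h where "h = (\<lambda>z. Re (cnj v * z))"
  have "inj_on h (eta ` J)"
  proof (rule inj_onI)
    fix x y assume xy: "x \<in> eta ` J" "y \<in> eta ` J" "h x = h y"
    have i: "Im (cnj v * x) > 0" "Im (cnj v * y) > 0" "cmod (cnj v * x) = 1" "cmod (cnj v * y) = 1"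
      using xy side n1 by auto
    have "(Im (cnj v * x))\<^sup>2 = (Im (cnj v * y))\<^sup>2"
      using cmod1_Re_Im[OF i(3)] cmod1_Re_Im[OF i(4)] xy(3) unfolding h_def by (metis add_left_cancel)
    then have "Im (cnj v * x) = Im (cnj v * y)" using i(1,2) power2_eq_imp_eq less_imp_le by blast
    then have "cnj v * x = cnj v * y" using xy(3) unfolding h_def by (metis complex_eqI)
    then show "x = y" using v1 by auto
  qed
  then have "infinite (h ` eta ` J)" using infeta finite_imageD by blast
  then obtain x1 x2 x3 where x: "x1 \<in> h ` eta ` J" "x2 \<in> h ` eta ` J" "x3 \<in> h ` eta ` J" "x1 < x2" "x2 < x3"
    using infinite_three_ordered by metis
  obtain m1 m2 m3 where m: "m1 \<in> J" "m2 \<in> J" "m3 \<in> J" "x1 = h (eta m1)" "x2 = h (eta m2)" "x3 = h (eta m3)"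
    using x by auto
  define e1 e2 e3 where "e1 = cnj v * eta m1" and "e2 = cnj v * eta m2" and "e3 = cnj v * eta m3"
  define q1 q2 q3 where "q1 = Re (cnj v * ww m1)" and "q2 = Re (cnj v * ww m2)" and "q3 = Re (cnj v * ww m3)"
  have e: "cmod e1 = 1" "cmod e2 = 1" "cmod e3 = 1" "Im e1 > 0" "Im e2 > 0" "Im e3 > 0" "Re e1 < Re e2" "Re e2 < Re e3"
    using n1 side m x(4,5) unfolding e1_def e2_def e3_def h_def by auto
  have ms: "t \<in> T" "ww m1 \<in> seg t" "ww m2 \<in> seg t" "ww m3 \<in> seg t" using J(1) m(1-3) unfolding top_point_def by auto
  have q: "\<bar>q1\<bar> < 1" "\<bar>q2\<bar> < 1" "\<bar>q3\<bar> < 1"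
    using seg_real(2)[OF ms(1,2)] seg_real(2)[OF ms(1,3)] seg_real(2)[OF ms(1,4)] v
    unfolding q1_def q2_def q3_def by (auto simp del: times_complex.sel)
  have avoid12: "cnj v * mob p 0 \<notin> between_rays e1 q1 e2 q2" if "p \<in> M" for p
    unfolding e1_def e2_def q1_def q2_def
    using orbit_avoids[OF J(1)[OF m(1)] J(1)[OF m(2)] v side[OF m(1)] side[OF m(2)] cross[OF m(1,2)] that] .
  have avoid23: "cnj v * mob p 0 \<notin> between_rays e2 q2 e3 q3" if "p \<in> M" for p
    unfolding e3_def e2_def q3_def q2_def
    using orbit_avoids[OF J(1)[OF m(2)] J(1)[OF m(3)] v side[OF m(2)] side[OF m(3)] cross[OF m(2,3)] that] .
  define f where "f = (\<lambda>z. min (Im z) (min (Re (cay e1 z) - Re (cay e1 (of_real q1))) (Re (cay e3 (of_real q3)) - Re (cay e3 z))))"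
  have ne: "e2 \<noteq> e1" "e2 \<noteq> e3" using e by auto
  have "isCont (cay e1) e2" "isCont (cay e3) e2" unfolding cay_def using ne by (intro continuous_intros; simp)+
  then have "isCont f e2" unfolding f_def
    by (intro continuous_intros continuous_Re continuous_Im continuous_ident)
  moreover have "f e2 > 0"
    using cay_order(1)[OF e(1,2,4,5) q(1) e(7)] cay_order(2)[OF e(3,2,6,5) q(3) e(8)] e unfolding f_def by auto
  ultimately have "eventually (\<lambda>z. f z > 0) (nhds e2)"
    by (simp add: continuous_at_imp_continuous_at_within isCont_def tendsto_at_iff_tendsto_nhds order_tendstoD(1))
  then obtain d where d: "d > 0" "\<And>z. dist z e2 < d \<Longrightarrow> f z > 0" unfolding eventually_nhds_metric by blast
  have SU2: "minv m2 \<in> SU11" using M_SU minv_M J(2) m(2) by blast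
  obtain d' where d': "d' > 0" "\<And>z. z \<in> cball 0 1 \<Longrightarrow> dist z \<xi> < d' \<Longrightarrow> dist (mob (minv m2) z) (mob (minv m2) \<xi>) < d"
    using continuous_mob[OF SU2] d(1) \<xi> unfolding continuous_on_iff by (metis mem_cball_0 order_refl)
  obtain p where p: "p \<in> M" "cmod (mob p 0 - \<xi>) < d'" using acc[OF d'(1)] by blast
  define r where "r = mmul (minv m2) p"
  have rM: "r \<in> M" unfolding r_def using mmul_M minv_M J(2) m(2) p(1) by blast
  have "mob r 0 = mob (minv m2) (mob p 0)" unfolding r_def using mob_mmul[OF M_SU[OF p(1)]] by simp
  moreover have "mob p 0 \<in> cball 0 1" using mob_le_1[OF M_SU[OF p(1)], of 0] by simp
  ultimately have "dist (mob r 0) (eta m2) < d" using d'(2) p(2) unfolding eta_def by (simp add: dist_norm)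
  moreover have "dist (cnj v * mob r 0) e2 = dist (mob r 0) (eta m2)"
    unfolding e2_def dist_norm right_diff_distrib[symmetric] norm_mult v1 by simp
  ultimately have fp: "f (cnj v * mob r 0) > 0" using d(2) by simp
  define z where "z = cnj v * mob r 0"
  have zD: "cmod z < 1" unfolding z_def norm_mult v1 using mob_less_1[OF M_SU[OF rM], of 0] by simp
  have z: "Im z > 0" "Re (cay e1 z) > Re (cay e1 (of_real q1))" "Re (cay e3 z) < Re (cay e3 (of_real q3))"
    using fp unfolding f_def z_def by auto
  have "\<not> Re (cay e2 z) < Re (cay e2 (of_real q2))" using avoid12[OF rM] z zD unfolding between_rays_def z_def by auto
  moreover have "\<not> Re (cay e2 z) > Re (cay e2 (of_real q2))" using avoid23[OF rM] z zD unfolding between_rays_def z_def by auto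
  ultimately have eq: "Re (cay e2 z) = Re (cay e2 (of_real q2))" by simp
  have up: "Im (cay e2 z) > Im (cay e2 (of_real q2))" by (rule cay_above_diameter[OF e(2,5) zD z(1) q(2) eq])
  have "cnj v * ww m2 = of_real q2"
  proof -
    have "ww m2 = of_real q2 * v" using seg_real(1)[OF ms(1,3)] v unfolding q2_def by (auto simp del: times_complex.sel)
    then show ?thesis using cnj_mult_self[OF v1(1)] by (simp add: mult.left_commute mult.commute)
  qed
  then have "Re (cay (eta m2) (mob r 0)) = Re (cay (eta m2) (ww m2))" "Im (cay (eta m2) (mob r 0)) > Im (cay (eta m2) (ww m2))"
    using eq up cay_rotate[OF v1(2)] unfolding e2_def z_def by metis+
  then show False using top_point_ray[OF J(1)[OF m(2)] rM ms(1) edge_ends(1)] by fastforce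
qed

end

section \<open>Geometry of the Dirichlet domain\<close>

lemma den_sq: assumes "m \<in> SU11"
  shows "(cmod (den m z))\<^sup>2 = 1 + (cmod (snd m))\<^sup>2 * (1 + (cmod z)\<^sup>2) + 2 * Re (fst m * cnj (snd m) * z)"
proof -
  have "(cmod (den m z))\<^sup>2 = (cmod (snd m))\<^sup>2 * (cmod z)\<^sup>2 + (cmod (fst m))\<^sup>2 + 2 * Re (fst m * cnj (snd m) * z)"
    unfolding den_def cmod_power2 by (simp add: power2_eq_square algebra_simps)
  then show ?thesis using assms unfolding SU11_iff by (simp add: algebra_simps)
qed

lemma den_lipschitz: assumes "m \<in> SU11"
  shows "cmod (den m z) \<le> cmod (den m w) + cmod (fst m) * cmod (z - w)"
proof -
  have "den m z = den m w + cnj (snd m) * (z - w)" by (simp add: den_def algebra_simps)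
  then have "cmod (den m z) \<le> cmod (den m w) + cmod (snd m) * cmod (z - w)"
    by (metis complex_mod_cnj norm_mult norm_triangle_ineq)
  also have "cmod (snd m) * cmod (z - w) \<le> cmod (fst m) * cmod (z - w)"
    using SU11_cmod(1)[OF assms] by (intro mult_right_mono) auto
  finally show ?thesis by simp
qed

lemma radial_projection: assumes "w \<noteq> 0" "cmod w < 1"
  shows "cmod (sgn w - w) = 1 - cmod w"
proof -
  have "sgn w * of_real (cmod w) = w" using assms(1) by (simp add: sgn_eq)
  then have "sgn w - w = sgn w - sgn w * of_real (cmod w)" by simp
  also have "\<dots> = sgn w * of_real (1 - cmod w)" by (simp add: algebra_simps)
  finally have "cmod (sgn w - w) = cmod (sgn w) * \<bar>1 - cmod w\<bar>" by (simp only: norm_mult norm_of_real)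
  then show ?thesis using assms by (simp add: norm_sgn)
qed

context fuchsian_matrices
begin

text \<open>The Dirichlet domain and its boundary at infinity in terms of matrices: a point is at least as
  close to \<open>0\<close> as to the orbit iff no derivative of a group element there exceeds \<open>1\<close>.\<close>

definition fund :: "complex set"
  where "fund = {w \<in> \<Delta>. \<forall>m\<in>M. 1 \<le> cmod (den m w)}"

definition ideal_points :: "complex set"
  where "ideal_points = {\<xi>. cmod \<xi> = 1 \<and> (\<forall>m\<in>M. 1 \<le> cmod (den m \<xi>))}"

lemma one_le_den_iff: assumes "m \<in> M"
  shows "1 \<le> cmod (den m z) \<longleftrightarrow> 0 \<le> (cmod (snd m))\<^sup>2 * (1 + (cmod z)\<^sup>2) + 2 * Re (fst m * cnj (snd m) * z)"
proof -
  have "1 \<le> cmod (den m z) \<longleftrightarrow> 1 \<le> (cmod (den m z))\<^sup>2"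
    by (metis norm_ge_zero one_power2 power2_le_iff_abs_le abs_one abs_le_square_iff abs_norm_cancel)
  then show ?thesis unfolding den_sq[OF M_SU[OF assms]] by simp
qed

lemma closure_fund_den: assumes "w \<in> closure fund" "m \<in> M" shows "1 \<le> cmod (den m w)"
proof -
  have "closed {z. 1 \<le> cmod (den m z)}"
    unfolding den_def by (intro closed_Collect_le continuous_intros)
  moreover have "fund \<subseteq> {z. 1 \<le> cmod (den m z)}" using assms(2) unfolding fund_def by blast
  ultimately show ?thesis using assms(1) closure_minimal by blast
qed

lemma closure_fund_cball: "closure fund \<subseteq> cball 0 1"
  by (intro closure_minimal) (auto simp: fund_def)

lemma compact_closure_fund: "compact (closure fund)"
  using closure_fund_cball by (meson bounded_cball bounded_subset closed_closure compact_eq_bounded_closed)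

text \<open>The constraints extend to the closure by continuity. Conversely the radius to an ideal point lies
  in the domain, which is star-shaped about \<open>0\<close>.\<close>

lemma ideal_points_closure: "closure fund \<inter> sphere 0 1 = ideal_points"
proof
  show "closure fund \<inter> sphere 0 1 \<subseteq> ideal_points"
    using closure_fund_den unfolding ideal_points_def by auto
  show "ideal_points \<subseteq> closure fund \<inter> sphere 0 1"
  proof
    fix \<xi> assume \<xi>: "\<xi> \<in> ideal_points"
    have \<xi>1: "cmod \<xi> = 1" using \<xi> unfolding ideal_points_def by simp
    have tf: "of_real t * \<xi> \<in> fund" if t: "0 \<le> t" "t < 1" for t
    proof -
      have "1 \<le> cmod (den m (of_real t * \<xi>))" if m: "m \<in> M" for m
      proof -
        define c k where "c = (cmod (snd m))\<^sup>2" and "k = Re (fst m * cnj (snd m) * \<xi>)"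
        have "0 \<le> c * (1 + 1\<^sup>2) + 2 * k"
          using \<xi> m one_le_den_iff[OF m, of \<xi>] unfolding ideal_points_def c_def k_def by simp
        then have "0 \<le> c + k" by simp
        then have "0 \<le> t * (c + k)" using t by simp
        moreover have "0 \<le> c * (1 - t)\<^sup>2" unfolding c_def by simp
        ultimately have "0 \<le> c * (1 - t)\<^sup>2 + 2 * (t * (c + k))" by simp
        also have "\<dots> = c * (1 + t\<^sup>2) + 2 * (t * k)" by (simp add: power2_eq_square algebra_simps)
        also have "t * k = Re (fst m * cnj (snd m) * (of_real t * \<xi>))" unfolding k_def by (simp add: algebra_simps)
        finally show ?thesis unfolding one_le_den_iff[OF m] c_def using \<xi>1 t by (simp add: norm_mult)
      qed
      moreover have "cmod (of_real t * \<xi>) < 1" using \<xi>1 t by (simp add: norm_mult)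
      ultimately show ?thesis unfolding fund_def by simp
    qed
    have "\<xi> \<in> closure fund" unfolding closure_approachable
    proof safe
      fix e :: real assume e: "e > 0"
      define t where "t = max 0 (1 - e / 2)"
      have t: "0 \<le> t" "t < 1" "1 - t < e" unfolding t_def using e by auto
      have "of_real t * \<xi> - \<xi> = of_real (t - 1) * \<xi>" by (simp add: algebra_simps)
      then have "dist (of_real t * \<xi>) \<xi> = \<bar>t - 1\<bar>"
        unfolding dist_norm using \<xi>1 by (simp only: norm_mult norm_of_real mult_1_right)
      then have "dist (of_real t * \<xi>) \<xi> < e" using t by simp
      then show "\<exists>y\<in>fund. dist y \<xi> < e" using tf[OF t(1,2)] by blast
    qed
    then show "\<xi> \<in> closure fund \<inter> sphere 0 1" using \<xi>1 by simp
  qed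
qed

text \<open>By the chain rule, an element \<open>m\<close> with maximal \<open>\<bar>m' z\<bar>\<close> moves \<open>z\<close> to a point where no derivative
  exceeds \<open>1\<close>. The maximum exists if \<open>z\<close> is not a limit point, also for \<open>z\<close> on the circle.\<close>

lemma exists_representative:
  assumes "cmod z \<le> 1" "e > 0" "\<And>m. m \<in> M \<Longrightarrow> e * cmod (fst m) \<le> cmod (den m z)"
  shows "\<exists>m\<in>M. \<forall>h\<in>M. 1 \<le> cmod (den h (mob m z))"
proof -
  define S where "S = {m \<in> M. cmod (den m z) \<le> 1}"
  have "S \<subseteq> {m \<in> M. cmod (fst m) \<le> 1 / e}"
  proof
    fix m assume "m \<in> S"
    then have "m \<in> M" "e * cmod (fst m) \<le> 1" using assms(3)[of m] unfolding S_def by auto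
    then show "m \<in> {m \<in> M. cmod (fst m) \<le> 1 / e}" using assms(2) by (simp add: field_simps)
  qed
  then have fin: "finite S" using finite_M finite_subset by blast
  have "(1,0) \<in> S" unfolding S_def using one_M by simp
  then obtain m where m: "m \<in> S" "\<And>h. h \<in> S \<Longrightarrow> cmod (den m z) \<le> cmod (den h z)"
    using arg_min_if_finite[OF fin, of "\<lambda>m. cmod (den m z)"] by (metis empty_iff linorder_not_le)
  have mM: "m \<in> M" "cmod (den m z) \<le> 1" using m(1) unfolding S_def by auto
  have min: "cmod (den m z) \<le> cmod (den h z)" if "h \<in> M" for h
    using m(2)[of h] mM(2) that unfolding S_def by force
  have "1 \<le> cmod (den h (mob m z))" if "h \<in> M" for h
  proof -
    have "cmod (den m z) \<le> cmod (den (mmul h m) z)" using min mmul_M that mM by blast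
    also have "\<dots> = cmod (den h (mob m z)) * cmod (den m z)"
      using den_mmul[OF M_SU[OF mM(1)] assms(1)] by (simp add: norm_mult)
    finally have "1 * cmod (den m z) \<le> cmod (den h (mob m z)) * cmod (den m z)" by simp
    moreover have "cmod (den m z) > 0" using den_nz[OF M_SU[OF mM(1)] assms(1)] by simp
    ultimately show ?thesis by (simp only: mult_le_cancel_right_pos)
  qed
  then show ?thesis using mM by blast
qed

lemma fund_covers: assumes "z \<in> \<Delta>" shows "\<exists>m\<in>M. mob m z \<in> fund"
proof -
  have z: "cmod z < 1" using assms by simp
  have "(1 - cmod z) * cmod (fst m) \<le> cmod (den m z)" if "m \<in> M" for m
    using den_lower[OF M_SU[OF that], of z] by (simp add: mult.commute)
  then obtain m where "m \<in> M" "\<forall>h\<in>M. 1 \<le> cmod (den h (mob m z))"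
    using exists_representative[of z "1 - cmod z"] z by auto
  then show ?thesis unfolding fund_def using mob_less_1[OF M_SU _ , of m z] z by auto
qed

lemma ideal_points_nonempty:
  assumes "cmod \<xi> = 1" "e > 0" "\<And>m. m \<in> M \<Longrightarrow> e \<le> cmod (mob m 0 - \<xi>)"
  shows "ideal_points \<noteq> {}"
proof -
  have "e * cmod (fst m) \<le> cmod (den m \<xi>)" if "m \<in> M" for m
  proof -
    have "cmod (den m \<xi>) = cmod (fst m) * cmod (\<xi> - mob (minv m) 0)"
      using den_via_orbit[OF M_SU[OF that]] cmod_one_minus_cnj[OF assms(1)] by simp
    moreover have "e \<le> cmod (\<xi> - mob (minv m) 0)" using assms(3)[OF minv_M[OF that]] by (simp add: norm_minus_commute)
    ultimately show ?thesis by (metis mult.commute mult_left_mono norm_ge_zero)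
  qed
  then obtain m where m: "m \<in> M" "\<forall>h\<in>M. 1 \<le> cmod (den h (mob m \<xi>))"
    using exists_representative[of \<xi> e] assms by auto
  then have "mob m \<xi> \<in> ideal_points" unfolding ideal_points_def using mob_eq_1[OF M_SU[OF m(1)] assms(1)] by simp
  then show ?thesis by auto
qed

end

text \<open>The first assumption is the conclusion of \<open>orbit_away\<close>; the second one holds for groups of the
  second kind. The rest of the argument uses the group only through these two properties.\<close>

locale convex_cocompact_matrices = fuchsian_matrices +
  assumes away: "\<lbrakk>cmod \<xi> = 1; \<And>m. m \<in> M \<Longrightarrow> 1 \<le> cmod (den m \<xi>)\<rbrakk> \<Longrightarrow> \<exists>e>0. \<forall>m\<in>M. e \<le> cmod (mob m 0 - \<xi>)"
    and ideal_ne: "ideal_points \<noteq> {}"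
begin

text \<open>The quotient of the two sides is \<open>\<bar>1 - cnj p * w\<bar>\<close> with the orbit point \<open>p = m\<^sup>-\<^sup>1 0\<close>. It is
  only small if \<open>w\<close> and \<open>p\<close> are both close to the same point of the circle. In the limit this would be
  an ideal point at which the orbit accumulates.\<close>

lemma den_comparable: "\<exists>d>0. \<forall>w\<in>closure fund. \<forall>m\<in>M. d * cmod (fst m) \<le> cmod (den m w)"
proof (rule ccontr)
  assume neg: "\<not> ?thesis"
  define K where "K = closure fund \<times> cball (0::complex) 1"
  have "compact (closure fund)" by (rule compact_closure_fund)
  then have Kc: "compact K" unfolding K_def by (intro compact_Times) auto
  have "\<exists>wp. wp \<in> K \<and> (\<exists>m\<in>M. snd wp = mob m 0) \<and> cmod (1 - cnj (snd wp) * fst wp) < 1 / real (Suc n)" for n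
  proof -
    have "1 / real (Suc n) > 0" by simp
    then obtain w m where wm: "w \<in> closure fund" "m \<in> M" "cmod (den m w) < 1 / real (Suc n) * cmod (fst m)"
      using neg by (meson linorder_not_le)
    have "cmod (fst m) > 0" using SU11_cmod(2)[OF M_SU[OF wm(2)]] by linarith
    moreover have "cmod (fst m) * cmod (1 - cnj (mob (minv m) 0) * w) < cmod (fst m) * (1 / real (Suc n))"
      using wm(3) unfolding den_via_orbit[OF M_SU[OF wm(2)]] by (simp only: mult.commute)
    ultimately have "cmod (1 - cnj (mob (minv m) 0) * w) < 1 / real (Suc n)" by (simp only: mult_less_cancel_left_pos)
    moreover have "mob (minv m) 0 \<in> cball 0 1" using mob_le_1[OF M_SU[OF minv_M[OF wm(2)]], of 0] by simp
    ultimately show ?thesis unfolding K_def using wm(1) minv_M[OF wm(2)]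
      by (intro exI[of _ "(w, mob (minv m) 0)"] conjI bexI[of _ "minv m"]) simp_all
  qed
  then obtain f where f: "\<And>n. f n \<in> K" "\<And>n. \<exists>m\<in>M. snd (f n) = mob m 0"
    "\<And>n. cmod (1 - cnj (snd (f n)) * fst (f n)) < 1 / real (Suc n)" by metis
  obtain l r where lr: "l \<in> K" "strict_mono r" "(f \<circ> r) \<longlonglongrightarrow> l"
    using Kc f(1) unfolding compact_def by metis
  obtain \<xi> p where l: "l = (\<xi>, p)" by (cases l)
  have lim: "(\<lambda>n. fst (f (r n))) \<longlonglongrightarrow> \<xi>" "(\<lambda>n. snd (f (r n))) \<longlonglongrightarrow> p"
    using tendsto_fst[OF lr(3)] tendsto_snd[OF lr(3)] unfolding l by (simp_all add: o_def)
  have "(\<lambda>n. cmod (1 - cnj (snd (f (r n))) * fst (f (r n)))) \<longlonglongrightarrow> cmod (1 - cnj p * \<xi>)"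
    by (intro tendsto_intros lim)
  moreover have "(\<lambda>n. cmod (1 - cnj (snd (f (r n))) * fst (f (r n)))) \<longlonglongrightarrow> 0"
  proof (rule tendsto_sandwich[where f = "\<lambda>_. 0" and h = "\<lambda>n. 1 / real (Suc n)"])
    show "(\<lambda>n. 1 / real (Suc n)) \<longlonglongrightarrow> 0" by (rule LIMSEQ_Suc[OF lim_1_over_n]) 
    show "\<forall>\<^sub>F n in sequentially. cmod (1 - cnj (snd (f (r n))) * fst (f (r n))) \<le> 1 / real (Suc n)"
    proof (intro always_eventually allI)
      fix n
      have "n \<le> r n" by (rule seq_suble[OF lr(2)])
      then have "1 / real (Suc (r n)) \<le> 1 / real (Suc n)" by (intro divide_left_mono) auto
      then show "cmod (1 - cnj (snd (f (r n))) * fst (f (r n))) \<le> 1 / real (Suc n)" using f(3)[of "r n"] by linarith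
    qed
  qed auto
  ultimately have "cmod (1 - cnj p * \<xi>) = 0" using LIMSEQ_unique by blast
  then have pe: "cnj p * \<xi> = 1" by simp
  have le: "cmod p \<le> 1" "cmod \<xi> \<le> 1" "\<xi> \<in> closure fund" using lr(1) closure_fund_cball unfolding K_def l by auto
  have pr: "cmod p * cmod \<xi> = 1" using arg_cong[OF pe, of cmod] by (simp add: norm_mult)
  have "cmod p * cmod \<xi> \<le> 1 * cmod \<xi>" "cmod p * cmod \<xi> \<le> cmod p * 1"
    using le by (intro mult_right_mono mult_left_mono; simp)+
  then have one: "cmod \<xi> = 1" "cmod p = 1" using le pr by auto
  have "p = p * (cnj p * \<xi>)" using pe by simp
  also have "\<dots> = \<xi>" using cnj_mult_self[OF one(2)] by (simp add: mult.assoc[symmetric])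
  finally have p\<xi>: "p = \<xi>" .
  obtain e where e: "e > 0" "\<And>m. m \<in> M \<Longrightarrow> e \<le> cmod (mob m 0 - \<xi>)"
    using away[OF one(1)] closure_fund_den[OF le(3)] by blast
  have "\<forall>\<^sub>F n in sequentially. dist (snd (f (r n))) p < e" using lim(2) e(1) by (rule tendstoD)
  then obtain n where "dist (snd (f (r n))) p < e" by (auto simp: eventually_sequentially)
  then show False using e(2) f(2)[of "r n"] unfolding p\<xi> dist_norm by force
qed

text \<open>A constraint that holds strictly at \<open>\<xi>\<close> also holds nearby. One that holds with equality at
  \<open>\<xi>\<close> is bounded by a geodesic that ends at \<open>\<xi>\<close> orthogonally to the circle. If \<open>w\<close> satisfies it but
  the radial projection \<open>sgn w\<close> does not, the geodesic separates them, and \<open>w\<close> approaches \<open>\<xi>\<close>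
  nontangentially.\<close>

lemma constraint_nontangential:
  assumes m: "m \<in> M" and \<xi>: "cmod \<xi> = 1" "1 \<le> cmod (den m \<xi>)"
  shows "\<exists>e>0. \<exists>K\<ge>0. \<forall>w\<in>\<Delta>. cmod (w - \<xi>) < e \<longrightarrow> 1 \<le> cmod (den m w) \<longrightarrow>
     1 \<le> cmod (den m (sgn w)) \<or> cmod (w - \<xi>) \<le> K * (1 - cmod w)"
proof -
  define a where "a = cmod (fst m)"
  have a1: "1 \<le> a" "cmod (snd m) < a" unfolding a_def using SU11_cmod[OF M_SU[OF m]] by auto
  have proj: "cmod (sgn w - w) = 1 - cmod w" "cmod (sgn w) = 1" "sgn w * of_real (cmod w) = w"
      "cmod (sgn w - \<xi>) \<le> 2 * cmod (w - \<xi>)" "1 / 2 < cmod w"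
    if "w \<in> \<Delta>" "cmod (w - \<xi>) < 1 / 2" for w
  proof -
    have g: "1 - cmod w \<le> cmod (w - \<xi>)" using norm_triangle_ineq2[of \<xi> w] \<xi>(1) by (simp add: norm_minus_commute)
    then show h: "1 / 2 < cmod w" using that(2) by simp
    then have nz: "w \<noteq> 0" by auto
    show s1: "cmod (sgn w) = 1" using nz by (simp add: norm_sgn)
    show s2: "sgn w * of_real (cmod w) = w" using nz by (simp add: sgn_eq)
    show s3: "cmod (sgn w - w) = 1 - cmod w" using radial_projection nz that(1) by simp
    have "cmod (sgn w - \<xi>) \<le> cmod (sgn w - w) + cmod (w - \<xi>)"
      using norm_triangle_ineq[of "sgn w - w" "w - \<xi>"] by simp
    then show "cmod (sgn w - \<xi>) \<le> 2 * cmod (w - \<xi>)" using s3 g by simp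
  qed
  show ?thesis
  proof (cases "cmod (den m \<xi>) = 1")
    case False
    then have gap: "cmod (den m \<xi>) > 1" using \<xi> by simp
    define e where "e = min (1 / 2) ((cmod (den m \<xi>) - 1) / (2 * a))"
    have e: "e > 0" "e \<le> 1 / 2" "2 * a * e \<le> cmod (den m \<xi>) - 1"
      unfolding e_def using gap a1 by (auto simp: min_def field_simps)
    have "1 \<le> cmod (den m (sgn w))" if w: "w \<in> \<Delta>" "cmod (w - \<xi>) < e" for w
    proof -
      have "cmod (\<xi> - sgn w) \<le> 2 * e" using proj(4)[of w] w e by (simp add: norm_minus_commute)
      then have "a * cmod (\<xi> - sgn w) \<le> a * (2 * e)" using a1 by (intro mult_left_mono) auto
      then show ?thesis using den_lipschitz[OF M_SU[OF m], of \<xi> "sgn w"] e(3) unfolding a_def by simp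
    qed
    then show ?thesis using e(1) by (intro exI[of _ e] conjI exI[of _ 0]) auto
  next
    case True
    define b where "b = cmod (snd m)"
    have b0: "b \<ge> 0" unfolding b_def by simp
    \<comment> \<open>Near \<open>\<xi>\<close> the constraint is governed by \<open>k\<close>: its imaginary part, which is \<open>\<plusminus> b\<close>, is the slope along
      the circle.\<close>
    define k where "k = fst m * cnj (snd m) * \<xi>"
    have Rek: "Re k = - b\<^sup>2"
      using den_sq[OF M_SU[OF m], of \<xi>] True \<xi>(1) unfolding b_def k_def by simp
    have "(cmod k)\<^sup>2 = (1 + b\<^sup>2) * b\<^sup>2"
      using M_SU[OF m] \<xi>(1) unfolding k_def b_def SU11_iff by (simp add: norm_mult power_mult_distrib)
    then have Imk2: "(Im k)\<^sup>2 = b\<^sup>2" unfolding cmod_power2 Rek by (simp add: power2_eq_square algebra_simps)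
    then have Imk: "\<bar>Im k\<bar> = b" using b0 by (metis abs_of_nonneg real_sqrt_abs)
    define e where "e = 1 / (4 * (b + 1))"
    have e: "e > 0" "e \<le> 1 / 4" unfolding e_def using b0 by (auto simp: field_simps)
    have be: "b * e \<le> 1 / 4" unfolding e_def using b0 by (simp add: field_simps)
    have "1 \<le> cmod (den m (sgn w)) \<or> cmod (w - \<xi>) \<le> (1 + 4 * b) * (1 - cmod w)"
      if w: "w \<in> \<Delta>" "cmod (w - \<xi>) < e" "1 \<le> cmod (den m w)" for w
    proof (cases "1 \<le> cmod (den m (sgn w))")
      case False
      define \<rho> where "\<rho> = cmod w"
      have pw: "cmod (w - \<xi>) < 1 / 2" using w e by simp
      note p = proj[OF w(1) pw]
      have \<rho>: "1 / 2 < \<rho>" "\<rho> < 1" using p(5) w(1) unfolding \<rho>_def by auto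
      define v where "v = sgn w * cnj \<xi>"
      define x y where "x = Re v" and "y = Im v"
      have v\<xi>: "sgn w = v * \<xi>" unfolding v_def using cnj_mult_self[OF \<xi>(1)] by (simp add: mult.assoc mult.commute[of "cnj \<xi>"])
      have v1: "cmod v = 1" unfolding v_def using p(2) \<xi>(1) by (simp add: norm_mult)
      then have xy: "x\<^sup>2 + y\<^sup>2 = 1" unfolding x_def y_def by (rule cmod1_Re_Im)
      have "sgn w - \<xi> = (v - 1) * \<xi>" unfolding v\<xi> by (simp add: algebra_simps)
      then have dv: "cmod (sgn w - \<xi>) = cmod (v - 1)" using \<xi>(1) by (simp add: norm_mult)
      have small: "cmod (v - 1) \<le> 2 * e" using p(4) w(2) unfolding dv by simp
      have ysm: "\<bar>y\<bar> \<le> 2 * e" using abs_Im_le_cmod[of "v - 1"] small unfolding y_def by simp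
      have xp: "x \<ge> 0" using abs_Re_le_cmod[of "v - 1"] small e unfolding x_def by simp
      have "x \<le> 1" using abs_Re_le_cmod[of v] v1 unfolding x_def by simp
      then have x2: "1 - x \<le> y\<^sup>2" using xp xy mult_left_le[of x x] by (simp add: power2_eq_square)
      have x1: "0 \<le> 1 - x" using \<open>x \<le> 1\<close> by simp
      have nv: "fst m * cnj (snd m) * sgn w = k * v" unfolding v\<xi> k_def by (simp add: mult.assoc mult.left_commute)
      have Rkv: "Re (k * v) = - b\<^sup>2 * x - Im k * y" unfolding x_def y_def using Rek by simp
      define s where "s = Im k * y"
      have f1: "b\<^sup>2 * (1 - x) < s"
      proof -
        have "\<not> 0 \<le> b\<^sup>2 * (1 + 1\<^sup>2) + 2 * Re (k * v)"
          using False p(2) nv unfolding one_le_den_iff[OF m] b_def by simp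
        then show ?thesis unfolding Rkv s_def by (simp add: algebra_simps)
      qed
      have f2: "0 \<le> b\<^sup>2 * (1 + \<rho>\<^sup>2) + 2 * (\<rho> * Re (k * v))"
      proof -
        have "fst m * cnj (snd m) * w = of_real \<rho> * (k * v)"
          unfolding \<rho>_def nv[symmetric] using p(3) by (metis mult.assoc mult.commute)
        then have "Re (fst m * cnj (snd m) * w) = \<rho> * Re (k * v)" by simp
        then show ?thesis using w(3) unfolding one_le_den_iff[OF m] b_def \<rho>_def by simp
      qed
      then have f3: "2 * \<rho> * (s - b\<^sup>2 * (1 - x)) \<le> b\<^sup>2 * (1 - \<rho>)\<^sup>2"
        unfolding Rkv s_def by (simp add: power2_eq_square algebra_simps)
      have bx: "0 \<le> b\<^sup>2 * (1 - x)" using x1 by simp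
      then have s0: "0 < s" using f1 by linarith
      have sb: "s = b * \<bar>y\<bar>" using s0 Imk unfolding s_def by (metis abs_mult abs_of_pos)
      have "s \<le> 1 / 2"
      proof -
        have "b * \<bar>y\<bar> \<le> b * (2 * e)" using ysm b0 by (intro mult_left_mono) auto
        then show ?thesis using be sb by simp
      qed
      have "b\<^sup>2 * (1 - x) \<le> b\<^sup>2 * y\<^sup>2" using x2 by (intro mult_left_mono) auto
      also have "\<dots> = s * s" unfolding sb by (simp add: power2_eq_square)
      also have "\<dots> \<le> s * (1 / 2)" using s0 \<open>s \<le> 1 / 2\<close> by (intro mult_left_mono) auto
      finally have half: "s / 2 \<le> s - b\<^sup>2 * (1 - x)" by simp
      have "\<rho> * s = 2 * \<rho> * (s / 2)" by simp
      also have "\<dots> \<le> 2 * \<rho> * (s - b\<^sup>2 * (1 - x))" using half \<rho> by (intro mult_left_mono) auto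
      also have "\<dots> \<le> b\<^sup>2 * (1 - \<rho>)\<^sup>2" by (rule f3)
      also have "\<dots> \<le> b\<^sup>2 * (1 - \<rho>)"
        using \<rho> by (intro mult_left_mono) (auto simp: power2_eq_square intro: mult_left_le)
      finally have "\<rho> * s \<le> b\<^sup>2 * (1 - \<rho>)" .
      moreover have "(1 / 2) * s \<le> \<rho> * s" using \<rho> s0 by (intro mult_right_mono) auto
      ultimately have "b * \<bar>y\<bar> \<le> b * (2 * b * (1 - \<rho>))" unfolding sb by (simp add: power2_eq_square)
      moreover have "b > 0" using s0 sb b0 by (cases "b = 0") auto
      ultimately have yb: "\<bar>y\<bar> \<le> 2 * b * (1 - \<rho>)" by (simp only: mult_le_cancel_left_pos)
      have "cmod (v - 1) \<le> \<bar>Re (v - 1)\<bar> + \<bar>Im (v - 1)\<bar>" by (rule cmod_le)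
      also have "\<dots> = (1 - x) + \<bar>y\<bar>" using x1 unfolding x_def y_def by simp
      also have "1 - x \<le> \<bar>y\<bar>"
      proof -
        have "y\<^sup>2 = \<bar>y\<bar> * \<bar>y\<bar>" by (simp add: power2_eq_square)
        also have "\<dots> \<le> \<bar>y\<bar> * 1" using ysm e by (intro mult_left_mono) auto
        finally show ?thesis using x2 by simp
      qed
      finally have "cmod (v - 1) \<le> 2 * \<bar>y\<bar>" by simp
      moreover have "cmod (w - \<xi>) \<le> cmod (sgn w - w) + cmod (sgn w - \<xi>)"
        using norm_triangle_ineq[of "w - sgn w" "sgn w - \<xi>"] by (simp add: norm_minus_commute)
      ultimately have "cmod (w - \<xi>) \<le> (1 - \<rho>) + 2 * (2 * b * (1 - \<rho>))"
        using yb p(1) dv unfolding \<rho>_def by linarith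
      then show ?thesis unfolding \<rho>_def by (simp add: algebra_simps)
    qed simp
    then show ?thesis using e(1) b0 by (intro exI[of _ e] conjI exI[of _ "1 + 4 * b"]) auto
  qed
qed

text \<open>Only finitely many constraints matter near \<open>\<xi>\<close>, because \<open>den m\<close> is large there for all other
  \<open>m\<close>. If \<open>sgn w\<close> satisfies all of them, it is an ideal point at distance \<open>1 - \<bar>w\<bar>\<close> from \<open>w\<close>;
  otherwise \<open>\<xi>\<close> itself is close enough. The second case occurs, for instance, when
  \<open>\<xi>\<close> is an isolated ideal point, a common end of two sides.\<close>

lemma near_ideal_local: assumes "\<xi> \<in> ideal_points"
  shows "\<exists>e>0. \<exists>K. \<forall>w\<in>fund. cmod (w - \<xi>) < e \<longrightarrow> (\<exists>\<zeta>\<in>ideal_points. cmod (w - \<zeta>) \<le> K * (1 - cmod w))"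
proof -
  have \<xi>: "cmod \<xi> = 1" "\<And>m. m \<in> M \<Longrightarrow> 1 \<le> cmod (den m \<xi>)" using assms unfolding ideal_points_def by auto
  obtain d where d: "d > 0" "\<And>w m. w \<in> closure fund \<Longrightarrow> m \<in> M \<Longrightarrow> d * cmod (fst m) \<le> cmod (den m w)"
    using den_comparable by metis
  define M0 where "M0 = {m \<in> M. cmod (fst m) \<le> 2 / d}"
  have M0: "finite M0" "M0 \<subseteq> M" unfolding M0_def using finite_M by auto
  have "\<forall>m\<in>M0. \<exists>eK. fst eK > 0 \<and> snd eK \<ge> 0 \<and> (\<forall>w\<in>\<Delta>. cmod (w - \<xi>) < fst eK \<longrightarrow> 1 \<le> cmod (den m w) \<longrightarrow>
     1 \<le> cmod (den m (sgn w)) \<or> cmod (w - \<xi>) \<le> snd eK * (1 - cmod w))"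
  proof
    fix m assume "m \<in> M0"
    then have mM: "m \<in> M" using M0 by blast
    obtain e K where "e > 0" "K \<ge> 0" "\<forall>w\<in>\<Delta>. cmod (w - \<xi>) < e \<longrightarrow> 1 \<le> cmod (den m w) \<longrightarrow>
     1 \<le> cmod (den m (sgn w)) \<or> cmod (w - \<xi>) \<le> K * (1 - cmod w)"
      using constraint_nontangential[OF mM \<xi>(1) \<xi>(2)[OF mM]] by blast
    then show "\<exists>eK. fst eK > 0 \<and> snd eK \<ge> 0 \<and> (\<forall>w\<in>\<Delta>. cmod (w - \<xi>) < fst eK \<longrightarrow> 1 \<le> cmod (den m w) \<longrightarrow>
     1 \<le> cmod (den m (sgn w)) \<or> cmod (w - \<xi>) \<le> snd eK * (1 - cmod w))"
      by (intro exI[of _ "(e, K)"]) simp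
  qed
  then obtain h where h: "\<And>m. m \<in> M0 \<Longrightarrow> fst (h m) > 0" "\<And>m. m \<in> M0 \<Longrightarrow> snd (h m) \<ge> 0"
    "\<And>m w. m \<in> M0 \<Longrightarrow> w \<in> \<Delta> \<Longrightarrow> cmod (w - \<xi>) < fst (h m) \<Longrightarrow> 1 \<le> cmod (den m w) \<Longrightarrow>
     1 \<le> cmod (den m (sgn w)) \<or> cmod (w - \<xi>) \<le> snd (h m) * (1 - cmod w)" by metis
  define e where "e = Min (insert (min (1 / 2) (d / 4)) ((\<lambda>m. fst (h m)) ` M0))"
  define K where "K = Max (insert 1 ((\<lambda>m. snd (h m)) ` M0))"
  have e0: "e > 0" unfolding e_def using M0(1) h(1) d(1) by (subst Min_gr_iff) auto
  have e1: "e \<le> 1 / 2" "e \<le> d / 4" "\<And>m. m \<in> M0 \<Longrightarrow> e \<le> fst (h m)"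
  proof -
    have "e \<le> min (1 / 2) (d / 4)" unfolding e_def using M0(1) by (intro Min_le) auto
    then show "e \<le> 1 / 2" "e \<le> d / 4" by simp_all
    show "e \<le> fst (h m)" if "m \<in> M0" for m unfolding e_def using M0(1) that by (intro Min_le) auto
  qed
  have K: "1 \<le> K" "\<And>m. m \<in> M0 \<Longrightarrow> snd (h m) \<le> K" unfolding K_def using M0(1) by (auto intro: Max_ge)
  have "\<exists>\<zeta>\<in>ideal_points. cmod (w - \<zeta>) \<le> K * (1 - cmod w)" if w: "w \<in> fund" "cmod (w - \<xi>) < e" for w
  proof (cases "\<forall>m\<in>M0. 1 \<le> cmod (den m (sgn w))")
    case True
    have wD: "w \<in> \<Delta>" using w(1) unfolding fund_def by simp
    have g: "1 - cmod w \<le> cmod (w - \<xi>)" using norm_triangle_ineq2[of \<xi> w] \<xi>(1) by (simp add: norm_minus_commute)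
    then have "0 < cmod w" using w(2) e1(1) by linarith
    then have nz: "w \<noteq> 0" by auto
    have sw: "cmod (sgn w - w) = 1 - cmod w" using radial_projection nz wD by simp
    have near: "cmod (\<xi> - sgn w) \<le> d / 2"
    proof -
      have "cmod (\<xi> - sgn w) \<le> cmod (sgn w - w) + cmod (w - \<xi>)"
        using norm_triangle_ineq[of "sgn w - w" "w - \<xi>"] by (simp add: norm_minus_commute)
      then show ?thesis using sw g w(2) e1(2) by simp
    qed
    have "1 \<le> cmod (den m (sgn w))" if m: "m \<in> M" for m
    proof (cases "m \<in> M0")
      case False
      then have big: "2 / d < cmod (fst m)" using m unfolding M0_def by simp
      have "\<xi> \<in> closure fund" using assms ideal_points_closure by blast
      then have "d * cmod (fst m) \<le> cmod (den m \<xi>)" using d(2) m by blast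
      also have "\<dots> \<le> cmod (den m (sgn w)) + cmod (fst m) * cmod (\<xi> - sgn w)" by (rule den_lipschitz[OF M_SU[OF m]])
      also have "cmod (fst m) * cmod (\<xi> - sgn w) \<le> cmod (fst m) * (d / 2)" using near by (intro mult_left_mono) auto
      finally have "d / 2 * cmod (fst m) \<le> cmod (den m (sgn w))" by (simp add: mult.commute)
      moreover have "1 < d / 2 * cmod (fst m)" using big d(1) by (simp add: field_simps)
      ultimately show ?thesis by simp
    qed (use True in blast)
    then have "sgn w \<in> ideal_points" unfolding ideal_points_def using nz by (simp add: norm_sgn)
    moreover have "cmod (w - sgn w) \<le> K * (1 - cmod w)"
    proof -
      have "1 * (1 - cmod w) \<le> K * (1 - cmod w)" using K wD by (intro mult_right_mono) auto
      then show ?thesis using sw by (simp add: norm_minus_commute)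
    qed
    ultimately show ?thesis by blast
  next
    case False
    then obtain m where m: "m \<in> M0" "\<not> 1 \<le> cmod (den m (sgn w))" by blast
    have wD: "w \<in> \<Delta>" "1 \<le> cmod (den m w)" using w(1) m(1) M0(2) unfolding fund_def by auto
    have "cmod (w - \<xi>) < fst (h m)" using w(2) e1(3)[OF m(1)] by simp
    then have "cmod (w - \<xi>) \<le> snd (h m) * (1 - cmod w)" using h(3)[OF m(1) wD(1) _ wD(2)] m(2) by blast
    also have "\<dots> \<le> K * (1 - cmod w)" using K(2)[OF m(1)] wD by (intro mult_right_mono) auto
    finally show ?thesis using assms by blast
  qed
  then show ?thesis using e0 by blast
qed

text \<open>Compactness makes the constant uniform: a sequence of points that violates the estimate with
  growing constants tends to the circle, thus to an ideal point, where the local estimate holds.\<close>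

lemma near_ideal: "\<exists>K\<ge>1. \<forall>w\<in>fund. \<exists>\<zeta>\<in>ideal_points. cmod (w - \<zeta>) \<le> K * (1 - cmod w)"
proof (rule ccontr)
  assume neg: "\<not> ?thesis"
  have "\<exists>w\<in>fund. \<forall>\<zeta>\<in>ideal_points. real (Suc n) * (1 - cmod w) < cmod (w - \<zeta>)" for n
  proof -
    have "1 \<le> real (Suc n)" by simp
    show ?thesis
    proof (rule ccontr)
      assume "\<not> ?thesis"
      then have "\<forall>w\<in>fund. \<exists>\<zeta>\<in>ideal_points. cmod (w - \<zeta>) \<le> real (Suc n) * (1 - cmod w)"
        by (simp add: not_less)
      then show False using neg \<open>1 \<le> real (Suc n)\<close> by blast
    qed
  qed
  then obtain f where f: "\<And>n. f n \<in> fund" "\<And>n \<zeta>. \<zeta> \<in> ideal_points \<Longrightarrow> real (Suc n) * (1 - cmod (f n)) < cmod (f n - \<zeta>)"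
    by metis
  have "compact (closure fund)" by (rule compact_closure_fund)
  moreover have "\<And>n. f n \<in> closure fund" using f(1) closure_subset by blast
  ultimately obtain \<xi> r where lr: "\<xi> \<in> closure fund" "strict_mono r" "(f \<circ> r) \<longlonglongrightarrow> \<xi>"
    unfolding compact_def by metis
  have lim: "(\<lambda>n. f (r n)) \<longlonglongrightarrow> \<xi>" using lr(3) by (simp add: o_def)
  have fD: "cmod (f n) < 1" for n using f(1)[of n] unfolding fund_def by simp
  obtain \<zeta>0 where \<zeta>0: "\<zeta>0 \<in> ideal_points" using ideal_ne by blast
  have "(\<lambda>n. 1 - cmod (f (r n))) \<longlonglongrightarrow> 1 - cmod \<xi>" by (intro tendsto_intros lim)
  moreover have "(\<lambda>n. 1 - cmod (f (r n))) \<longlonglongrightarrow> 0"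
  proof (rule tendsto_sandwich[where f = "\<lambda>_. 0" and h = "\<lambda>n. 2 / real (Suc n)"])
    show "(\<lambda>n. 2 / real (Suc n)) \<longlonglongrightarrow> 0"
      using tendsto_mult_right_zero[OF LIMSEQ_Suc[OF lim_1_over_n], of 2] by simp
    show "\<forall>\<^sub>F n in sequentially. 1 - cmod (f (r n)) \<le> 2 / real (Suc n)"
    proof (intro always_eventually allI)
      fix n
      have "n \<le> r n" by (rule seq_suble[OF lr(2)])
      then have "real (Suc n) * (1 - cmod (f (r n))) \<le> real (Suc (r n)) * (1 - cmod (f (r n)))"
        using fD[of "r n"] by (intro mult_right_mono) auto
      also have "\<dots> < cmod (f (r n) - \<zeta>0)" by (rule f(2)[OF \<zeta>0])
      also have "\<dots> \<le> cmod (f (r n)) + cmod \<zeta>0" by (rule norm_triangle_ineq4)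
      also have "\<dots> \<le> 2" using fD[of "r n"] \<zeta>0 unfolding ideal_points_def by simp
      finally show "1 - cmod (f (r n)) \<le> 2 / real (Suc n)" by (simp add: field_simps)
    qed
    show "\<forall>\<^sub>F n in sequentially. 0 \<le> 1 - cmod (f (r n))" using fD by (simp add: less_imp_le)
  qed auto
  ultimately have "1 - cmod \<xi> = 0" using LIMSEQ_unique by blast
  then have "\<xi> \<in> closure fund \<inter> sphere 0 1" using lr(1) by simp
  then have "\<xi> \<in> ideal_points" unfolding ideal_points_closure .
  then obtain e K where eK: "e > 0" "\<And>w. w \<in> fund \<Longrightarrow> cmod (w - \<xi>) < e \<Longrightarrow> \<exists>\<zeta>\<in>ideal_points. cmod (w - \<zeta>) \<le> K * (1 - cmod w)"
    using near_ideal_local by metis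
  have "\<forall>\<^sub>F n in sequentially. dist (f (r n)) \<xi> < e" using lim eK(1) by (rule tendstoD)
  then obtain n0 where n0: "\<And>n. n \<ge> n0 \<Longrightarrow> dist (f (r n)) \<xi> < e" by (auto simp: eventually_sequentially)
  obtain n1 where n1: "K \<le> real n1" using real_arch_simple by blast
  define n where "n = max n0 n1"
  have "dist (f (r n)) \<xi> < e" using n0[of n] by (simp add: n_def)
  then obtain \<zeta> where \<zeta>: "\<zeta> \<in> ideal_points" "cmod (f (r n) - \<zeta>) \<le> K * (1 - cmod (f (r n)))"
    using eK(2)[OF f(1)] by (auto simp: dist_norm)
  have "K \<le> real (Suc (r n))" using n1 seq_suble[OF lr(2), of n] unfolding n_def by linarith
  then have "K * (1 - cmod (f (r n))) \<le> real (Suc (r n)) * (1 - cmod (f (r n)))"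
    using fD[of "r n"] by (intro mult_right_mono) auto
  then show False using \<zeta>(2) f(2)[OF \<zeta>(1), of "r n"] by linarith
qed

end

section \<open>Area under holomorphic maps\<close>

text \<open>The Jacobian is a determinant, so area estimates take place on \<open>real^2\<close>, which these maps identify
  with the complex plane.\<close>

definition vec_of :: "complex \<Rightarrow> real^2"
  where "vec_of z = vector [Re z, Im z]"

definition of_vec :: "real^2 \<Rightarrow> complex"
  where "of_vec v = Complex (v $ 1) (v $ 2)"

lemma vec_of_nth [simp]: "vec_of z $ 1 = Re z" "vec_of z $ 2 = Im z"
  by (simp_all add: vec_of_def)

lemma of_vec_of [simp]: "of_vec (vec_of z) = z" "vec_of (of_vec v) = v"
  by (simp_all add: of_vec_def complex_eq_iff vec_eq_iff forall_2)

lemma linear_vec_of: "linear vec_of"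
  by (rule linearI) (simp_all add: vec_eq_iff forall_2)

lemma linear_of_vec: "linear of_vec"
  by (rule linearI) (simp_all add: of_vec_def complex_eq_iff)

lemma bounded_linear_vec: "bounded_linear vec_of" "bounded_linear of_vec"
  using linear_vec_of linear_of_vec by (auto simp: linear_conv_bounded_linear)

lemma borel_vec [measurable]: "vec_of \<in> borel_measurable borel" "of_vec \<in> borel_measurable borel"
  using bounded_linear_vec by (auto intro!: borel_measurable_continuous_onI linear_continuous_on)

lemma lborel_of_vec: "lborel = distr lborel borel of_vec"
proof (rule lborel_eqI)
  fix l u :: complex assume le: "\<And>b. b \<in> Basis \<Longrightarrow> l \<bullet> b \<le> u \<bullet> b"
  have b: "Re l \<le> Re u" "Im l \<le> Im u" using le[of 1] le[of \<i>] by (auto simp: Basis_complex_def inner_complex_def)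
  have pre: "of_vec -` box l u = box (vec_of l) (vec_of u)"
  proof (rule Set.set_eqI)
    fix v
    have "v \<in> of_vec -` box l u \<longleftrightarrow> (Re l < v $ 1 \<and> v $ 1 < Re u) \<and> (Im l < v $ 2 \<and> v $ 2 < Im u)"
      unfolding vimage_eq mem_box by (simp add: Basis_complex_def inner_complex_def of_vec_def)
    also have "\<dots> \<longleftrightarrow> v \<in> box (vec_of l) (vec_of u)"
      unfolding mem_box_cart by (simp add: forall_2)
    finally show "v \<in> of_vec -` box l u \<longleftrightarrow> v \<in> box (vec_of l) (vec_of u)" .
  qed
  have "emeasure (distr lborel borel of_vec) (box l u) = emeasure lborel (of_vec -` box l u)"
    by (subst emeasure_distr) auto
  also have "\<dots> = emeasure lborel (cbox (vec_of l) (vec_of u))"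
    unfolding pre emeasure_lborel_box_eq emeasure_lborel_cbox_eq by simp
  also have "\<dots> = ennreal (measure lborel (cbox (vec_of l) (vec_of u)))"
    using emeasure_lborel_cbox_finite[of "vec_of l" "vec_of u"]
    by (metis emeasure_eq_ennreal_measure infinity_ennreal_def less_irrefl)
  also have "measure lborel (cbox (vec_of l) (vec_of u)) = (\<Prod>b\<in>Basis. (u - l) \<bullet> b)"
  proof -
    have "cbox (vec_of l) (vec_of u) \<noteq> {}" using b by (auto simp: interval_ne_empty_cart forall_2)
    then show ?thesis by (subst content_cbox_cart) (simp_all add: UNIV_2 Basis_complex_def inner_complex_def)
  qed
  finally show "emeasure (distr lborel borel of_vec) (box l u) = (\<Prod>b\<in>Basis. (u - l) \<bullet> b)" .
qed simp

lemma lborel_vec_of: "lborel = distr lborel borel vec_of"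
proof -
  have "distr lborel borel vec_of = distr (distr lborel borel of_vec) borel vec_of"
    using lborel_of_vec by simp
  also have "\<dots> = distr lborel borel (\<lambda>x. x)" by (subst distr_distr) (simp_all add: o_def)
  also have "\<dots> = distr lborel lborel (\<lambda>x. x)" by (intro distr_cong) auto
  finally show ?thesis by (simp add: distr_id)
qed

lemma lebesgue_image_iso:
  fixes U :: "'a::euclidean_space \<Rightarrow> 'b::euclidean_space"
  assumes [measurable]: "V \<in> borel_measurable borel"
    and UV: "\<And>y. U (V y) = y" "\<And>x. V (U x) = x" and V: "lborel = distr lborel borel V"
    and S: "S \<in> sets lebesgue"
  shows "U ` S \<in> sets lebesgue" "emeasure lebesgue (U ` S) = emeasure lebesgue S"
proof -
  have img: "U ` B = V -` B" for B using UV by (auto simp: image_iff) metis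
  have bor: "U ` B \<in> sets borel" "emeasure lborel (U ` B) = emeasure lborel B" if "B \<in> sets borel" for B
  proof -
    show "U ` B \<in> sets borel" unfolding img using measurable_sets[OF assms(1) that] by simp
    have "emeasure lborel B = emeasure (distr lborel borel V) B" using V by simp
    also have "\<dots> = emeasure lborel (V -` B)" using that by (subst emeasure_distr) auto
    finally show "emeasure lborel (U ` B) = emeasure lborel B" unfolding img by simp
  qed
  obtain B N N' where S: "S = B \<union> N" "N \<subseteq> N'" "N' \<in> null_sets lborel" "B \<in> sets lborel"
    using S by (rule sets_completionE)
  have N': "U ` N' \<in> null_sets lborel" using bor[of N'] S(3) by (auto simp: null_sets_def)
  have "U ` S = U ` B \<union> U ` N" "U ` N \<subseteq> U ` N'" using S by auto
  then show "U ` S \<in> sets lebesgue" using bor[of B] S(4) N' by (intro sets_completionI[of _ "U ` B" "U ` N" "U ` N'"]) auto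
  have null: "U ` N \<in> null_sets lebesgue" "N \<in> null_sets lebesgue"
    using N' S(2,3) by (meson image_mono null_sets_completion_subset null_sets_completionI)+
  have "emeasure lebesgue (U ` S) = emeasure lebesgue (U ` B)" unfolding \<open>U ` S = U ` B \<union> U ` N\<close>
    using bor[of B] S(4) null by (intro emeasure_Un_null_set) auto
  also have "\<dots> = emeasure lebesgue B" using bor[of B] S(4) by simp
  also have "\<dots> = emeasure lebesgue S" unfolding S(1) using S(4) null by (intro emeasure_Un_null_set[symmetric]) auto
  finally show "emeasure lebesgue (U ` S) = emeasure lebesgue S" .
qed

lemma vec_of_lebesgue: assumes "S \<in> sets lebesgue"
  shows "vec_of ` S \<in> sets lebesgue" "emeasure lebesgue (vec_of ` S) = emeasure lebesgue S"
  using lebesgue_image_iso[OF borel_vec(2), of vec_of] lborel_of_vec assms by auto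

lemma of_vec_lebesgue: assumes "S \<in> sets lebesgue"
  shows "of_vec ` S \<in> sets lebesgue" "emeasure lebesgue (of_vec ` S) = emeasure lebesgue S"
  using lebesgue_image_iso[OF borel_vec(1), of of_vec] lborel_vec_of assms by auto

text \<open>The real Jacobian determinant of a holomorphic map is \<open>\<bar>f'\<bar>\<^sup>2\<close>.\<close>

lemma lmeasurable_holomorphic_image_le:
  fixes f :: "complex \<Rightarrow> complex"
  assumes S: "S \<in> lmeasurable" and f: "\<And>z. z \<in> S \<Longrightarrow> (f has_field_derivative f' z) (at z within S)"
    and cont: "continuous_on S f'" and B: "\<And>z. z \<in> S \<Longrightarrow> cmod (f' z) \<le> B"
  shows "f ` S \<in> sets lebesgue" "emeasure lebesgue (f ` S) \<le> ennreal (B\<^sup>2) * emeasure lebesgue S"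
proof -
  define g where "g = vec_of \<circ> f \<circ> of_vec"
  define g' where "g' = (\<lambda>v h. vec_of (f' (of_vec v) * of_vec h))"
  define S' where "S' = vec_of ` S"
  have SL: "S \<in> sets lebesgue" using S by auto
  have S'S: "v \<in> S' \<longleftrightarrow> of_vec v \<in> S" for v unfolding S'_def by (metis image_iff of_vec_of)
  have S'm: "S' \<in> lmeasurable" unfolding S'_def fmeasurable_def
    using vec_of_lebesgue[OF SL] S by (auto simp: fmeasurable_def)
  have der: "(g has_derivative g' v) (at v within S')" if "v \<in> S'" for v
  proof -
    have "of_vec ` S' = S" unfolding S'_def by (simp add: image_image)
    moreover have "(f has_derivative (*) (f' (of_vec v))) (at (of_vec v) within S)"
      using f[of "of_vec v"] that S'S by (simp add: has_field_derivative_def)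
    ultimately have "(f has_derivative (*) (f' (of_vec v))) (at (of_vec v) within of_vec ` S')" by simp
    then have "((f \<circ> of_vec) has_derivative (*) (f' (of_vec v)) \<circ> of_vec) (at v within S')"
      by (rule diff_chain_within[OF bounded_linear_imp_has_derivative[OF bounded_linear_vec(2)]])
    then have "((vec_of \<circ> (f \<circ> of_vec)) has_derivative vec_of \<circ> ((*) (f' (of_vec v)) \<circ> of_vec)) (at v within S')"
      by (rule diff_chain_within[OF _ bounded_linear_imp_has_derivative[OF bounded_linear_vec(1)]])
    then show ?thesis unfolding g_def g'_def by (simp add: o_def)
  qed
  have det: "\<bar>det (matrix (g' v))\<bar> = (cmod (f' (of_vec v)))\<^sup>2" for v
    unfolding det_2 g'_def matrix_def cmod_power2
    by (simp add: of_vec_def axis_def power2_eq_square)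
  have detB: "\<bar>det (matrix (g' v))\<bar> \<le> B\<^sup>2" if "v \<in> S'" for v
    unfolding det using B[of "of_vec v"] that S'S by (intro power_mono) auto
  have "continuous_on S' (\<lambda>v. (cmod (f' (of_vec v)))\<^sup>2)"
  proof -
    have "continuous_on S' of_vec" by (rule linear_continuous_on[OF bounded_linear_vec(2)])
    moreover have "of_vec ` S' \<subseteq> S" using S'S by auto
    ultimately have "continuous_on S' (\<lambda>v. f' (of_vec v))" by (rule continuous_on_compose2[OF cont])
    then show ?thesis by (intro continuous_intros)
  qed
  then have "(\<lambda>v. (cmod (f' (of_vec v)))\<^sup>2) \<in> borel_measurable (lebesgue_on S')"
    using S'm by (intro continuous_imp_measurable_on_sets_lebesgue) auto
  moreover have "(\<lambda>v. B\<^sup>2) integrable_on S'" using S'm by (rule integrable_on_const)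
  ultimately have int: "(\<lambda>v. (cmod (f' (of_vec v)))\<^sup>2) integrable_on S'"
  proof (rule measurable_bounded_by_integrable_imp_integrable)
    show "norm ((cmod (f' (of_vec v)))\<^sup>2) \<le> B\<^sup>2" if "v \<in> S'" for v
      using detB[OF that] unfolding det by simp
    show "S' \<in> sets lebesgue" using S'm by auto
  qed
  have int': "(\<lambda>v. \<bar>det (matrix (g' v))\<bar>) integrable_on S'" unfolding det by (rule int)
  have gm: "g ` S' \<in> lmeasurable" and gle: "measure lebesgue (g ` S') \<le> B\<^sup>2 * measure lebesgue S'"
    using measurable_bounded_differentiable_image[OF S'm der int' detB]
      measure_bounded_differentiable_image[OF S'm der int' detB] by auto
  have gS: "g ` S' = vec_of ` f ` S" unfolding g_def S'_def by (simp add: image_image o_def)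
  have fS: "f ` S = of_vec ` g ` S'" unfolding gS by (simp add: image_image)
  show "f ` S \<in> sets lebesgue" unfolding fS using of_vec_lebesgue gm by auto
  have "emeasure lebesgue (f ` S) = emeasure lebesgue (g ` S')" unfolding fS using of_vec_lebesgue gm by auto
  also have "\<dots> = ennreal (measure lebesgue (g ` S'))" using gm by (rule emeasure_eq_measure2)
  also have "\<dots> \<le> ennreal (B\<^sup>2 * measure lebesgue S')" using gle by (rule ennreal_leI)
  also have "\<dots> = ennreal (B\<^sup>2) * emeasure lebesgue S'" unfolding emeasure_eq_measure2[OF S'm] by (simp add: ennreal_mult)
  also have "emeasure lebesgue S' = emeasure lebesgue S" unfolding S'_def by (rule vec_of_lebesgue(2)[OF SL])
  finally show "emeasure lebesgue (f ` S) \<le> ennreal (B\<^sup>2) * emeasure lebesgue S" .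
qed

lemma mob_derivative: assumes "m \<in> SU11" "cmod z \<le> 1"
  shows "(mob m has_field_derivative 1 / (den m z)\<^sup>2) (at z within S)"
proof -
  have nz: "cnj (snd m) * z + cnj (fst m) \<noteq> 0" using den_nz[OF assms] unfolding den_def .
  have s: "fst m * cnj (fst m) - snd m * cnj (snd m) = 1" using assms(1) SU11_cnj by simp
  have "((\<lambda>z. (fst m * z + snd m) / (cnj (snd m) * z + cnj (fst m))) has_field_derivative
     (fst m * (cnj (snd m) * z + cnj (fst m)) - (fst m * z + snd m) * cnj (snd m)) / ((cnj (snd m) * z + cnj (fst m)) * (cnj (snd m) * z + cnj (fst m)))) (at z within S)"
    using nz by (auto intro!: derivative_eq_intros)
  moreover have "fst m * (cnj (snd m) * z + cnj (fst m)) - (fst m * z + snd m) * cnj (snd m) = 1"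
    using s by (simp add: algebra_simps)
  ultimately show ?thesis unfolding mob_def den_def by (simp add: power2_eq_square)
qed

lemma emeasure_mob_image_le:
  assumes m: "m \<in> SU11" and S: "S \<in> sets lebesgue" "S \<subseteq> \<Delta>" and c: "c > 0" "\<And>z. z \<in> S \<Longrightarrow> c \<le> cmod (den m z)"
  shows "mob m ` S \<in> sets lebesgue" "emeasure lebesgue (mob m ` S) \<le> ennreal (1 / c ^ 4) * emeasure lebesgue S"
proof -
  have Sm: "S \<in> lmeasurable" using S bounded_subset[OF bounded_ball] by (intro bounded_set_imp_lmeasurable) auto
  have z: "cmod z \<le> 1" if "z \<in> S" for z using that S(2) by auto
  have d: "(mob m has_field_derivative 1 / (den m z)\<^sup>2) (at z within S)" if "z \<in> S" for z
    using mob_derivative[OF m z[OF that]] .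
  have ct: "continuous_on S (\<lambda>z. 1 / (den m z)\<^sup>2)"
    using den_nz[OF m] z by (intro continuous_intros continuous_den) auto
  have b: "cmod (1 / (den m z)\<^sup>2) \<le> 1 / c\<^sup>2" if "z \<in> S" for z
  proof -
    have "c\<^sup>2 \<le> (cmod (den m z))\<^sup>2" using c that by (intro power_mono) auto
    then show ?thesis using c(1) by (simp add: norm_divide norm_power frac_le)
  qed
  show "mob m ` S \<in> sets lebesgue" using lmeasurable_holomorphic_image_le(1)[OF Sm d ct b] .
  have "(1 / c\<^sup>2)\<^sup>2 = 1 / c ^ 4" by (simp add: power_divide flip: power_mult)
  then show "emeasure lebesgue (mob m ` S) \<le> ennreal (1 / c ^ 4) * emeasure lebesgue S"
    using lmeasurable_holomorphic_image_le(2)[OF Sm d ct b] by simp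
qed

text \<open>The area bound says that the push-forward of Lebesgue measure on \<open>mob m ` A\<close> under the inverse map
  is dominated by a multiple of Lebesgue measure on \<open>A\<close>. A bound in place of an exact formula suffices,
  since the derivative is comparable to a constant on the domain.\<close>

lemma nn_integral_mob_image_le:
  fixes \<psi> :: "complex \<Rightarrow> ennreal"
  assumes m: "m \<in> SU11" and A: "A \<in> sets lebesgue" "A \<subseteq> \<Delta>" and c: "c > 0" "\<And>z. z \<in> A \<Longrightarrow> c \<le> cmod (den m z)"
    and \<psi>: "\<psi> \<in> borel_measurable lebesgue"
  shows "(\<integral>\<^sup>+z\<in>mob m ` A. \<psi> (mob (minv m) z) \<partial>lebesgue) \<le> ennreal (1 / c ^ 4) * (\<integral>\<^sup>+z\<in>A. \<psi> z \<partial>lebesgue)"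
proof -
  define h where "h = mob (minv m)"
  have h: "h (mob m z) = z" if "z \<in> A" for z unfolding h_def using mob_minv(2)[OF m] that A(2) by auto
  have pre: "h -` E \<inter> mob m ` A = mob m ` (A \<inter> E)" for E using h by auto
  have img: "mob m ` (A \<inter> E) \<in> sets lebesgue" "emeasure lebesgue (mob m ` (A \<inter> E)) \<le> ennreal (1 / c ^ 4) * emeasure lebesgue (A \<inter> E)"
    if "E \<in> sets lebesgue" for E
  proof -
    have AE: "A \<inter> E \<in> sets lebesgue" "A \<inter> E \<subseteq> \<Delta>" "\<And>z. z \<in> A \<inter> E \<Longrightarrow> c \<le> cmod (den m z)"
      using A c that by auto
    show "mob m ` (A \<inter> E) \<in> sets lebesgue" "emeasure lebesgue (mob m ` (A \<inter> E)) \<le> ennreal (1 / c ^ 4) * emeasure lebesgue (A \<inter> E)"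
      by (rule emeasure_mob_image_le[OF m AE(1,2) c(1) AE(3)]; assumption)+
  qed
  have gA: "mob m ` A \<in> sets lebesgue" using img(1)[of UNIV] by simp
  define R where "R = restrict_space lebesgue (mob m ` A)"
  have hm: "h \<in> measurable R lebesgue"
  proof (rule measurableI)
    fix E :: "complex set" assume E: "E \<in> sets lebesgue"
    have "h -` E \<inter> space R = mob m ` (A \<inter> E)" unfolding R_def space_restrict_space using pre by simp
    moreover have "mob m ` (A \<inter> E) \<in> sets R" unfolding R_def
      using img(1)[OF E] gA by (subst sets_restrict_space_iff) auto
    ultimately show "h -` E \<inter> space R \<in> sets R" by simp
  qed simp
  define K where "K = density lebesgue (\<lambda>z. ennreal (1 / c ^ 4) * indicator A z)"
  have meas: "(\<lambda>z. ennreal (1 / c ^ 4) * indicator A z) \<in> borel_measurable lebesgue" using A(1) by measurable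
  have le: "distr R lebesgue h \<le> K"
  proof (subst le_measure)
    show "\<forall>E\<in>sets (distr R lebesgue h). emeasure (distr R lebesgue h) E \<le> emeasure K E"
    proof
      fix E assume "E \<in> sets (distr R lebesgue h)"
      then have E: "E \<in> sets lebesgue" by simp
      have "emeasure (distr R lebesgue h) E = emeasure R (mob m ` (A \<inter> E))"
        using emeasure_distr[OF hm E] pre[of E] unfolding R_def space_restrict_space by simp
      also have "\<dots> = emeasure lebesgue (mob m ` (A \<inter> E))" unfolding R_def
        using gA by (intro emeasure_restrict_space) auto
      also have "\<dots> \<le> ennreal (1 / c ^ 4) * emeasure lebesgue (A \<inter> E)" by (rule img(2)[OF E])
      also have "\<dots> = emeasure K E"
      proof -
        have "emeasure K E = (\<integral>\<^sup>+z. ennreal (1 / c ^ 4) * indicator (A \<inter> E) z \<partial>lebesgue)"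
          unfolding K_def using emeasure_density[OF meas E] by (simp add: mult.assoc indicator_inter_arith)
        also have "\<dots> = ennreal (1 / c ^ 4) * emeasure lebesgue (A \<inter> E)"
          using A(1) E by (intro nn_integral_cmult_indicator) auto
        finally show ?thesis by simp
      qed
      finally show "emeasure (distr R lebesgue h) E \<le> emeasure K E" .
    qed
  qed (simp add: K_def)
  have "(\<integral>\<^sup>+z\<in>mob m ` A. \<psi> (h z) \<partial>lebesgue) = (\<integral>\<^sup>+z. \<psi> (h z) \<partial>R)"
    unfolding R_def using gA by (subst nn_integral_restrict_space) auto
  also have "\<dots> = nn_integral (distr R lebesgue h) \<psi>" using \<psi> by (intro nn_integral_distr[symmetric] hm) simp
  also have "\<dots> \<le> nn_integral K \<psi>" using le by (intro nn_integral_mono_measure) (simp_all add: K_def)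
  also have "\<dots> = (\<integral>\<^sup>+z. ennreal (1 / c ^ 4) * (\<psi> z * indicator A z) \<partial>lebesgue)"
    unfolding K_def by (subst nn_integral_density[OF meas \<psi>]) (simp add: mult.assoc mult.left_commute mult.commute)
  also have "\<dots> = ennreal (1 / c ^ 4) * (\<integral>\<^sup>+z\<in>A. \<psi> z \<partial>lebesgue)"
    using A(1) \<psi> by (intro nn_integral_cmult) simp
  finally show ?thesis unfolding h_def .
qed

section \<open>Arcs of bounded overlap\<close>

lemma cmod_cis_diff: "cmod (cis x - cis y) = 2 * \<bar>sin ((x - y) / 2)\<bar>"
proof -
  have "cis x - cis y = cis y * (cis (x - y) - 1)" by (simp add: right_diff_distrib cis_mult)
  then have "cmod (cis x - cis y) = cmod (exp (\<i> * of_real (x - y)) - 1)" by (simp add: norm_mult cis_conv_exp)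
  then show ?thesis unfolding dist_exp_i_1 .
qed

lemma half_le_sin: assumes "\<bar>x\<bar> \<le> pi / 2" shows "\<bar>x\<bar> / 2 \<le> \<bar>sin x\<bar>"
proof -
  have pos: "y / 2 \<le> sin y" if y: "0 \<le> y" "y \<le> pi / 2" for y
  proof (cases "y \<le> pi / 3")
    case True
    have "(\<lambda>y. sin y - y / 2) 0 \<le> (\<lambda>y. sin y - y / 2) y"
    proof (rule DERIV_nonneg_imp_nondecreasing[OF y(1)])
      fix t assume t: "0 \<le> t" "t \<le> y"
      have "cos (pi / 3) \<le> cos t" using t True by (intro cos_monotone_0_pi_le) auto
      then have "0 \<le> cos t - 1 / 2" by (simp add: cos_60)
      then show "\<exists>d. ((\<lambda>y. sin y - y / 2) has_real_derivative d) (at t) \<and> 0 \<le> d"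
        by (intro exI[of _ "cos t - 1 / 2"] conjI) (auto intro!: derivative_eq_intros)
    qed
    then show ?thesis by simp
  next
    case False
    have "sin (pi / 3) \<le> sin y" using False y by (intro sin_monotone_2pi_le) auto
    moreover have "1.7 \<le> sqrt (3::real)" by (rule real_le_rsqrt) (simp add: power2_eq_square)
    ultimately show ?thesis using y(2) pi_less_4 pi_approx by (simp add: sin_60)
  qed
  show ?thesis using pos[of x] pos[of "- x"] assms by (cases "0 \<le> x") auto
qed

text \<open>Integrate the number of arcs over a point of the circle: it is at most \<open>N\<close>, and zero unless the
  point is close to \<open>\<zeta>\<close>. In the angular coordinate, the arc of chordal radius \<open>s i\<close> contains an interval
  of length \<open>2 s i\<close>, and all these intervals lie in one of length \<open>6 R\<close>.\<close>

lemma sum_radii_overlap_le: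
  fixes \<eta> :: "'i \<Rightarrow> complex" and s :: "'i \<Rightarrow> real"
  assumes P: "finite P" and \<zeta>: "cmod \<zeta> = 1" and \<eta>: "\<And>i. i \<in> P \<Longrightarrow> cmod (\<eta> i) = 1"
    and near: "\<And>i. i \<in> P \<Longrightarrow> cmod (\<eta> i - \<zeta>) \<le> R" and s: "\<And>i. i \<in> P \<Longrightarrow> 0 \<le> s i \<and> s i \<le> R"
    and over: "\<And>x. cmod x = 1 \<Longrightarrow> card {i \<in> P. cmod (x - \<eta> i) < s i} \<le> N" and R: "R \<ge> 0"
  shows "(\<Sum>i\<in>P. s i) \<le> 3 * real N * R"
proof -
  define \<tau> where "\<tau> = Arg \<zeta>"
  have "\<zeta> \<noteq> 0" using \<zeta> by auto
  then have \<tau>: "\<zeta> = cis \<tau>" unfolding \<tau>_def using \<zeta> by (simp add: cis_Arg sgn_eq)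
  have "\<exists>t. \<eta> i = cis t \<and> \<bar>t - \<tau>\<bar> \<le> 2 * R" if i: "i \<in> P" for i
  proof -
    define v where "v = \<eta> i * cnj \<zeta>"
    have v1: "cmod v = 1" using \<zeta> \<eta>[OF i] by (simp add: v_def norm_mult)
    then have "v \<noteq> 0" by auto
    then have v: "v = cis (Arg v)" using v1 by (simp add: cis_Arg sgn_eq)
    have "\<eta> i = v * \<zeta>" unfolding v_def using cnj_mult_self[OF \<zeta>] by (simp add: mult.assoc mult.commute[of "cnj \<zeta>"])
    then have e: "\<eta> i = cis (Arg v + \<tau>)" using v \<tau> by (metis cis_mult)
    have "\<bar>Arg v\<bar> \<le> pi" using Arg_bounded[of v] by auto
    then have "\<bar>Arg v / 2\<bar> / 2 \<le> \<bar>sin (Arg v / 2)\<bar>" by (intro half_le_sin) simp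
    also have "2 * \<bar>sin (Arg v / 2)\<bar> \<le> R" using near[OF i] unfolding e \<tau> cmod_cis_diff by simp
    finally have "\<bar>Arg v\<bar> \<le> 2 * R" by simp
    then show ?thesis using e by (intro exI[of _ "Arg v + \<tau>"]) simp
  qed
  then obtain t where t: "\<And>i. i \<in> P \<Longrightarrow> \<eta> i = cis (t i)" "\<And>i. i \<in> P \<Longrightarrow> \<bar>t i - \<tau>\<bar> \<le> 2 * R" by metis
  define I where "I = (\<lambda>i. {t i - s i<..<t i + s i})"
  define L where "L = {\<tau> - 3 * R..\<tau> + 3 * R}"
  have pt: "(\<Sum>i\<in>P. indicator (I i) x) \<le> (of_nat N * indicator L x :: ennreal)" for x
  proof (cases "x \<in> L")
    case True
    have "{i \<in> P. x \<in> I i} \<subseteq> {i \<in> P. cmod (cis x - \<eta> i) < s i}"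
    proof safe
      fix i assume i: "i \<in> P" "x \<in> I i"
      have "cmod (cis x - \<eta> i) \<le> \<bar>x - t i\<bar>" unfolding t(1)[OF i(1)] cmod_cis_diff
        using abs_sin_x_le_abs_x[of "(x - t i) / 2"] by simp
      also have "\<dots> < s i" using i(2) unfolding I_def by auto
      finally show "cmod (cis x - \<eta> i) < s i" .
    qed
    then have "card {i \<in> P. x \<in> I i} \<le> card {i \<in> P. cmod (cis x - \<eta> i) < s i}"
      using P by (intro card_mono) simp_all
    then have "card {i \<in> P. x \<in> I i} \<le> N" using over[of "cis x"] by simp
    moreover have "(\<Sum>i\<in>P. indicator (I i) x) = (of_nat (card {i \<in> P. x \<in> I i}) :: ennreal)"
      using P by (simp add: indicator_def sum.If_cases Int_def)
    ultimately show ?thesis using True by simp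
  next
    case False
    have "x \<notin> I i" if "i \<in> P" for i
      using False t(2)[OF that] s[OF that] unfolding I_def L_def by auto
    then show ?thesis by simp
  qed
  have "ennreal (2 * (\<Sum>i\<in>P. s i)) = (\<Sum>i\<in>P. ennreal (2 * s i))"
  proof -
    have "(\<Sum>i\<in>P. ennreal (2 * s i)) = ennreal (\<Sum>i\<in>P. 2 * s i)" using s by (intro sum_ennreal) simp
    then show ?thesis by (simp only: sum_distrib_left)
  qed
  also have "\<dots> = (\<Sum>i\<in>P. emeasure lborel (I i))" using s by (intro sum.cong) (auto simp: I_def)
  also have "\<dots> = (\<Sum>i\<in>P. \<integral>\<^sup>+x. indicator (I i) x \<partial>lborel)" by (simp add: I_def)
  also have "\<dots> = (\<integral>\<^sup>+x. (\<Sum>i\<in>P. indicator (I i) x) \<partial>lborel)"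
    by (intro nn_integral_sum[symmetric]) (simp add: I_def)
  also have "\<dots> \<le> (\<integral>\<^sup>+x. of_nat N * indicator L x \<partial>lborel)" by (intro nn_integral_mono pt)
  also have "\<dots> = of_nat N * emeasure lborel L" by (intro nn_integral_cmult_indicator) (simp add: L_def)
  also have "\<dots> = ennreal (real N * (6 * R))" using R unfolding L_def
    by (simp add: ennreal_mult ennreal_of_nat_eq_real_of_nat)
  finally have "2 * (\<Sum>i\<in>P. s i) \<le> real N * (6 * R)" using R by (simp add: ennreal_le_iff)
  then show ?thesis by (simp add: mult.commute mult.left_commute)
qed

section \<open>From the Dirichlet domain to the disk\<close>

text \<open>The function \<open>u\<close> stands for \<open>\<bar>\<mu>\<bar>\<^sup>2\<close>, extended by \<open>0\<close> outside the disk. Invariance is assumed as an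
  inequality, which for a group amounts to equality.\<close>

locale carleson_on_domain = convex_cocompact_matrices +
  fixes u :: "complex \<Rightarrow> real" and C :: real
  assumes u_measurable: "u \<in> borel_measurable lebesgue" and u_nonneg: "0 \<le> u z"
    and u_bounded: "AE z in lebesgue. z \<in> \<Delta> \<longrightarrow> u z \<le> 1"
    and u_invariant: "m \<in> M \<Longrightarrow> AE z in lebesgue. z \<in> \<Delta> \<longrightarrow> u z \<le> u (mob m z)"
    and C: "0 \<le> C" and carleson_domain: "\<lbrakk>\<xi> \<in> ideal_points; 0 < r; r < 1\<rbrakk> \<Longrightarrow>
      (\<integral>\<^sup>+z\<in>fund \<inter> ball \<xi> r. ennreal (u z / (1 - (cmod z)\<^sup>2)) \<partial>lebesgue) \<le> ennreal (C * r)"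
begin

definition \<phi> :: "complex \<Rightarrow> ennreal"
  where "\<phi> z = ennreal (u z / (1 - (cmod z)\<^sup>2))"

definition \<nu> :: "complex measure"
  where "\<nu> = density lebesgue \<phi>"

lemma \<phi>_measurable: "\<phi> \<in> borel_measurable lebesgue"
proof -
  have "(\<lambda>z::complex. 1 - (cmod z)\<^sup>2) \<in> borel_measurable borel" by measurable
  then have "(\<lambda>z::complex. 1 - (cmod z)\<^sup>2) \<in> borel_measurable lebesgue" by (simp add: measurable_completion)
  then show ?thesis unfolding \<phi>_def using u_measurable by measurable
qed

lemma sets_\<nu> [simp]: "sets \<nu> = sets lebesgue"
  by (simp add: \<nu>_def)

lemma emeasure_\<nu>: "A \<in> sets lebesgue \<Longrightarrow> emeasure \<nu> A = (\<integral>\<^sup>+z\<in>A. \<phi> z \<partial>lebesgue)"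
  unfolding \<nu>_def using \<phi>_measurable by (rule emeasure_density)

lemma fund_disk: "fund \<subseteq> \<Delta>"
  by (auto simp: fund_def)

lemma ideal_pointsD: "\<xi> \<in> ideal_points \<Longrightarrow> \<xi> \<in> closure fund" "\<xi> \<in> ideal_points \<Longrightarrow> cmod \<xi> = 1"
  using ideal_points_closure by (auto simp: ideal_points_def)

lemma fund_borel: "fund \<in> sets borel"
proof -
  have "fund = \<Delta> \<inter> (\<Inter>m\<in>M. {w. 1 \<le> cmod (den m w)})" unfolding fund_def by blast
  moreover have "closed (\<Inter>m\<in>M. {w. 1 \<le> cmod (den m w)})"
    unfolding den_def by (intro closed_INT ballI closed_Collect_le continuous_intros)
  ultimately show ?thesis by simp
qed

lemma fund_lebesgue: "fund \<in> sets lebesgue"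
  using fund_borel by simp

text \<open>Under \<open>m\<close> the area scales by \<open>\<bar>m'\<bar>\<^sup>2\<close> and \<open>1 - \<bar>z\<bar>\<^sup>2\<close> by \<open>\<bar>m'\<bar>\<close>, so the measure scales by
  \<open>\<bar>m'\<bar>\<close>, which is of size \<open>\<bar>fst m\<bar>\<^sup>-\<^sup>2\<close> on the whole domain.\<close>

lemma translate_mass:
  "\<exists>C1>0. \<forall>m\<in>M. \<forall>A\<in>sets lebesgue. A \<subseteq> fund \<longrightarrow>
     mob m ` A \<in> sets lebesgue \<and> emeasure \<nu> (mob m ` A) \<le> ennreal (C1 / (cmod (fst m))\<^sup>2) * emeasure \<nu> A"
proof -
  obtain d where d: "d > 0" "\<And>w m. w \<in> closure fund \<Longrightarrow> m \<in> M \<Longrightarrow> d * cmod (fst m) \<le> cmod (den m w)"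
    using den_comparable by metis
  have "mob m ` A \<in> sets lebesgue \<and> emeasure \<nu> (mob m ` A) \<le> ennreal (4 / d ^ 4 / (cmod (fst m))\<^sup>2) * emeasure \<nu> A"
    if m: "m \<in> M" and A: "A \<in> sets lebesgue" "A \<subseteq> fund" for m A
  proof -
    note SU = M_SU[OF m]
    define a where "a = cmod (fst m)"
    have a: "1 \<le> a" unfolding a_def using SU11_cmod(2)[OF SU] .
    have c0: "d * a > 0" using d(1) a by simp
    have c: "d * a \<le> cmod (den m z)" if "z \<in> A" for z
    proof -
      have "z \<in> closure fund" using that A(2) closure_subset by blast
      then show ?thesis unfolding a_def by (intro d(2) m)
    qed
    have AD: "A \<subseteq> \<Delta>" using A(2) fund_disk by blast
    have img: "mob m ` A \<in> sets lebesgue" using emeasure_mob_image_le(1)[OF SU A(1) AD c0 c] .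
    have "emeasure \<nu> (mob m ` A) = (\<integral>\<^sup>+z\<in>mob m ` A. \<phi> z \<partial>lebesgue)" by (rule emeasure_\<nu>[OF img])
    also have "\<dots> \<le> (\<integral>\<^sup>+z\<in>mob m ` A. ennreal (4 * a\<^sup>2) * \<phi> (mob (minv m) z) \<partial>lebesgue)"
    proof (rule nn_integral_mono_AE)
      show "AE z in lebesgue. \<phi> z * indicator (mob m ` A) z \<le> ennreal (4 * a\<^sup>2) * \<phi> (mob (minv m) z) * indicator (mob m ` A) z"
        using u_invariant[OF minv_M[OF m]]
      proof eventually_elim
        fix z assume inv: "z \<in> \<Delta> \<longrightarrow> u z \<le> u (mob (minv m) z)"
        show "\<phi> z * indicator (mob m ` A) z \<le> ennreal (4 * a\<^sup>2) * \<phi> (mob (minv m) z) * indicator (mob m ` A) z"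
        proof (cases "z \<in> mob m ` A")
          case True
          then obtain w where w: "w \<in> A" "z = mob m w" by blast
          have w1: "cmod w < 1" using w(1) AD by auto
          have wz: "mob (minv m) z = w" unfolding w(2) using mob_minv(2)[OF SU] w1 by simp
          have zD: "z \<in> \<Delta>" unfolding w(2) using mob_less_1[OF SU w1] by simp
          define D where "D = (cmod (den m w))\<^sup>2"
          have D0: "D > 0" unfolding D_def using den_nz[OF SU, of w] w1 by simp
          have "cmod (den m w) \<le> 2 * a" unfolding a_def using den_upper[OF SU] w1 by simp
          then have "D \<le> (2 * a)\<^sup>2" unfolding D_def by (intro power_mono) auto
          then have D4: "D \<le> 4 * a\<^sup>2" by (simp add: power_mult_distrib)
          have w2: "1 - (cmod w)\<^sup>2 > 0" using w1 by (simp add: abs_square_less_1)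
          have "u z / (1 - (cmod z)\<^sup>2) = u z * D / (1 - (cmod w)\<^sup>2)"
            unfolding w(2) D_def using one_minus_mob[OF SU, of w] w1 by simp
          also have "\<dots> \<le> u w * (4 * a\<^sup>2) / (1 - (cmod w)\<^sup>2)"
            using inv zD wz D4 D0 w2 u_nonneg by (intro divide_right_mono mult_mono) auto
          finally have "u z / (1 - (cmod z)\<^sup>2) \<le> 4 * a\<^sup>2 * (u w / (1 - (cmod w)\<^sup>2))" by (simp add: mult.commute)
          then have "ennreal (u z / (1 - (cmod z)\<^sup>2)) \<le> ennreal (4 * a\<^sup>2 * (u w / (1 - (cmod w)\<^sup>2)))" by (rule ennreal_leI)
          also have "\<dots> = ennreal (4 * a\<^sup>2) * ennreal (u w / (1 - (cmod w)\<^sup>2))"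
            using w2 u_nonneg by (intro ennreal_mult) auto
          finally show ?thesis unfolding \<phi>_def wz using True by simp
        qed simp
      qed
    qed
    also have "\<dots> \<le> ennreal (1 / (d * a) ^ 4) * (\<integral>\<^sup>+z\<in>A. ennreal (4 * a\<^sup>2) * \<phi> z \<partial>lebesgue)"
      by (rule nn_integral_mob_image_le[OF SU A(1) AD c0 c, where \<psi> = "\<lambda>w. ennreal (4 * a\<^sup>2) * \<phi> w"])
        (use \<phi>_measurable in measurable)
    also have "(\<integral>\<^sup>+z\<in>A. ennreal (4 * a\<^sup>2) * \<phi> z \<partial>lebesgue) = ennreal (4 * a\<^sup>2) * emeasure \<nu> A"
      unfolding emeasure_\<nu>[OF A(1)] mult.assoc 
      using \<phi>_measurable A(1) by (intro nn_integral_cmult) simp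
    also have "ennreal (1 / (d * a) ^ 4) * (ennreal (4 * a\<^sup>2) * emeasure \<nu> A) = ennreal (1 / (d * a) ^ 4 * (4 * a\<^sup>2)) * emeasure \<nu> A"
    proof -
      have "ennreal (1 / (d * a) ^ 4 * (4 * a\<^sup>2)) = ennreal (1 / (d * a) ^ 4) * ennreal (4 * a\<^sup>2)"
        by (rule ennreal_mult) simp_all
      then show ?thesis by (simp only: mult.assoc)
    qed
    also have "1 / (d * a) ^ 4 * (4 * a\<^sup>2) = 4 / d ^ 4 / a\<^sup>2"
      using a d(1) by (simp add: power_mult_distrib field_simps power2_eq_square eval_nat_numeral)
    finally show ?thesis using img unfolding a_def by blast
  qed
  then show ?thesis using d(1) by (intro exI[of _ "4 / d ^ 4"]) simp
qed

lemma compact_mass: assumes "\<rho> < 1"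
  shows "emeasure \<nu> (\<Delta> \<inter> cball 0 \<rho>) < \<infinity>"
proof (cases "0 \<le> \<rho>")
  case True
  have r: "1 - \<rho>\<^sup>2 > 0" using True assms by (simp add: abs_square_less_1)
  have "emeasure \<nu> (\<Delta> \<inter> cball 0 \<rho>) = (\<integral>\<^sup>+z\<in>\<Delta> \<inter> cball 0 \<rho>. \<phi> z \<partial>lebesgue)"
    by (intro emeasure_\<nu>) auto
  also have "\<dots> \<le> (\<integral>\<^sup>+z. ennreal (1 / (1 - \<rho>\<^sup>2)) * indicator (cball (0::complex) \<rho>) z \<partial>lebesgue)"
  proof (rule nn_integral_mono_AE)
    show "AE z in lebesgue. \<phi> z * indicator (\<Delta> \<inter> cball 0 \<rho>) z \<le> ennreal (1 / (1 - \<rho>\<^sup>2)) * indicator (cball 0 \<rho>) z"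
      using u_bounded
    proof eventually_elim
      fix z assume b: "z \<in> \<Delta> \<longrightarrow> u z \<le> 1"
      show "\<phi> z * indicator (\<Delta> \<inter> cball 0 \<rho>) z \<le> ennreal (1 / (1 - \<rho>\<^sup>2)) * indicator (cball 0 \<rho>) z"
      proof (cases "z \<in> \<Delta> \<inter> cball 0 \<rho>")
        case z: True
        have "(cmod z)\<^sup>2 \<le> \<rho>\<^sup>2" using z by (intro power_mono) auto
        then have "u z / (1 - (cmod z)\<^sup>2) \<le> 1 / (1 - \<rho>\<^sup>2)"
          using b z r u_nonneg by (intro frac_le) auto
        then have "\<phi> z \<le> ennreal (1 / (1 - \<rho>\<^sup>2))" unfolding \<phi>_def by (rule ennreal_leI)
        then show ?thesis using z by simp
      qed simp
    qed
  qed
  also have "\<dots> = ennreal (1 / (1 - \<rho>\<^sup>2)) * emeasure lebesgue (cball (0::complex) \<rho>)"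
    by (intro nn_integral_cmult_indicator) simp
  also have "\<dots> < \<infinity>" using emeasure_lborel_cball_finite[of "0::complex" \<rho>]
    by (simp add: ennreal_mult_less_top)
  finally show ?thesis .
next
  case False
  then have "\<Delta> \<inter> cball 0 \<rho> = {}" by (auto simp: not_le)
  then show ?thesis by simp
qed

lemma fund_ball_mass: assumes "\<xi> \<in> ideal_points" "0 < r" "r < 1"
  shows "emeasure \<nu> (fund \<inter> ball \<xi> r) \<le> ennreal (C * r)"
proof -
  have "fund \<inter> ball \<xi> r \<in> sets lebesgue" using fund_borel by simp
  then show ?thesis using carleson_domain[OF assms] emeasure_\<nu> unfolding \<phi>_def by simp
qed

text \<open>Finitely many disks about ideal points and a compact part of the unit disk cover the domain.\<close>

lemma fund_mass_finite: "emeasure \<nu> fund < \<infinity>"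
proof -
  obtain K where K: "K \<ge> 1" "\<And>w. w \<in> fund \<Longrightarrow> \<exists>\<zeta>\<in>ideal_points. cmod (w - \<zeta>) \<le> K * (1 - cmod w)"
    using near_ideal by metis
  have "compact (closure fund)" by (rule compact_closure_fund)
  then have "compact ideal_points" unfolding ideal_points_closure[symmetric] by (intro compact_Int_closed) auto
  then obtain X where X: "finite X" "X \<subseteq> ideal_points" "ideal_points \<subseteq> (\<Union>x\<in>X. ball x (1/4))"
    using compactE_image[of ideal_points ideal_points "\<lambda>x. ball x (1/4)"]
    by (metis (no_types, lifting) centre_in_ball UN_iff open_ball subsetI zero_less_divide_1_iff zero_less_numeral)
  \<comment> \<open>A point of the domain of modulus above \<open>\<rho>\<close> is at distance less than \<open>1/4\<close> from an ideal point.\<close>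
  define \<rho> where "\<rho> = 1 - 1 / (8 * K)"
  have \<rho>: "\<rho> < 1" unfolding \<rho>_def using K by simp
  have cover: "fund \<subseteq> (\<Delta> \<inter> cball 0 \<rho>) \<union> (\<Union>x\<in>X. fund \<inter> ball x (1/2))"
  proof
    fix w assume w: "w \<in> fund"
    show "w \<in> (\<Delta> \<inter> cball 0 \<rho>) \<union> (\<Union>x\<in>X. fund \<inter> ball x (1/2))"
    proof (cases "cmod w \<le> \<rho>")
      case True
      then show ?thesis using w fund_disk by auto
    next
      case False
      obtain \<zeta> where \<zeta>: "\<zeta> \<in> ideal_points" "cmod (w - \<zeta>) \<le> K * (1 - cmod w)" using K(2)[OF w] by blast
      have "K * (1 - cmod w) \<le> K * (1 / (8 * K))" using False K unfolding \<rho>_def by (intro mult_left_mono) auto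
      then have d: "dist \<zeta> w < 1/4" using \<zeta>(2) K by (simp add: dist_norm norm_minus_commute)
      obtain x where x: "x \<in> X" "dist x \<zeta> < 1/4" using X(3) \<zeta>(1) by auto
      then have "dist x w < 1/2" using d dist_triangle[of x w \<zeta>] by simp
      then show ?thesis using x w by auto
    qed
  qed
  have m: "\<Delta> \<inter> cball 0 \<rho> \<in> sets \<nu>" "(\<Union>x\<in>X. fund \<inter> ball x (1/2)) \<in> sets \<nu>" "\<And>x. fund \<inter> ball x (1/2) \<in> sets \<nu>"
    using fund_borel X(1) by (auto intro!: sets.finite_UN)
  have "emeasure \<nu> fund \<le> emeasure \<nu> ((\<Delta> \<inter> cball 0 \<rho>) \<union> (\<Union>x\<in>X. fund \<inter> ball x (1/2)))"
    using m cover by (intro emeasure_mono) auto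
  also have "\<dots> \<le> emeasure \<nu> (\<Delta> \<inter> cball 0 \<rho>) + emeasure \<nu> (\<Union>x\<in>X. fund \<inter> ball x (1/2))"
    using m by (intro emeasure_subadditive) auto
  also have "emeasure \<nu> (\<Union>x\<in>X. fund \<inter> ball x (1/2)) \<le> (\<Sum>x\<in>X. emeasure \<nu> (fund \<inter> ball x (1/2)))"
    using m X(1) by (intro emeasure_subadditive_finite) auto
  also have "\<dots> \<le> (\<Sum>x\<in>X. ennreal (C * (1/2)))" using X(2) by (intro sum_mono fund_ball_mass) auto
  also have "emeasure \<nu> (\<Delta> \<inter> cball 0 \<rho>) + (\<Sum>x\<in>X. ennreal (C * (1/2))) < \<infinity>"
    using compact_mass[OF \<rho>] by (simp add: ennreal_mult_less_top of_nat_less_top)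
  finally show ?thesis by (simp add: add_left_mono)
qed

text \<open>By \<open>near_ideal\<close> the ball lies in a comparable ball about an ideal point. For large radii the
  finite total mass gives the bound.\<close>

lemma fund_ball_mass_inner:
  "\<exists>C2\<ge>0. \<forall>w\<in>fund. \<forall>\<rho>>0. 1 - cmod w \<le> \<rho> \<longrightarrow> emeasure \<nu> (fund \<inter> ball w \<rho>) \<le> ennreal (C2 * \<rho>)"
proof -
  obtain K where K: "K \<ge> 1" "\<And>w. w \<in> fund \<Longrightarrow> \<exists>\<zeta>\<in>ideal_points. cmod (w - \<zeta>) \<le> K * (1 - cmod w)"
    using near_ideal by metis
  obtain T where T: "T \<ge> 0" "emeasure \<nu> fund = ennreal T"
    using fund_mass_finite by (cases "emeasure \<nu> fund") auto
  have "emeasure \<nu> (fund \<inter> ball w \<rho>) \<le> ennreal ((C + T) * (K + 1) * \<rho>)"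
    if w: "w \<in> fund" and \<rho>: "\<rho> > 0" "1 - cmod w \<le> \<rho>" for w \<rho>
  proof -
    obtain \<zeta> where \<zeta>: "\<zeta> \<in> ideal_points" "cmod (w - \<zeta>) \<le> K * (1 - cmod w)" using K(2)[OF w] by blast
    have "K * (1 - cmod w) \<le> K * \<rho>" using \<rho> K by (intro mult_left_mono) auto
    then have near: "dist \<zeta> w \<le> K * \<rho>" using \<zeta>(2) by (simp add: dist_norm norm_minus_commute)
    define r where "r = (K + 1) * \<rho>"
    have r0: "r > 0" unfolding r_def using K \<rho> by simp
    have e: "(C + T) * (K + 1) * \<rho> = C * r + T * r" unfolding r_def by (simp add: algebra_simps)
    show ?thesis
    proof (cases "r < 1")
      case True
      have "ball w \<rho> \<subseteq> ball \<zeta> r"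
      proof
        fix y assume "y \<in> ball w \<rho>"
        then show "y \<in> ball \<zeta> r" using near dist_triangle[of \<zeta> y w] unfolding r_def by (simp add: algebra_simps)
      qed
      then have "emeasure \<nu> (fund \<inter> ball w \<rho>) \<le> emeasure \<nu> (fund \<inter> ball \<zeta> r)"
        using fund_borel by (intro emeasure_mono) auto
      also have "\<dots> \<le> ennreal (C * r)" by (rule fund_ball_mass[OF \<zeta>(1) r0 True])
      also have "\<dots> \<le> ennreal ((C + T) * (K + 1) * \<rho>)" unfolding e using T(1) r0 by (intro ennreal_leI) simp
      finally show ?thesis .
    next
      case False
      have "emeasure \<nu> (fund \<inter> ball w \<rho>) \<le> emeasure \<nu> fund" using fund_borel by (intro emeasure_mono) auto
      also have "\<dots> = ennreal T" by (rule T(2))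
      also have "\<dots> \<le> ennreal ((C + T) * (K + 1) * \<rho>)" unfolding e
      proof (rule ennreal_leI)
        have "T * 1 \<le> T * r" using False T(1) by (intro mult_left_mono) auto
        moreover have "0 \<le> C * r" using C r0 by simp
        ultimately show "T \<le> C * r + T * r" by simp
      qed
      finally show ?thesis .
    qed
  qed
  then show ?thesis using C T(1) K(1) by (intro exI[of _ "(C + T) * (K + 1)"]) auto
qed

text \<open>A quantitative form of being an ordinary point: tame points have distance at least \<open>d\<close> from the
  orbit of \<open>0\<close>.\<close>

definition tame :: "real \<Rightarrow> complex set"
  where "tame d = {y. cmod y = 1 \<and> (\<forall>h\<in>M. d * cmod (fst h) \<le> cmod (den h y))}"

text \<open>If \<open>k\<close> moves a tame point \<open>y\<close> to a tame point, then \<open>den k\<close> at \<open>y\<close> and the denominator of the inverse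
  at \<open>k y\<close> are both at least \<open>d \<bar>fst k\<bar>\<close>, but their product is \<open>1\<close>. So there are finitely many such
  \<open>k\<close>, and they account for all translates of the tame set over a given point.\<close>

lemma tame_overlap: assumes "d > 0" "P \<subseteq> M" "cmod x = 1"
  shows "card {m \<in> P. mob (minv m) x \<in> tame d} \<le> card {k \<in> M. cmod (fst k) \<le> 1 / d}"
proof (cases "{m \<in> P. mob (minv m) x \<in> tame d} = {}")
  case False
  then obtain m0 where m0: "m0 \<in> P" "mob (minv m0) x \<in> tame d" by blast
  have m0M: "m0 \<in> M" using m0(1) assms(2) by blast
  have "{m \<in> P. mob (minv m) x \<in> tame d} \<subseteq> mmul m0 ` {k \<in> M. cmod (fst k) \<le> 1 / d}"
  proof
    fix m assume "m \<in> {m \<in> P. mob (minv m) x \<in> tame d}"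
    then have m: "m \<in> M" "mob (minv m) x \<in> tame d" using assms(2) by blast+
    define k where "k = mmul (minv m0) m"
    define y where "y = mob (minv m) x"
    have kM: "k \<in> M" unfolding k_def using mmul_M minv_M m0M m(1) by blast
    have y1: "cmod y = 1" using m(2) unfolding tame_def y_def by simp
    have "mob k y = mob (minv m0) (mob m y)" unfolding k_def using mob_mmul[OF M_SU[OF m(1)]] y1 by simp
    also have "mob m y = x" unfolding y_def using mob_minv(1)[OF M_SU[OF m(1)]] assms(3) by simp
    finally have ky: "mob k y = mob (minv m0) x" .
    have "den (minv k) (mob k y) * den k y = 1" using den_minv[OF M_SU[OF kM], of y] y1 by simp
    then have pr: "cmod (den (minv k) (mob k y)) * cmod (den k y) = 1" by (metis norm_mult norm_one)
    have g1: "d * cmod (fst k) \<le> cmod (den k y)" using m(2) kM unfolding tame_def y_def by blast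
    have "d * cmod (fst (minv k)) \<le> cmod (den (minv k) (mob k y))"
      using m0(2) minv_M[OF kM] unfolding tame_def ky by blast
    then have g2: "d * cmod (fst k) \<le> cmod (den (minv k) (mob k y))" by simp
    have "(d * cmod (fst k)) * (d * cmod (fst k)) \<le> 1"
      using mult_mono[OF g2 g1] assms(1) pr by simp
    then have "(d * cmod (fst k))\<^sup>2 \<le> 1" by (simp only: power2_eq_square)
    then have "d * cmod (fst k) \<le> 1" using assms(1) by (simp add: abs_square_le_1)
    then have "cmod (fst k) \<le> 1 / d" using assms(1) by (simp add: field_simps)
    moreover have "mmul m0 k = m" unfolding k_def using mmul_minv[OF M_SU[OF m0M]] by (simp add: mmul_assoc[symmetric])
    ultimately show "m \<in> mmul m0 ` {k \<in> M. cmod (fst k) \<le> 1 / d}" using kM by blast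
  qed
  then have "card {m \<in> P. mob (minv m) x \<in> tame d} \<le> card (mmul m0 ` {k \<in> M. cmod (fst k) \<le> 1 / d})"
    using finite_M by (intro card_mono) auto
  also have "\<dots> \<le> card {k \<in> M. cmod (fst k) \<le> 1 / d}" using finite_M by (intro card_image_le)
  finally show ?thesis .
qed (simp only: card.empty zero_le)

text \<open>The part of the tile \<open>m (fund)\<close> inside the disk, pulled back to the domain.\<close>

definition piece :: "complex \<Rightarrow> real \<Rightarrow> mat \<Rightarrow> complex set"
  where "piece \<zeta> r m = {w \<in> fund. mob m w \<in> ball \<zeta> r}"

definition scale :: "real \<Rightarrow> mat \<Rightarrow> real"
  where "scale r m = min r (1 / (cmod (fst m))\<^sup>2)"

lemma piece_lebesgue: assumes "m \<in> M" shows "piece \<zeta> r m \<in> sets lebesgue"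
proof -
  have "continuous_on \<Delta> (mob m)"
    using continuous_mob[OF M_SU[OF assms]] ball_subset_cball continuous_on_subset by blast
  then have "open (\<Delta> \<inter> mob m -` ball \<zeta> r)" by (intro continuous_open_preimage) auto
  moreover have "piece \<zeta> r m = fund \<inter> (\<Delta> \<inter> mob m -` ball \<zeta> r)"
    unfolding piece_def using fund_disk by blast
  ultimately show ?thesis using fund_borel by simp
qed

text \<open>A small tile has size of order at most \<open>r\<close>: its whole mass is admissible, and the image of any ideal
  point serves as \<open>\<eta>\<close>. For a large tile, the piece lies in a ball of radius \<open>\<rho> = 8 r \<bar>fst m\<bar>\<^sup>2\<close> about one
  of its points \<open>w0\<close>; the factor \<open>8\<close> comes from the diameter \<open>2 r\<close> and the bound \<open>4 \<bar>fst m\<bar>\<^sup>2\<close> for the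
  expansion of the inverse. There \<open>\<eta>\<close> is the image of an ideal point close to \<open>w0\<close>. In both cases the
  arc about \<open>\<eta>\<close> pulls back to within \<open>d\<close> of an ideal point, where all points are tame.\<close>

lemma piece_mass_and_arc:
  obtains d K' C3 where "d > 0" "K' \<ge> 0" "C3 \<ge> 0"
    "\<And>m \<zeta> r. \<lbrakk>m \<in> M; cmod \<zeta> = 1; 0 < r; piece \<zeta> r m \<noteq> {}\<rbrakk> \<Longrightarrow>
     emeasure \<nu> (mob m ` piece \<zeta> r m) \<le> ennreal (C3 * scale r m) \<and>
     (\<exists>\<eta>. cmod \<eta> = 1 \<and> cmod (\<eta> - \<zeta>) \<le> K' * r \<and>
       (\<forall>x. cmod x = 1 \<longrightarrow> cmod (x - \<eta>) < d / 4 * scale r m \<longrightarrow> mob (minv m) x \<in> tame d))"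
proof -
  obtain e where e: "e > 0" "\<And>w m. w \<in> closure fund \<Longrightarrow> m \<in> M \<Longrightarrow> e * cmod (fst m) \<le> cmod (den m w)"
    using den_comparable by metis
  obtain K where K: "K \<ge> 1" "\<And>w. w \<in> fund \<Longrightarrow> \<exists>\<zeta>\<in>ideal_points. cmod (w - \<zeta>) \<le> K * (1 - cmod w)"
    using near_ideal by metis
  obtain C1 where C1: "C1 > 0" "\<And>m A. m \<in> M \<Longrightarrow> A \<in> sets lebesgue \<Longrightarrow> A \<subseteq> fund \<Longrightarrow>
     emeasure \<nu> (mob m ` A) \<le> ennreal (C1 / (cmod (fst m))\<^sup>2) * emeasure \<nu> A"
    using translate_mass by metis
  obtain C2 where C2: "C2 \<ge> 0" "\<And>w \<rho>. w \<in> fund \<Longrightarrow> \<rho> > 0 \<Longrightarrow> 1 - cmod w \<le> \<rho> \<Longrightarrow> emeasure \<nu> (fund \<inter> ball w \<rho>) \<le> ennreal (C2 * \<rho>)"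
    using fund_ball_mass_inner by metis
  obtain T where T: "T \<ge> 0" "emeasure \<nu> fund = ennreal T"
    using fund_mass_finite by (cases "emeasure \<nu> fund") auto
  define d where "d = e / 2"
  have d: "d > 0" "e = 2 * d" unfolding d_def using e(1) by auto
  define C3 where "C3 = C1 * T + 8 * C1 * C2"
  define K' where "K' = 2 / e\<^sup>2 + 8 * K / e\<^sup>2 + 1"
  have K'0: "K' \<ge> 0" unfolding K'_def using K e(1) by simp
  have C30: "C3 \<ge> 0" unfolding C3_def using C1 C2 T by simp
  have main: "emeasure \<nu> (mob m ` piece \<zeta> r m) \<le> ennreal (C3 * scale r m) \<and>
     (\<exists>\<eta>. cmod \<eta> = 1 \<and> cmod (\<eta> - \<zeta>) \<le> K' * r \<and>
       (\<forall>x. cmod x = 1 \<longrightarrow> cmod (x - \<eta>) < d / 4 * scale r m \<longrightarrow> mob (minv m) x \<in> tame d))"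
    if m: "m \<in> M" and \<zeta>: "cmod \<zeta> = 1" and r: "0 < r" and ne: "piece \<zeta> r m \<noteq> {}" for m \<zeta> r
  proof -
    note SU = M_SU[OF m]
    define a where "a = cmod (fst m)"
    have a: "1 \<le> a" unfolding a_def using SU11_cmod(2)[OF SU] .
    define s where "s = scale r m"
    have s0: "0 \<le> s" "s \<le> 1 / a\<^sup>2" unfolding s_def scale_def a_def using r by auto
    obtain w0 where w0: "w0 \<in> fund" "cmod (mob m w0 - \<zeta>) < r"
      using ne unfolding piece_def by (auto simp: dist_norm norm_minus_commute)
    have w0D: "cmod w0 < 1" using w0(1) fund_disk by auto
    have low: "e * a \<le> cmod (den m w)" if "w \<in> closure fund" for w unfolding a_def using e(2)[OF that m] .
    have up: "cmod (den m w) \<le> 2 * a" if "cmod w \<le> 1" for w unfolding a_def using den_upper[OF SU that] .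
    have contr: "cmod (mob m y - mob m w0) \<le> cmod (y - w0) / (e * a)\<^sup>2" if "y \<in> closure fund" for y
    proof -
      have y1: "cmod y \<le> 1" using that closure_fund_cball by auto
      have "(e * a) * (e * a) \<le> cmod (den m y) * cmod (den m w0)"
        using low[OF that] low[of w0] w0(1) closure_subset[of fund] e(1) a by (intro mult_mono) auto
      then show ?thesis unfolding mob_dist[OF SU y1 less_imp_le[OF w0D]] power2_eq_square
        using e(1) a by (intro divide_left_mono mult_pos_pos) (auto intro!: mult_pos_pos simp: den_nz[OF SU y1] den_nz[OF SU less_imp_le[OF w0D]])
    qed
    have pf: "piece \<zeta> r m \<subseteq> fund" unfolding piece_def by blast
    have pm: "emeasure \<nu> (mob m ` piece \<zeta> r m) \<le> ennreal (C1 / a\<^sup>2) * emeasure \<nu> (piece \<zeta> r m)"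
      unfolding a_def by (rule C1(2)[OF m piece_lebesgue[OF m] pf])
    have "emeasure \<nu> (mob m ` piece \<zeta> r m) \<le> ennreal (C3 * s) \<and> (\<exists>\<xi>\<in>ideal_points. cmod (mob m \<xi> - \<zeta>) \<le> K' * r)"
    proof (cases "1 / a\<^sup>2 \<le> r")
      case True
      then have s: "s = 1 / a\<^sup>2" unfolding s_def scale_def a_def by simp
      have mT: "emeasure \<nu> (piece \<zeta> r m) \<le> ennreal T" unfolding T(2)[symmetric]
        using pf fund_lebesgue by (intro emeasure_mono) auto
      have "emeasure \<nu> (mob m ` piece \<zeta> r m) \<le> ennreal (C1 / a\<^sup>2) * ennreal T"
        by (rule order_trans[OF pm mult_left_mono[OF mT]]) simp
      also have "\<dots> = ennreal (C1 / a\<^sup>2 * T)" using C1(1) T(1) by (intro ennreal_mult[symmetric]) auto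
      also have "\<dots> \<le> ennreal (C3 * s)"
      proof (rule ennreal_leI)
        have "C1 / a\<^sup>2 * T = (C1 * T) * s" unfolding s by simp
        also have "\<dots> \<le> C3 * s" unfolding C3_def using C1 C2 s0 by (intro mult_right_mono) auto
        finally show "C1 / a\<^sup>2 * T \<le> C3 * s" .
      qed
      finally have mass: "emeasure \<nu> (mob m ` piece \<zeta> r m) \<le> ennreal (C3 * s)" .
      obtain \<xi> where \<xi>: "\<xi> \<in> ideal_points" using ideal_ne by blast
      then have \<xi>c: "\<xi> \<in> closure fund" "cmod \<xi> = 1" using ideal_pointsD by blast+
      have "cmod (\<xi> - w0) \<le> 2" using norm_triangle_ineq4[of \<xi> w0] \<xi>c w0D by simp
      then have "cmod (\<xi> - w0) / (e * a)\<^sup>2 \<le> 2 / (e * a)\<^sup>2" by (intro divide_right_mono) auto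
      also have "\<dots> = 2 / e\<^sup>2 * (1 / a\<^sup>2)" by (simp add: power_mult_distrib)
      also have "\<dots> \<le> 2 / e\<^sup>2 * r" using True by (intro mult_left_mono) auto
      finally have c: "cmod (mob m \<xi> - mob m w0) \<le> 2 / e\<^sup>2 * r" using contr[OF \<xi>c(1)] by linarith
      have "cmod (mob m \<xi> - \<zeta>) \<le> cmod (mob m \<xi> - mob m w0) + cmod (mob m w0 - \<zeta>)"
        using norm_triangle_ineq[of "mob m \<xi> - mob m w0" "mob m w0 - \<zeta>"] by simp
      then have "cmod (mob m \<xi> - \<zeta>) \<le> 2 / e\<^sup>2 * r + r" using c w0(2) by simp
      also have "\<dots> \<le> K' * r"
      proof -
        have "0 \<le> 8 * K / e\<^sup>2 * r" using K r by simp
        then show ?thesis unfolding K'_def by (simp add: distrib_right)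
      qed
      finally show ?thesis using mass \<xi> by blast
    next
      case False
      then have s: "s = r" unfolding s_def scale_def a_def by simp
      define \<rho> where "\<rho> = 8 * r * a\<^sup>2"
      have \<rho>0: "\<rho> > 0" unfolding \<rho>_def using r a by simp
      have w0\<rho>: "1 - cmod w0 \<le> \<rho>"
      proof -
        define D where "D = (cmod (den m w0))\<^sup>2"
        have D0: "D > 0" unfolding D_def using den_nz[OF SU less_imp_le[OF w0D]] by simp
        have "D \<le> (2 * a)\<^sup>2" unfolding D_def using up[of w0] w0D by (intro power_mono) auto
        then have D4: "D \<le> 4 * a\<^sup>2" by (simp add: power_mult_distrib)
        define q where "q = cmod (mob m w0)"
        have q1: "q < 1" "q \<ge> 0" unfolding q_def using mob_less_1[OF SU w0D] by auto
        have q2: "1 - q < r" using norm_triangle_ineq2[of \<zeta> "mob m w0"] \<zeta> w0(2) unfolding q_def by (simp add: norm_minus_commute)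
        have "1 - q\<^sup>2 = (1 - q) * (1 + q)" by (simp add: power2_eq_square algebra_simps)
        also have "\<dots> \<le> (1 - q) * 2" using q1 by (intro mult_left_mono) auto
        finally have q3: "1 - q\<^sup>2 \<le> 2 * r" using q2 by simp
        have "1 - cmod w0 \<le> 1 - (cmod w0)\<^sup>2" using w0D by (simp add: power2_eq_square mult_left_le)
        also have "\<dots> = (1 - q\<^sup>2) * D"
          unfolding q_def D_def one_minus_mob[OF SU less_imp_le[OF w0D]] using D0 unfolding D_def by simp
        also have "\<dots> \<le> (2 * r) * (4 * a\<^sup>2)" using q3 D4 D0 r by (intro mult_mono) auto
        finally show ?thesis unfolding \<rho>_def by simp
      qed
      have sub: "piece \<zeta> r m \<subseteq> fund \<inter> ball w0 \<rho>"
      proof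
        fix w assume w: "w \<in> piece \<zeta> r m"
        then have wf: "w \<in> fund" "cmod (mob m w - \<zeta>) < r" unfolding piece_def by (auto simp: dist_norm norm_minus_commute)
        have wD: "cmod w < 1" using wf(1) fund_disk by auto
        have "cmod (mob m w - mob m w0) \<le> cmod (mob m w - \<zeta>) + cmod (mob m w0 - \<zeta>)"
          using norm_triangle_ineq4[of "mob m w - \<zeta>" "mob m w0 - \<zeta>"] by simp
        then have c: "cmod (mob m w - mob m w0) < 2 * r" using wf(2) w0(2) by simp
        define D where "D = cmod (den m w) * cmod (den m w0)"
        have D0: "D > 0" unfolding D_def using den_nz[OF SU less_imp_le[OF w0D]] den_nz[OF SU less_imp_le[OF wD]] by simp
        have "D \<le> (2 * a) * (2 * a)" unfolding D_def using up[of w] up[of w0] wD w0D a by (intro mult_mono) auto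
        then have D4: "D \<le> 4 * a\<^sup>2" by (simp add: power2_eq_square)
        have "cmod (w - w0) = cmod (mob m w - mob m w0) * D"
          unfolding mob_dist[OF SU less_imp_le[OF wD] less_imp_le[OF w0D]] D_def[symmetric] using D0 by simp
        also have "\<dots> < (2 * r) * D" using c D0 by (intro mult_strict_right_mono)
        also have "\<dots> \<le> (2 * r) * (4 * a\<^sup>2)" using D4 r by (intro mult_left_mono) auto
        finally show "w \<in> fund \<inter> ball w0 \<rho>" using wf(1) unfolding \<rho>_def by (simp add: dist_norm norm_minus_commute)
      qed
      have "emeasure \<nu> (piece \<zeta> r m) \<le> emeasure \<nu> (fund \<inter> ball w0 \<rho>)"
        using sub fund_borel by (intro emeasure_mono) auto
      also have "\<dots> \<le> ennreal (C2 * \<rho>)" by (rule C2(2)[OF w0(1) \<rho>0 w0\<rho>])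
      finally have mT: "emeasure \<nu> (piece \<zeta> r m) \<le> ennreal (C2 * \<rho>)" .
      have "emeasure \<nu> (mob m ` piece \<zeta> r m) \<le> ennreal (C1 / a\<^sup>2) * ennreal (C2 * \<rho>)"
        by (rule order_trans[OF pm mult_left_mono[OF mT]]) simp
      also have "\<dots> = ennreal (C1 / a\<^sup>2 * (C2 * \<rho>))" using C1(1) C2(1) \<rho>0 by (intro ennreal_mult[symmetric]) auto
      also have "\<dots> \<le> ennreal (C3 * s)"
      proof (rule ennreal_leI)
        have "C1 / a\<^sup>2 * (C2 * \<rho>) = (8 * C1 * C2) * s" unfolding s \<rho>_def using a by (simp add: field_simps)
        also have "\<dots> \<le> C3 * s" unfolding C3_def using C1 T s0 by (intro mult_right_mono) auto
        finally show "C1 / a\<^sup>2 * (C2 * \<rho>) \<le> C3 * s" .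
      qed
      finally have mass: "emeasure \<nu> (mob m ` piece \<zeta> r m) \<le> ennreal (C3 * s)" .
      obtain \<xi> where \<xi>: "\<xi> \<in> ideal_points" "cmod (w0 - \<xi>) \<le> K * (1 - cmod w0)" using K(2)[OF w0(1)] by blast
      then have \<xi>c: "\<xi> \<in> closure fund" "cmod \<xi> = 1" using ideal_pointsD by blast+
      have "K * (1 - cmod w0) \<le> K * \<rho>" using w0\<rho> K by (intro mult_left_mono) auto
      then have "cmod (\<xi> - w0) \<le> K * \<rho>" using \<xi>(2) by (simp add: norm_minus_commute)
      then have "cmod (\<xi> - w0) / (e * a)\<^sup>2 \<le> K * \<rho> / (e * a)\<^sup>2" by (intro divide_right_mono) auto
      also have "\<dots> = 8 * K / e\<^sup>2 * r" unfolding \<rho>_def using a e(1) by (simp add: power_mult_distrib)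
      finally have c: "cmod (mob m \<xi> - mob m w0) \<le> 8 * K / e\<^sup>2 * r" using contr[OF \<xi>c(1)] by linarith
      have "cmod (mob m \<xi> - \<zeta>) \<le> cmod (mob m \<xi> - mob m w0) + cmod (mob m w0 - \<zeta>)"
        using norm_triangle_ineq[of "mob m \<xi> - mob m w0" "mob m w0 - \<zeta>"] by simp
      then have "cmod (mob m \<xi> - \<zeta>) \<le> 8 * K / e\<^sup>2 * r + r" using c w0(2) by simp
      also have "\<dots> \<le> K' * r"
      proof -
        have "0 \<le> 2 / e\<^sup>2 * r" using r by simp
        then show ?thesis unfolding K'_def by (simp add: distrib_right)
      qed
      finally show ?thesis using mass \<xi> by blast
    qed
    then obtain \<xi> where mass: "emeasure \<nu> (mob m ` piece \<zeta> r m) \<le> ennreal (C3 * s)"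
      and \<xi>: "\<xi> \<in> ideal_points" "cmod (mob m \<xi> - \<zeta>) \<le> K' * r" by blast
    have \<xi>c: "\<xi> \<in> closure fund" "cmod \<xi> = 1" using \<xi>(1) ideal_points_closure unfolding ideal_points_def by blast+
    have arc: "mob (minv m) x \<in> tame d" if x: "cmod x = 1" "cmod (x - mob m \<xi>) < d / 4 * s" for x
    proof -
      define y where "y = mob (minv m) x"
      have y1: "cmod y = 1" unfolding y_def using mob_eq_1[OF minv_SU11[OF SU] x(1)] .
      have xy: "x = mob m y" unfolding y_def using mob_minv(1)[OF SU] x(1) by simp
      define D where "D = cmod (den m y) * cmod (den m \<xi>)"
      have D0: "D > 0" unfolding D_def using den_nz[OF SU, of y] den_nz[OF SU, of \<xi>] y1 \<xi>c by simp
      have "D \<le> (2 * a) * (2 * a)" unfolding D_def using up[of y] up[of \<xi>] y1 \<xi>c a by (intro mult_mono) auto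
      then have D4: "D \<le> 4 * a\<^sup>2" by (simp add: power2_eq_square)
      have "cmod (x - mob m \<xi>) = cmod (y - \<xi>) / D"
        unfolding xy D_def using y1 \<xi>c by (intro mob_dist[OF SU]) simp_all
      then have "cmod (y - \<xi>) = cmod (x - mob m \<xi>) * D" using D0 by simp
      also have "\<dots> \<le> (d / 4 * s) * (4 * a\<^sup>2)" using x(2) D4 D0 d(1) s0 by (intro mult_mono) auto
      also have "\<dots> \<le> (d / 4 * (1 / a\<^sup>2)) * (4 * a\<^sup>2)"
        using s0 d by (intro mult_right_mono mult_left_mono) auto
      also have "\<dots> = d" using a by simp
      finally have yd: "cmod (\<xi> - y) \<le> d" by (simp add: norm_minus_commute)
      have "d * cmod (fst h) \<le> cmod (den h y)" if h: "h \<in> M" for h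
      proof -
        have "e * cmod (fst h) \<le> cmod (den h \<xi>)" by (rule e(2)[OF \<xi>c(1) h])
        also have "\<dots> \<le> cmod (den h y) + cmod (fst h) * cmod (\<xi> - y)" by (rule den_lipschitz[OF M_SU[OF h]])
        also have "cmod (fst h) * cmod (\<xi> - y) \<le> cmod (fst h) * d" using yd by (intro mult_left_mono) auto
        finally show ?thesis unfolding d(2) by (simp add: algebra_simps)
      qed
      then show ?thesis unfolding tame_def y_def[symmetric] using y1 by blast
    qed
    have "cmod (mob m \<xi>) = 1" by (rule mob_eq_1[OF SU \<xi>c(2)])
    then show ?thesis using mass \<xi>(2) arc unfolding s_def by blast
  qed
  show thesis by (rule that[OF d(1) K'0 C30 main])
qed

text \<open>Sum the contributions of the tiles. Finitely many tiles are treated at a time, with a bound that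
  does not depend on their number; monotone convergence gives the whole disk.\<close>

theorem carleson_disk: "\<exists>C'. \<forall>\<zeta> r. cmod \<zeta> = 1 \<longrightarrow> 0 < r \<longrightarrow> emeasure \<nu> (\<Delta> \<inter> ball \<zeta> r) \<le> ennreal (C' * r)"
proof -
  obtain d K' C3 where d: "d > 0" and K': "K' \<ge> 0" and C3: "C3 \<ge> 0"
    and main: "\<And>m \<zeta> r. m \<in> M \<Longrightarrow> cmod \<zeta> = 1 \<Longrightarrow> 0 < r \<Longrightarrow> piece \<zeta> r m \<noteq> {} \<Longrightarrow>
       emeasure \<nu> (mob m ` piece \<zeta> r m) \<le> ennreal (C3 * scale r m) \<and>
     (\<exists>\<eta>. cmod \<eta> = 1 \<and> cmod (\<eta> - \<zeta>) \<le> K' * r \<and>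
       (\<forall>x. cmod x = 1 \<longrightarrow> cmod (x - \<eta>) < d / 4 * scale r m \<longrightarrow> mob (minv m) x \<in> tame d))"
    by (rule piece_mass_and_arc) blast
  define N where "N = card {k \<in> M. cmod (fst k) \<le> 1 / d}"
  define K2 where "K2 = K' + d"
  define C' where "C' = C3 * (12 * real N * K2 / d)"
  have "emeasure \<nu> (\<Delta> \<inter> ball \<zeta> r) \<le> ennreal (C' * r)" if \<zeta>: "cmod \<zeta> = 1" and r: "0 < r" for \<zeta> r
  proof -
    define P where "P = (\<lambda>n::nat. {m \<in> {m \<in> M. cmod (fst m) \<le> real n}. piece \<zeta> r m \<noteq> {}})"
    define E where "E = (\<lambda>n. \<Union>m\<in>P n. mob m ` piece \<zeta> r m)"
    have finP: "finite (P n)" for n unfolding P_def using finite_M by (intro finite_Collect_conjI) auto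
    have PM: "P n \<subseteq> M" for n unfolding P_def by blast
    have img: "mob m ` piece \<zeta> r m \<in> sets lebesgue" if "m \<in> M" for m
    proof -
      have "piece \<zeta> r m \<subseteq> fund" unfolding piece_def by blast
      then show ?thesis using translate_mass piece_lebesgue[OF that] that by blast
    qed
    have Em: "E n \<in> sets lebesgue" for n unfolding E_def
      by (intro sets.finite_UN finP img) (use PM in blast)
    have Ele: "emeasure \<nu> (E n) \<le> ennreal (C' * r)" for n
    proof -
      have "\<forall>m\<in>P n. \<exists>\<eta>. cmod \<eta> = 1 \<and> cmod (\<eta> - \<zeta>) \<le> K' * r \<and>
         (\<forall>x. cmod x = 1 \<longrightarrow> cmod (x - \<eta>) < d / 4 * scale r m \<longrightarrow> mob (minv m) x \<in> tame d)"
      proof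
        fix m assume "m \<in> P n"
        then have "m \<in> M" "piece \<zeta> r m \<noteq> {}" unfolding P_def by blast+
        then show "\<exists>\<eta>. cmod \<eta> = 1 \<and> cmod (\<eta> - \<zeta>) \<le> K' * r \<and>
         (\<forall>x. cmod x = 1 \<longrightarrow> cmod (x - \<eta>) < d / 4 * scale r m \<longrightarrow> mob (minv m) x \<in> tame d)"
          using main[OF _ \<zeta> r] by blast
      qed
      then obtain \<eta> where \<eta>: "\<And>m. m \<in> P n \<Longrightarrow> cmod (\<eta> m) = 1" "\<And>m. m \<in> P n \<Longrightarrow> cmod (\<eta> m - \<zeta>) \<le> K' * r"
        "\<And>m x. m \<in> P n \<Longrightarrow> cmod x = 1 \<Longrightarrow> cmod (x - \<eta> m) < d / 4 * scale r m \<Longrightarrow> mob (minv m) x \<in> tame d"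
        by metis
      have sr: "0 \<le> scale r m" "scale r m \<le> r" for m unfolding scale_def using r by auto
      have "(\<Sum>m\<in>P n. d / 4 * scale r m) \<le> 3 * real N * (K2 * r)"
      proof (rule sum_radii_overlap_le[OF finP \<zeta> \<eta>(1)])
        fix m assume m: "m \<in> P n"
        have "K' * r \<le> K2 * r" unfolding K2_def using d r by (intro mult_right_mono) auto
        then show "cmod (\<eta> m - \<zeta>) \<le> K2 * r" using \<eta>(2)[OF m] by simp
        have "d / 4 * scale r m \<le> d * r" using sr[of m] d by (intro mult_mono) auto
        also have "\<dots> \<le> K2 * r" unfolding K2_def using K' r by (intro mult_right_mono) auto
        finally show "0 \<le> d / 4 * scale r m \<and> d / 4 * scale r m \<le> K2 * r" using sr[of m] d by simp
      next
        fix x :: complex assume x: "cmod x = 1"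
        have sub: "{m \<in> P n. cmod (x - \<eta> m) < d / 4 * scale r m} \<subseteq> {m \<in> P n. mob (minv m) x \<in> tame d}"
        proof
          fix m assume "m \<in> {m \<in> P n. cmod (x - \<eta> m) < d / 4 * scale r m}"
          then have "m \<in> P n" "cmod (x - \<eta> m) < d / 4 * scale r m" by blast+
          then show "m \<in> {m \<in> P n. mob (minv m) x \<in> tame d}" using \<eta>(3)[OF _ x] by blast
        qed
        have "card {m \<in> P n. cmod (x - \<eta> m) < d / 4 * scale r m} \<le> card {m \<in> P n. mob (minv m) x \<in> tame d}"
          using sub finP[of n] by (intro card_mono finite_subset[OF _ finP[of n]]) blast+
        also have "\<dots> \<le> N" unfolding N_def by (rule tame_overlap[OF d PM x])
        finally show "card {m \<in> P n. cmod (x - \<eta> m) < d / 4 * scale r m} \<le> N" .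
      next
        show "0 \<le> K2 * r" unfolding K2_def using K' d r by simp
      qed
      then have "d / 4 * (\<Sum>m\<in>P n. scale r m) \<le> 3 * real N * (K2 * r)" by (simp only: sum_distrib_left)
      then have sum: "(\<Sum>m\<in>P n. scale r m) \<le> 12 * real N * K2 / d * r" using d by (simp add: field_simps)
      have "emeasure \<nu> (E n) \<le> (\<Sum>m\<in>P n. emeasure \<nu> (mob m ` piece \<zeta> r m))"
        unfolding E_def using img PM by (intro emeasure_subadditive_finite finP) (simp only: sets_\<nu>, blast)
      also have "\<dots> \<le> (\<Sum>m\<in>P n. ennreal (C3 * scale r m))"
      proof (rule sum_mono)
        fix m assume "m \<in> P n"
        then have "m \<in> M" "piece \<zeta> r m \<noteq> {}" unfolding P_def by blast+
        then show "emeasure \<nu> (mob m ` piece \<zeta> r m) \<le> ennreal (C3 * scale r m)" using main[OF _ \<zeta> r] by blast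
      qed
      also have "\<dots> = ennreal (\<Sum>m\<in>P n. C3 * scale r m)" using C3 sr by (intro sum_ennreal) auto
      also have "\<dots> = ennreal (C3 * (\<Sum>m\<in>P n. scale r m))" by (simp only: sum_distrib_left)
      also have "\<dots> \<le> ennreal (C' * r)"
      proof (rule ennreal_leI)
        have "C3 * (\<Sum>m\<in>P n. scale r m) \<le> C3 * (12 * real N * K2 / d * r)" using sum C3 by (rule mult_left_mono)
        then show "C3 * (\<Sum>m\<in>P n. scale r m) \<le> C' * r" unfolding C'_def by (simp only: mult.assoc)
      qed
      finally show ?thesis .
    qed
    have "P i \<subseteq> P j" if "i \<le> j" for i j
    proof
      fix m assume "m \<in> P i"
      then have "m \<in> M" "cmod (fst m) \<le> real i" "piece \<zeta> r m \<noteq> {}" unfolding P_def by blast+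
      moreover have "real i \<le> real j" using that by simp
      ultimately show "m \<in> P j" unfolding P_def by (simp del: of_nat_le_iff)
    qed
    then have inc: "incseq E" unfolding E_def incseq_def by blast
    have cover: "\<Delta> \<inter> ball \<zeta> r \<subseteq> (\<Union>n. E n)"
    proof
      fix z assume z: "z \<in> \<Delta> \<inter> ball \<zeta> r"
      then have z1: "cmod z \<le> 1" by simp
      obtain m where m: "m \<in> M" "mob m z \<in> fund" using fund_covers[of z] z by blast
      define k where "k = minv m"
      have kM: "k \<in> M" unfolding k_def using minv_M[OF m(1)] .
      have kz: "mob k (mob m z) = z" unfolding k_def using mob_minv(2)[OF M_SU[OF m(1)] z1] .
      then have w: "mob m z \<in> piece \<zeta> r k" unfolding piece_def using m(2) z by simp
      obtain n where "cmod (fst k) \<le> real n" using real_arch_simple by blast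
      then have "k \<in> P n" unfolding P_def using kM w by blast
      then show "z \<in> (\<Union>n. E n)" unfolding E_def using w kz by (metis UN_I UNIV_I imageI)
    qed
    have "emeasure \<nu> (\<Delta> \<inter> ball \<zeta> r) \<le> emeasure \<nu> (\<Union>n. E n)" using cover Em by (intro emeasure_mono) auto
    also have "\<dots> = (SUP n. emeasure \<nu> (E n))" using Em inc by (intro SUP_emeasure_incseq[symmetric]) auto
    also have "\<dots> \<le> ennreal (C' * r)" using Ele by (intro SUP_least)
    finally show ?thesis .
  qed
  then show ?thesis by blast
qed

end

section \<open>The matrices of a Fuchsian group\<close>

definition disk_map :: "mat \<Rightarrow> complex \<Rightarrow> complex"
  where "disk_map m = disk_moebius (fst m) (snd m)"

abbreviation disk_bij :: "(complex \<Rightarrow> complex) monoid"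
  where "disk_bij \<equiv> BijGroup (cball 0 1)"

definition matrices :: "(complex \<Rightarrow> complex) set \<Rightarrow> mat set"
  where "matrices G = {m \<in> SU11. disk_map m \<in> G}"

lemma disk_map_restrict: "disk_map m = restrict (mob m) (cball 0 1)"
  unfolding disk_map_def disk_moebius_def mob_def den_def ..

lemma disk_map_apply: "cmod z \<le> 1 \<Longrightarrow> disk_map m z = mob m z"
  by (simp add: disk_map_restrict)

lemma disk_map_one: "disk_map (1,0) = \<one>\<^bsub>disk_bij\<^esub>"
  unfolding disk_map_restrict BijGroup_def by (auto simp: restrict_def)

lemma disk_map_mmul: assumes "p \<in> SU11" "q \<in> SU11" "disk_map p \<in> carrier disk_bij" "disk_map q \<in> carrier disk_bij"
  shows "disk_map p \<otimes>\<^bsub>disk_bij\<^esub> disk_map q = disk_map (mmul p q)"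
proof -
  have "disk_map p \<otimes>\<^bsub>disk_bij\<^esub> disk_map q = compose (cball 0 1) (disk_map p) (disk_map q)"
    using assms(3,4) by (simp add: BijGroup_def)
  also have "\<dots> = disk_map (mmul p q)"
  proof
    fix z show "compose (cball 0 1) (disk_map p) (disk_map q) z = disk_map (mmul p q) z"
    proof (cases "cmod z \<le> 1")
      case True
      then show ?thesis using mob_le_1[OF assms(2) True] mob_mmul[OF assms(2) True, of p]
        by (simp add: compose_def disk_map_restrict)
    qed (simp add: compose_def disk_map_restrict)
  qed
  finally show ?thesis .
qed

text \<open>A transformation that fixes \<open>0\<close> and \<open>1\<close> comes from a diagonal matrix with real entries of modulus
  one.\<close>

lemma disk_map_eq: assumes "p \<in> SU11" "q \<in> SU11" "disk_map p = disk_map q" shows "p = q \<or> p = - q"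
proof -
  define h where "h = mmul p (minv q)"
  have h: "h \<in> SU11" unfolding h_def using mmul_SU11 minv_SU11 assms by blast
  have pq: "mob p z = mob q z" if "cmod z \<le> 1" for z using disk_map_apply[OF that] assms(3) by metis
  have id: "mob h z = z" if z: "cmod z \<le> 1" for z
  proof -
    have "mob h z = mob p (mob (minv q) z)" unfolding h_def by (rule mob_mmul[OF minv_SU11[OF assms(2)] z])
    also have "\<dots> = mob q (mob (minv q) z)" by (rule pq[OF mob_le_1[OF minv_SU11[OF assms(2)] z]])
    also have "\<dots> = z" by (rule mob_minv(1)[OF assms(2) z])
    finally show ?thesis .
  qed
  have a: "fst h \<noteq> 0" using SU11_cmod(2)[OF h] by auto
  have b0: "snd h = 0" using id[of 0] a unfolding mob_0 by simp
  have "fst h / cnj (fst h) = 1" using id[of 1] b0 by (simp add: mob_def den_def)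
  then have "fst h = cnj (fst h)" using a by simp
  moreover have "fst h * cnj (fst h) = 1" using h b0 unfolding SU11_cnj by simp
  ultimately have "fst h * fst h = 1" by metis
  then have "fst h = 1 \<or> fst h = -1" using square_eq_1_iff by blast
  then have "h = (1,0) \<or> h = - (1,0)" using b0 by (auto simp: prod_eq_iff)
  moreover have "mmul h q = p" unfolding h_def using mmul_minv(2)[OF assms(2)] by (simp add: mmul_assoc)
  moreover have "mmul (- (1,0)) q = - q" by (simp add: mmul_def prod_eq_iff)
  ultimately show ?thesis by auto
qed

lemma words_mmul: assumes "q \<in> words T" "p \<in> words T" shows "mmul p q \<in> words T"
  using assms(1)
proof induction
  case one
  then show ?case using assms(2) by simp
next
  case (mul m t)
  then show ?case using words.mul by (simp add: mmul_assoc[symmetric])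
next
  case (inv m t)
  then show ?case using words.inv by (simp add: mmul_assoc[symmetric])
qed

context
  fixes G :: "(complex \<Rightarrow> complex) set"
  assumes fuchsian: "fuchsian_group G"
begin

lemma G_subgroup: "subgroup G disk_bij"
  using fuchsian by (simp add: fuchsian_group_def moebius_disk_group_def)

lemma disk_map_of_group: assumes "g \<in> G" obtains m where "m \<in> matrices G" "g = disk_map m"
proof -
  have "G \<subseteq> {disk_moebius a b | a b. (a, b) \<in> SU11}"
    using fuchsian by (simp add: fuchsian_group_def moebius_disk_group_def)
  then obtain a b where "g = disk_moebius a b" "(a, b) \<in> SU11" using assms by blast
  then have "(a, b) \<in> matrices G" "g = disk_map (a, b)" unfolding matrices_def disk_map_def using assms by auto
  then show thesis by (rule that)
qed

lemma matricesD: assumes "m \<in> matrices G" shows "m \<in> SU11" "disk_map m \<in> G" "disk_map m \<in> carrier disk_bij"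
  using assms subgroup.subset[OF G_subgroup] unfolding matrices_def by auto

lemma one_matrices: "(1,0) \<in> matrices G"
  unfolding matrices_def using one_SU11 disk_map_one subgroup.one_closed[OF G_subgroup] by simp

lemma mmul_matrices: assumes "p \<in> matrices G" "q \<in> matrices G" shows "mmul p q \<in> matrices G"
proof -
  have "disk_map (mmul p q) = disk_map p \<otimes>\<^bsub>disk_bij\<^esub> disk_map q" using disk_map_mmul matricesD assms by metis
  also have "\<dots> \<in> G" using subgroup.m_closed[OF G_subgroup] matricesD(2) assms by blast
  finally show ?thesis unfolding matrices_def using mmul_SU11 matricesD(1) assms by blast
qed

lemma disk_map_minv: assumes "m \<in> matrices G" shows "disk_map (minv m) = inv\<^bsub>disk_bij\<^esub> (disk_map m)" "minv m \<in> matrices G"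
proof -
  note m = matricesD[OF assms]
  interpret group disk_bij by (rule group_BijGroup)
  have "inv\<^bsub>disk_bij\<^esub> (disk_map m) \<in> G" by (rule subgroup.m_inv_closed[OF G_subgroup m(2)])
  then obtain n where n: "n \<in> matrices G" "inv\<^bsub>disk_bij\<^esub> (disk_map m) = disk_map n" by (rule disk_map_of_group)
  note n' = matricesD[OF n(1)]
  have "disk_map (mmul n m) = inv\<^bsub>disk_bij\<^esub> (disk_map m) \<otimes>\<^bsub>disk_bij\<^esub> disk_map m" unfolding n(2) by (rule disk_map_mmul[symmetric, OF n'(1) m(1) n'(3) m(3)])
  also have "\<dots> = disk_map (1,0)" unfolding disk_map_one using m(3) by simp
  finally have nm: "mmul n m = (1,0) \<or> mmul n m = - (1,0)"
    by (rule disk_map_eq[OF mmul_SU11[OF n'(1) m(1)] one_SU11])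
  have "n = mmul (mmul n m) (minv m)" using mmul_minv(1)[OF m(1)] by (simp add: mmul_assoc)
  moreover have "mmul (- (1,0)) (minv m) = - minv m" by (simp add: mmul_def prod_eq_iff)
  ultimately have "n = minv m \<or> n = - minv m" using nm by auto
  moreover have "disk_map (- k) = disk_map k" for k unfolding disk_map_restrict by (intro restrict_ext mob_minus(1))
  ultimately show "disk_map (minv m) = inv\<^bsub>disk_bij\<^esub> (disk_map m)" using n(2) by metis
  then show "minv m \<in> matrices G" unfolding matrices_def using minv_SU11[OF m(1)] n matricesD(2) by simp
qed

text \<open>Infinitely many matrices of bounded size would accumulate somewhere. The quotient of two that are
  close to each other is close to the identity, but not equal to it, against discreteness.\<close>

lemma finite_matrices: "finite {m \<in> matrices G. cmod (fst m) \<le> R}"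
proof (rule ccontr)
  define S where "S = {m \<in> matrices G. cmod (fst m) \<le> R}"
  assume "infinite {m \<in> matrices G. cmod (fst m) \<le> R}"
  then have inf: "infinite S" unfolding S_def .
  have le: "cmod (fst m) \<le> R" "cmod (snd m) \<le> R" if "m \<in> S" for m
    using that SU11_cmod(1)[of m] matricesD(1)[of m] unfolding S_def by auto
  have "S \<subseteq> cball 0 R \<times> cball 0 R" using le by (auto simp: mem_Times_iff)
  moreover have cmp: "compact (cball (0::complex) R \<times> cball (0::complex) R)" by (intro compact_Times) auto
  ultimately obtain l where l: "l islimpt S"
    using inf compact_eq_Bolzano_Weierstrass by metis
  have "{(a, b). (a, b) \<in> SU11 \<and> disk_moebius a b \<in> G} = matrices G"
    unfolding matrices_def disk_map_def by auto
  then have "discrete (matrices G)" using fuchsian unfolding fuchsian_group_def by simp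
  then have "(1,0) isolated_in matrices G" using one_matrices by (rule discreteD)
  then obtain e where e: "e > 0" "\<And>y. y \<in> matrices G \<Longrightarrow> dist (1,0) y < e \<Longrightarrow> y = (1,0)"
    unfolding isolated_in_dist_Ex_iff by blast
  define R' where "R' = \<bar>R\<bar> + 1"
  have R': "R' > 0" "R \<le> R'" unfolding R'_def by auto
  \<comment> \<open>Each entry of the quotient minus the identity is a sum of two products of size at most \<open>2 \<delta> R'\<close>.\<close>
  define \<delta> where "\<delta> = e / (16 * R')"
  have \<delta>: "\<delta> > 0" unfolding \<delta>_def using e R' by simp
  have "infinite (S \<inter> ball l \<delta>)" using l \<delta> islimpt_eq_infinite_ball by blast
  then obtain p where p: "p \<in> S \<inter> ball l \<delta>" using infinite_imp_nonempty by blast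
  have "infinite (S \<inter> ball l \<delta> - {p})" using \<open>infinite (S \<inter> ball l \<delta>)\<close> by simp
  then obtain q where q: "q \<in> S \<inter> ball l \<delta> - {p}" using infinite_imp_nonempty by blast
  have pq: "p \<in> matrices G" "q \<in> matrices G" "p \<noteq> q" using p q unfolding S_def by auto
  have "dist p q < 2 * \<delta>" using p q dist_triangle2[of p q l] by (auto simp: dist_commute)
  moreover have "dist (fst p) (fst q) \<le> dist p q" "dist (snd p) (snd q) \<le> dist p q"
    by (rule dist_fst_le, rule dist_snd_le)
  ultimately have d: "cmod (fst q - fst p) \<le> 2 * \<delta>" "cmod (snd q - snd p) \<le> 2 * \<delta>"
    by (auto simp: dist_norm norm_minus_commute)
  have lep: "cmod (fst p) \<le> R'" "cmod (snd p) \<le> R'" using le[of p] p R' by auto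
  define k where "k = mmul (minv p) q"
  have kM: "k \<in> matrices G" unfolding k_def using mmul_matrices disk_map_minv(2) pq by blast
  have s: "fst p * cnj (fst p) - snd p * cnj (snd p) = 1" using matricesD(1)[OF pq(1)] unfolding SU11_cnj .
  have mm: "cmod (x * y) \<le> R' * (2 * \<delta>)" if "cmod x \<le> R'" "cmod y \<le> 2 * \<delta>" for x y
    unfolding norm_mult using that R' by (intro mult_mono) auto
  have k1: "fst k - 1 = cnj (fst p) * (fst q - fst p) - snd p * cnj (snd q - snd p)"
    unfolding k_def mmul_def minv_def s[symmetric] by (simp add: algebra_simps)
  have k2: "snd k = cnj (fst p) * (snd q - snd p) - snd p * cnj (fst q - fst p)"
    unfolding k_def mmul_def minv_def by (simp add: algebra_simps)
  have "cmod (fst k - 1) \<le> cmod (cnj (fst p) * (fst q - fst p)) + cmod (snd p * cnj (snd q - snd p))"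
    unfolding k1 by (rule norm_triangle_ineq4)
  also have "\<dots> \<le> R' * (2 * \<delta>) + R' * (2 * \<delta>)" using lep d by (intro add_mono mm) (simp_all only: complex_mod_cnj)
  also have "\<dots> = e / 4" unfolding \<delta>_def using R' by simp
  finally have b1: "cmod (fst k - 1) \<le> e / 4" .
  have "cmod (snd k) \<le> cmod (cnj (fst p) * (snd q - snd p)) + cmod (snd p * cnj (fst q - fst p))"
    unfolding k2 by (rule norm_triangle_ineq4)
  also have "\<dots> \<le> R' * (2 * \<delta>) + R' * (2 * \<delta>)" using lep d by (intro add_mono mm) (simp_all only: complex_mod_cnj)
  also have "\<dots> = e / 4" unfolding \<delta>_def using R' by simp
  finally have b2: "cmod (snd k) \<le> e / 4" .
  have "dist (1,0) k \<le> dist 1 (fst k) + dist 0 (snd k)"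
    using sqrt_sum_squares_le_sum[of "dist 1 (fst k)" "dist 0 (snd k)"] unfolding dist_prod_def by simp
  also have "\<dots> < e" using b1 b2 e(1) by (simp add: dist_norm norm_minus_commute)
  finally have "k = (1,0)" using e(2) kM by blast
  then have "mmul p k = p" by simp
  moreover have "mmul p k = q" unfolding k_def using mmul_minv(1)[OF matricesD(1)[OF pq(1)]] by (simp add: mmul_assoc[symmetric])
  ultimately show False using pq(3) by simp
qed

lemma fuchsian_matrices: "fuchsian_matrices (matrices G)"
proof unfold_locales
  show "matrices G \<subseteq> SU11" by (auto simp only: matrices_def)
qed (rule one_matrices mmul_matrices disk_map_minv(2) finite_matrices; assumption)+

lemma finite_lifts: assumes "finite S" shows "finite {m \<in> matrices G. disk_map m \<in> S}"
proof -
  have "finite {m \<in> matrices G. disk_map m = s}" for s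
  proof (cases "{m \<in> matrices G. disk_map m = s} = {}")
    case False
    then obtain m0 where m0: "m0 \<in> matrices G" "disk_map m0 = s" by blast
    have "{m \<in> matrices G. disk_map m = s} \<subseteq> {m0, - m0}"
    proof
      fix m assume "m \<in> {m \<in> matrices G. disk_map m = s}"
      then have m: "m \<in> matrices G" "disk_map m = disk_map m0" using m0(2) by simp_all
      have "m = m0 \<or> m = - m0" by (rule disk_map_eq[OF matricesD(1)[OF m(1)] matricesD(1)[OF m0(1)] m(2)])
      then show "m \<in> {m0, - m0}" by blast
    qed
    then show ?thesis using finite_subset by blast
  qed (simp only: finite.emptyI)
  then have "finite (\<Union>s\<in>S. {m \<in> matrices G. disk_map m = s})" using assms by (intro finite_UN_I)
  moreover have "{m \<in> matrices G. disk_map m \<in> S} \<subseteq> (\<Union>s\<in>S. {m \<in> matrices G. disk_map m = s})" by blast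
  ultimately show ?thesis using finite_subset by blast
qed

text \<open>The lifts of the identity are added to the generators, so that both signs of each matrix are
  obtained as words.\<close>

lemma matrices_generated:
  assumes "S \<subseteq> G" "generate disk_bij S = G"
  shows "matrices G \<subseteq> words {m \<in> matrices G. disk_map m \<in> insert \<one>\<^bsub>disk_bij\<^esub> S}" (is "_ \<subseteq> words ?T")
proof
  interpret group disk_bij by (rule group_BijGroup)
  have GS: "G \<subseteq> carrier disk_bij" by (rule subgroup.subset[OF G_subgroup])
  have T_words: "t \<in> words ?T" if "t \<in> ?T" for t using words.mul[OF words.one that] by simp
  have *: "\<forall>m\<in>matrices G. disk_map m = g \<longrightarrow> m \<in> words ?T" if "g \<in> generate disk_bij S" for g
    using that
  proof (induction rule: generate.induct)
    case one
    then show ?case using T_words by blast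
  next
    case (incl h)
    then show ?case using T_words by blast
  next
    case (inv h)
    show ?case
    proof (intro ballI impI)
      fix m assume m: "m \<in> matrices G" "disk_map m = inv\<^bsub>disk_bij\<^esub> h"
      have "h \<in> carrier disk_bij" using inv assms(1) GS by blast
      then have "disk_map (minv m) = h" using disk_map_minv(1)[OF m(1)] m(2) by simp
      then have "minv m \<in> ?T" using disk_map_minv(2)[OF m(1)] inv by blast
      then show "m \<in> words ?T" using words.inv[OF words.one, of "minv m"] by simp
    qed
  next
    case (eng h1 h2)
    show ?case
    proof (intro ballI impI)
      fix m assume m: "m \<in> matrices G" "disk_map m = h1 \<otimes>\<^bsub>disk_bij\<^esub> h2"
      have hG: "h1 \<in> G" "h2 \<in> G" using eng(1,2) assms(2) by simp_all
      obtain p where p: "p \<in> matrices G" "h1 = disk_map p" using hG(1) by (rule disk_map_of_group)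
      define q where "q = mmul (minv p) m"
      have q: "q \<in> matrices G" unfolding q_def using mmul_matrices disk_map_minv(2) p(1) m(1) by blast
      have hc: "h1 \<in> carrier disk_bij" "h2 \<in> carrier disk_bij" using hG GS by blast+
      note mp = matricesD[OF disk_map_minv(2)[OF p(1)]] and mm = matricesD[OF m(1)]
      have "disk_map q = inv\<^bsub>disk_bij\<^esub> h1 \<otimes>\<^bsub>disk_bij\<^esub> (h1 \<otimes>\<^bsub>disk_bij\<^esub> h2)"
        unfolding q_def p(2) using disk_map_mmul[OF mp(1) mm(1) mp(3) mm(3)] disk_map_minv(1)[OF p(1)] m(2) p(2) by simp
      also have "\<dots> = h2" using hc by (simp add: m_assoc[symmetric])
      finally have "q \<in> words ?T" using eng.IH(2) q by blast
      moreover have "p \<in> words ?T" using eng.IH(1) p by blast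
      moreover have "m = mmul p q" unfolding q_def using mmul_minv(1)[OF matricesD(1)[OF p(1)]] by (simp add: mmul_assoc[symmetric])
      ultimately show "m \<in> words ?T" using words_mmul by metis
    qed
  qed
  fix m assume m: "m \<in> matrices G"
  then have "disk_map m \<in> generate disk_bij S" using matricesD(2) assms(2) by blast
  then show "m \<in> words ?T" using * m by blast
qed

text \<open>As no element is parabolic, there is a second fixed point \<open>z\<close>. The number \<open>v = den m \<xi>\<close> is real,
  hence \<open>\<plusminus> 1\<close>, and the chord formula for \<open>\<xi>\<close> and \<open>z\<close> gives \<open>den m z = v\<close>. A denominator that takes the
  same value twice is constant.\<close>

lemma no_parabolic_matrices:
  assumes np: "\<forall>g\<in>G. \<not> parabolic g" and m: "m \<in> matrices G" and \<xi>: "cmod \<xi> = 1" "mob m \<xi> = \<xi>" "cmod (den m \<xi>) = 1"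
  shows "m = (1,0) \<or> m = - (1,0)"
proof -
  note SU = matricesD(1)[OF m]
  have "{z \<in> cball 0 1. disk_map m z = z} \<noteq> {\<xi>}"
    using np matricesD(2)[OF m] \<xi>(1) unfolding parabolic_def by auto
  moreover have "\<xi> \<in> {z \<in> cball 0 1. disk_map m z = z}" using \<xi> by (simp add: disk_map_apply)
  ultimately obtain z where z: "z \<noteq> \<xi>" "cmod z \<le> 1" "disk_map m z = z" by auto
  have mz: "mob m z = z" using z disk_map_apply by metis
  define v where "v = den m \<xi>"
  have "z - \<xi> = (z - \<xi>) / (den m z * v)" using mob_diff[OF SU z(2), of \<xi>] \<xi> mz unfolding v_def by simp
  moreover have "den m z * v \<noteq> 0" unfolding v_def using den_nz[OF SU] z(2) \<xi>(1) by simp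
  ultimately have "(z - \<xi>) * (den m z * v) = z - \<xi>" by (metis nonzero_eq_divide_eq)
  then have "(z - \<xi>) * (den m z * v - 1) = 0" by (simp add: algebra_simps)
  then have zv: "den m z * v = 1" using z(1) by simp
  have e: "fst m * \<xi> + snd m = \<xi> * v" using mob_den[OF SU, of \<xi>] \<xi> unfolding v_def by simp
  have "\<xi> * cnj v = (\<xi> * cnj \<xi>) * snd m + \<xi> * fst m" unfolding v_def den_def by (simp add: algebra_simps)
  also have "\<dots> = \<xi> * v" using e cnj_mult_self[OF \<xi>(1)] by (simp add: algebra_simps)
  finally have "cnj v = v" using \<xi>(1) by auto
  then have vv: "v * v = 1" using cnj_mult_self[of v] \<xi>(3) unfolding v_def by simp
  then have v1: "v = 1 \<or> v = -1" using square_eq_1_iff by blast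
  have "den m z = (den m z * v) * v" using vv by (simp only: mult.assoc mult_1_right)
  then have "den m z = v" unfolding zv by simp
  then have "cnj (snd m) * (z - \<xi>) = 0" unfolding v_def den_def by (simp add: algebra_simps)
  then have b0: "snd m = 0" using z(1) by simp
  then have "cnj (fst m) = 1 \<or> cnj (fst m) = -1" using v1 unfolding v_def den_def by simp
  then have "fst m = 1 \<or> fst m = -1" by (metis complex_cnj_cnj complex_cnj_minus complex_cnj_one)
  then show ?thesis using b0 by (auto simp: prod_eq_iff)
qed

text \<open>Near a point inside the disk there are only finitely many orbit points.\<close>

lemma limit_set_sphere: "limit_set G \<subseteq> sphere 0 1"
proof
  fix \<xi> assume "\<xi> \<in> limit_set G"
  then obtain z where z: "cmod z < 1" "\<xi> islimpt (\<lambda>g. g z) ` G" unfolding limit_set_def by auto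
  have orb: "cmod (g z) < 1" if g: "g \<in> G" for g
  proof -
    obtain m where m: "m \<in> matrices G" "g = disk_map m" using g by (rule disk_map_of_group)
    then show ?thesis using mob_less_1[OF matricesD(1)[OF m(1)] z(1)] z(1) by (simp add: disk_map_apply)
  qed
  then have "(\<lambda>g. g z) ` G \<subseteq> cball 0 1" by (auto simp: less_imp_le)
  then have "\<xi> islimpt cball 0 1" using z(2) islimpt_subset by blast
  then have le: "cmod \<xi> \<le> 1" using closed_limpt[of "cball (0::complex) 1"] by auto
  show "\<xi> \<in> sphere 0 1"
  proof (rule ccontr)
    assume "\<xi> \<notin> sphere 0 1"
    then have lt: "cmod \<xi> < 1" using le by simp
    define \<delta> where "\<delta> = (1 - cmod \<xi>) / 2"
    define R where "R = cmod \<xi> + \<delta>"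
    have \<delta>: "\<delta> > 0" and R: "R < 1" "R \<ge> 0" unfolding R_def \<delta>_def using lt by (auto simp: field_simps)
    define B where "B = 1 / ((1 - R\<^sup>2) * (1 - cmod z)\<^sup>2)"
    have "(\<lambda>g. g z) ` G \<inter> ball \<xi> \<delta> \<subseteq> (\<lambda>m. mob m z) ` {m \<in> matrices G. cmod (fst m) \<le> B}"
    proof
      fix y assume y: "y \<in> (\<lambda>g. g z) ` G \<inter> ball \<xi> \<delta>"
      then obtain g where g: "g \<in> G" "y = g z" by blast
      obtain m where m: "m \<in> matrices G" "g = disk_map m" using g(1) by (rule disk_map_of_group)
      note SU = matricesD(1)[OF m(1)]
      have ym: "y = mob m z" using g m z(1) by (simp add: disk_map_apply)
      have "cmod y \<le> R" using y norm_triangle_ineq2[of y \<xi>] unfolding R_def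
        by (auto simp: dist_norm norm_minus_commute)
      then have "cmod (mob m z) \<le> R" unfolding ym .
      then have "cmod (fst m) \<le> B"
        unfolding B_def by (rule fst_bounded_if_mob_bounded[OF SU order_refl z(1) _ R(1)])
      then show "y \<in> (\<lambda>m. mob m z) ` {m \<in> matrices G. cmod (fst m) \<le> B}" using ym m(1) by blast
    qed
    then have "finite ((\<lambda>g. g z) ` G \<inter> ball \<xi> \<delta>)" using finite_matrices finite_surj by blast
    then show False using z(2) \<delta> islimpt_eq_infinite_ball by blast
  qed
qed

lemma second_kind_gap: assumes "second_kind G"
  obtains \<xi> e where "cmod \<xi> = 1" "e > 0" "\<And>m. m \<in> matrices G \<Longrightarrow> e \<le> cmod (mob m 0 - \<xi>)"
proof -
  have "\<not> sphere 0 1 \<subseteq> limit_set G"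
    using assms limit_set_sphere unfolding second_kind_def first_kind_def by blast
  then obtain \<xi> where "\<xi> \<in> sphere 0 1" and nl: "\<xi> \<notin> limit_set G" by blast
  then have \<xi>: "cmod \<xi> = 1" "\<xi> \<notin> limit_set G" by simp_all
  then have "\<not> \<xi> islimpt (\<lambda>g. g 0) ` G" unfolding limit_set_def by auto
  then obtain e where e: "e > 0" "\<And>y. y \<in> (\<lambda>g. g 0) ` G \<Longrightarrow> y \<noteq> \<xi> \<Longrightarrow> e \<le> dist y \<xi>"
    unfolding islimpt_approachable by (auto simp: not_less)
  have "e \<le> cmod (mob m 0 - \<xi>)" if m: "m \<in> matrices G" for m
  proof -
    have "mob m 0 \<noteq> \<xi>" using mob_less_1[OF matricesD(1)[OF m], of 0] \<xi>(1) by auto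
    moreover have "mob m 0 = disk_map m 0" by (simp add: disk_map_apply)
    then have "mob m 0 \<in> (\<lambda>g. g 0) ` G" using matricesD(2)[OF m] by blast
    ultimately show ?thesis using e(2) by (simp add: dist_norm)
  qed
  then show thesis using that \<xi>(1) e(1) by blast
qed

lemma artanh_le_iff: fixes x y :: real assumes "0 \<le> x" "x < 1" "0 \<le> y" "y < 1"
  shows "artanh x \<le> artanh y \<longleftrightarrow> x \<le> y"
proof -
  have "artanh x \<le> artanh y \<longleftrightarrow> (1 + x) / (1 - x) \<le> (1 + y) / (1 - y)"
    unfolding artanh_def using assms by simp
  also have "\<dots> \<longleftrightarrow> (1 + x) * (1 - y) \<le> (1 + y) * (1 - x)" using assms by (simp add: divide_simps)
  also have "\<dots> \<longleftrightarrow> x \<le> y" by (simp add: algebra_simps)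
  finally show ?thesis .
qed

text \<open>The hyperbolic distances of \<open>w\<close> from \<open>0\<close> and from \<open>m 0\<close> depend on \<open>\<bar>w\<bar>\<close> and \<open>\<bar>m\<^sup>-\<^sup>1 w\<bar>\<close> in the same
  way, and the latter are compared by the derivative of \<open>m\<^sup>-\<^sup>1\<close> at \<open>w\<close>.\<close>

lemma half_plane0_iff: assumes "m \<in> matrices G" "w \<in> \<Delta>"
  shows "w \<in> half_plane0 (disk_map m) \<longleftrightarrow> 1 \<le> cmod (den (minv m) w)"
proof -
  note SU = matricesD(1)[OF assms(1)]
  have w: "cmod w < 1" using assms(2) by simp
  define a b where "a = fst m" and "b = snd m"
  have a0: "a \<noteq> 0" unfolding a_def using SU11_cmod(2)[OF SU] by auto
  define n where "n = minv m"
  have nSU: "n \<in> SU11" unfolding n_def by (rule minv_SU11[OF SU])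
  have nn: "fst n = cnj a" "snd n = - b" unfolding n_def minv_def a_def b_def by simp_all
  have dn: "den n w \<noteq> 0" using den_nz[OF nSU] w by simp
  have v: "disk_map m 0 = b / cnj a" unfolding a_def b_def by (simp add: disk_map_apply mob_0)
  have e1: "w - b / cnj a = (cnj a * w - b) / cnj a" using a0 by (simp add: field_simps)
  have e2: "1 - cnj (b / cnj a) * w = den n w / a" using a0 unfolding den_def nn by (simp add: field_simps)
  have "cmod ((w - disk_map m 0) / (1 - cnj (disk_map m 0) * w)) = cmod (mob n w)"
    unfolding v e1 e2 mob_def nn using a0 by (simp add: norm_divide norm_mult)
  then have h: "hyp_dist w (disk_map m 0) = 2 * artanh (cmod (mob n w))" unfolding hyp_dist_def by simp
  have h0: "hyp_dist w 0 = 2 * artanh (cmod w)" unfolding hyp_dist_def by simp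
  have q: "cmod (mob n w) < 1" by (rule mob_less_1[OF nSU w])
  have D: "(cmod (den n w))\<^sup>2 > 0" using dn by simp
  have w2: "1 - (cmod w)\<^sup>2 > 0" using w by (simp add: abs_square_less_1)
  have "w \<in> half_plane0 (disk_map m) \<longleftrightarrow> cmod w \<le> cmod (mob n w)"
    using assms(2) artanh_le_iff[of "cmod w" "cmod (mob n w)"] w q by (simp add: half_plane0_def h h0)
  also have "\<dots> \<longleftrightarrow> (cmod w)\<^sup>2 \<le> (cmod (mob n w))\<^sup>2" by (simp add: abs_le_square_iff[symmetric])
  also have "\<dots> \<longleftrightarrow> (1 - (cmod w)\<^sup>2) / (cmod (den n w))\<^sup>2 \<le> 1 - (cmod w)\<^sup>2"
  proof -
    have "1 - (cmod (mob n w))\<^sup>2 = (1 - (cmod w)\<^sup>2) / (cmod (den n w))\<^sup>2" using w by (intro one_minus_mob[OF nSU]) simp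
    then show ?thesis by linarith
  qed
  also have "\<dots> \<longleftrightarrow> 1 \<le> (cmod (den n w))\<^sup>2" using D w2 by (simp add: divide_le_eq)
  also have "\<dots> \<longleftrightarrow> 1 \<le> cmod (den n w)" using abs_le_square_iff[of 1 "cmod (den n w)"] by simp
  finally show ?thesis unfolding n_def .
qed

lemma dirichlet_domain_eq: "dirichlet_domain G = fuchsian_matrices.fund (matrices G)"
proof -
  interpret fuchsian_matrices "matrices G" by (rule fuchsian_matrices)
  show ?thesis
  proof (rule Set.set_eqI)
    fix w
    show "w \<in> dirichlet_domain G \<longleftrightarrow> w \<in> fund"
    proof (cases "w \<in> \<Delta>")
      case wD: True
      show ?thesis
      proof
        assume w: "w \<in> dirichlet_domain G"
        have "1 \<le> cmod (den m w)" if m: "m \<in> matrices G" for m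
        proof (cases "disk_map (minv m) = \<one>\<^bsub>disk_bij\<^esub>")
          case True
          then have "minv m = (1,0) \<or> minv m = - (1,0)"
            unfolding disk_map_one[symmetric] by (rule disk_map_eq[OF matricesD(1)[OF disk_map_minv(2)[OF m]] one_SU11])
          then have "m = minv (1,0) \<or> m = minv (- (1,0))" by (metis minv_minv)
          then show ?thesis by (auto simp: minv_def den_def)
        next
          case False
          then have "w \<in> half_plane0 (disk_map (minv m))"
            using w matricesD(2)[OF disk_map_minv(2)[OF m]] unfolding dirichlet_domain_def by blast
          then show ?thesis using half_plane0_iff[OF disk_map_minv(2)[OF m] wD] by simp
        qed
        then show "w \<in> fund" unfolding fund_def using wD by blast
      next
        assume w: "w \<in> fund"
        have "w \<in> half_plane0 g" if g: "g \<in> G" for g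
        proof -
          obtain m where m: "m \<in> matrices G" "g = disk_map m" using g by (rule disk_map_of_group)
          have "1 \<le> cmod (den (minv m) w)" using w disk_map_minv(2)[OF m(1)] unfolding fund_def by blast
          then show ?thesis using half_plane0_iff[OF m(1) wD] m(2) by simp
        qed
        then show "w \<in> dirichlet_domain G" unfolding dirichlet_domain_def using wD by blast
      qed
    next
      case False
      then show ?thesis unfolding dirichlet_domain_def fund_def by blast
    qed
  qed
qed

lemma convex_cocompact_matrices_matrices:
  assumes "convex_cocompact G" "second_kind G" shows "convex_cocompact_matrices (matrices G)"
proof -
  interpret fuchsian_matrices "matrices G" by (rule fuchsian_matrices)
  obtain S where S: "finite S" "S \<subseteq> G" "generate disk_bij S = G"
    using assms(1) unfolding convex_cocompact_def finitely_generated_def by blast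
  have np: "\<forall>g\<in>G. \<not> parabolic g" using assms(1) unfolding convex_cocompact_def by blast
  define T where "T = {m \<in> matrices G. disk_map m \<in> insert \<one>\<^bsub>disk_bij\<^esub> S}"
  have T: "fg_fuchsian_matrices (matrices G) T"
  proof unfold_locales
    show "finite T" unfolding T_def using S(1) by (intro finite_lifts) simp
    show "T \<subseteq> matrices G" unfolding T_def by blast
    show "(1,0) \<in> T" unfolding T_def using one_matrices disk_map_one by simp
    show "matrices G \<subseteq> words T" unfolding T_def by (rule matrices_generated[OF S(2,3)])
  qed (rule no_parabolic_matrices[OF np])
  show ?thesis
  proof unfold_locales
    fix \<xi> :: complex assume \<xi>: "cmod \<xi> = 1" "\<And>m. m \<in> matrices G \<Longrightarrow> 1 \<le> cmod (den m \<xi>)"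
    interpret empty_horoball "matrices G" T \<xi>
      using T \<xi> by (intro empty_horoball.intro empty_horoball_axioms.intro)
    show "\<exists>e>0. \<forall>m\<in>matrices G. e \<le> cmod (mob m 0 - \<xi>)" by (rule orbit_away)
  next
    show "ideal_points \<noteq> {}" using second_kind_gap[OF assms(2)] ideal_points_nonempty by metis
  qed
qed

text \<open>The quotient of the derivatives has modulus one, or is \<open>0\<close> by convention; an inequality holds in
  either case.\<close>

lemma beltrami_invariant: assumes "\<mu> \<in> beltrami G" "m \<in> matrices G"
  shows "AE z in lebesgue. z \<in> \<Delta> \<longrightarrow> cmod (\<mu> z) \<le> cmod (\<mu> (mob m z))"
proof -
  have "AE z in lebesgue_on \<Delta>. \<mu> z = \<mu> (disk_map m z) * cnj (deriv (disk_map m) z) / deriv (disk_map m) z"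
    using assms matricesD(2) unfolding beltrami_def by blast
  then have "AE z in lebesgue. z \<in> \<Delta> \<longrightarrow> \<mu> z = \<mu> (disk_map m z) * cnj (deriv (disk_map m) z) / deriv (disk_map m) z"
    by (subst (asm) AE_restrict_space_iff) auto
  then show ?thesis
  proof eventually_elim
    fix z assume e: "z \<in> \<Delta> \<longrightarrow> \<mu> z = \<mu> (disk_map m z) * cnj (deriv (disk_map m) z) / deriv (disk_map m) z"
    show "z \<in> \<Delta> \<longrightarrow> cmod (\<mu> z) \<le> cmod (\<mu> (mob m z))"
    proof
      assume z: "z \<in> \<Delta>"
      define D where "D = deriv (disk_map m) z"
      have "\<mu> z = \<mu> (mob m z) * cnj D / D" using e z unfolding D_def by (simp add: disk_map_apply)
      then have "cmod (\<mu> z) = cmod (\<mu> (mob m z)) * (cmod D / cmod D)" by (simp add: norm_mult norm_divide)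
      also have "\<dots> \<le> cmod (\<mu> (mob m z)) * 1" by (intro mult_left_mono) (auto simp: divide_simps)
      finally show "cmod (\<mu> z) \<le> cmod (\<mu> (mob m z))" by simp
    qed
  qed
qed

end

lemma beltrami_bounded: assumes "\<mu> \<in> beltrami G"
  shows "AE z in lebesgue. z \<in> \<Delta> \<longrightarrow> cmod (\<mu> z) \<le> 1"
proof -
  have ess: "esssup (lebesgue_on \<Delta>) (\<lambda>z. ereal (cmod (\<mu> z))) < 1" using assms by (simp add: beltrami_def)
  have "AE z in lebesgue_on \<Delta>. ereal (cmod (\<mu> z)) \<le> esssup (lebesgue_on \<Delta>) (\<lambda>z. ereal (cmod (\<mu> z)))"
    by (rule esssup_AE)
  then have "AE z in lebesgue_on \<Delta>. cmod (\<mu> z) \<le> 1"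
  proof eventually_elim
    fix z assume "ereal (cmod (\<mu> z)) \<le> esssup (lebesgue_on \<Delta>) (\<lambda>z. ereal (cmod (\<mu> z)))"
    then have "ereal (cmod (\<mu> z)) \<le> ereal 1" using ess by (metis less_imp_le one_ereal_def order_trans)
    then show "cmod (\<mu> z) \<le> 1" by simp
  qed
  then show ?thesis by (subst (asm) AE_restrict_space_iff) auto
qed

theorem theorem1p1:
  fixes G :: "(complex \<Rightarrow> complex) set" and F :: "complex set" and \<mu> :: "complex \<Rightarrow> complex"
  assumes "fuchsian_group G" and "convex_cocompact G" and "second_kind G"
    and "F = dirichlet_domain G"
    and "\<mu> \<in> beltrami G"
    and "\<exists>C::real. \<forall>\<xi>\<in>boundary_at_infinity F. \<forall>r. 0 < r \<and> r < 1 \<longrightarrow>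
      (\<integral>\<^sup>+z\<in>ball \<xi> r. ennreal ((cmod (\<mu> z))\<^sup>2 * indicat_real F z / (1 - (cmod z)\<^sup>2)) \<partial>lebesgue)
        \<le> ennreal (C * r)"
  shows "\<mu> \<in> CM_star"
proof -
  interpret convex_cocompact_matrices "matrices G"
    by (rule convex_cocompact_matrices_matrices[OF assms(1-3)])
  have F: "F = fund" unfolding assms(4) by (rule dirichlet_domain_eq[OF assms(1)])
  have Finf: "boundary_at_infinity F = ideal_points"
    unfolding boundary_at_infinity_def F by (rule ideal_points_closure)
  obtain C where C0: "\<forall>\<xi>\<in>ideal_points. \<forall>r. 0 < r \<and> r < 1 \<longrightarrow>
      (\<integral>\<^sup>+z\<in>ball \<xi> r. ennreal ((cmod (\<mu> z))\<^sup>2 * indicat_real fund z / (1 - (cmod z)\<^sup>2)) \<partial>lebesgue) \<le> ennreal (C * r)"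
    using assms(6)[unfolded Finf, unfolded F] by (rule exE)
  have C: "(\<integral>\<^sup>+z\<in>ball \<xi> r. ennreal ((cmod (\<mu> z))\<^sup>2 * indicat_real fund z / (1 - (cmod z)\<^sup>2)) \<partial>lebesgue) \<le> ennreal (C * r)"
    if "\<xi> \<in> ideal_points" "0 < r" "r < 1" for \<xi> r
    using C0 that by simp
  define u where "u = (\<lambda>z. indicat_real \<Delta> z * (cmod (\<mu> z))\<^sup>2)"
  have \<mu>m: "\<mu> \<in> borel_measurable (lebesgue_on \<Delta>)" using assms(5) by (simp add: beltrami_def)
  then have "(\<lambda>z. (cmod (\<mu> z))\<^sup>2) \<in> borel_measurable (lebesgue_on \<Delta>)" by measurable
  then have um: "u \<in> borel_measurable lebesgue" unfolding u_def
    by (subst (asm) borel_measurable_restrict_space_iff) auto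
  interpret carleson_on_domain "matrices G" u "\<bar>C\<bar>"
  proof unfold_locales
    show "u \<in> borel_measurable lebesgue" by (rule um)
    show "0 \<le> u z" for z unfolding u_def by simp
    show "AE z in lebesgue. z \<in> \<Delta> \<longrightarrow> u z \<le> 1"
      using beltrami_bounded[OF assms(5)] by eventually_elim (simp add: u_def power_le_one)
    show "AE z in lebesgue. z \<in> \<Delta> \<longrightarrow> u z \<le> u (mob m z)" if m: "m \<in> matrices G" for m
      using beltrami_invariant[OF assms(1,5) m]
    proof eventually_elim
      fix z assume e: "z \<in> \<Delta> \<longrightarrow> cmod (\<mu> z) \<le> cmod (\<mu> (mob m z))"
      show "z \<in> \<Delta> \<longrightarrow> u z \<le> u (mob m z)"
      proof
        assume z: "z \<in> \<Delta>"
        then have "mob m z \<in> \<Delta>" using mob_less_1[OF M_SU[OF m], of z] by simp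
        then show "u z \<le> u (mob m z)" unfolding u_def using e z by (simp add: power_mono)
      qed
    qed
    show "0 \<le> \<bar>C\<bar>" by simp
    fix \<xi> r assume \<xi>: "\<xi> \<in> ideal_points" and r: "0 < r" "r < (1::real)"
    have "(\<integral>\<^sup>+z\<in>fund \<inter> ball \<xi> r. ennreal (u z / (1 - (cmod z)\<^sup>2)) \<partial>lebesgue)
        = (\<integral>\<^sup>+z\<in>ball \<xi> r. ennreal ((cmod (\<mu> z))\<^sup>2 * indicat_real fund z / (1 - (cmod z)\<^sup>2)) \<partial>lebesgue)"
    proof (intro nn_integral_cong)
      fix z
      have "z \<in> fund \<Longrightarrow> z \<in> \<Delta>" unfolding fund_def by blast
      then show "ennreal (u z / (1 - (cmod z)\<^sup>2)) * indicator (fund \<inter> ball \<xi> r) z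
        = ennreal ((cmod (\<mu> z))\<^sup>2 * indicat_real fund z / (1 - (cmod z)\<^sup>2)) * indicator (ball \<xi> r) z"
        unfolding u_def by (auto simp: indicator_def)
    qed
    also have "\<dots> \<le> ennreal (C * r)" by (rule C[OF \<xi> r])
    also have "\<dots> \<le> ennreal (\<bar>C\<bar> * r)" using r by (intro ennreal_leI mult_right_mono) auto
    finally show "(\<integral>\<^sup>+z\<in>fund \<inter> ball \<xi> r. ennreal (u z / (1 - (cmod z)\<^sup>2)) \<partial>lebesgue) \<le> ennreal (\<bar>C\<bar> * r)" .
  qed
  obtain C' where C': "\<And>\<zeta> r. cmod \<zeta> = 1 \<Longrightarrow> 0 < r \<Longrightarrow> emeasure \<nu> (\<Delta> \<inter> ball \<zeta> r) \<le> ennreal (C' * r)"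
    using carleson_disk by blast
  define f where "f = (\<lambda>z. ennreal ((cmod (\<mu> z))\<^sup>2 / (1 - (cmod z)\<^sup>2)))"
  define l where "l = density (lebesgue_on \<Delta>) f"
  have fm: "f \<in> borel_measurable (lebesgue_on \<Delta>)"
  proof -
    have "(\<lambda>z::complex. 1 - (cmod z)\<^sup>2) \<in> borel_measurable borel" by measurable
    then have "(\<lambda>z::complex. 1 - (cmod z)\<^sup>2) \<in> borel_measurable (lebesgue_on \<Delta>)"
      by (intro measurable_restrict_space1) (simp add: measurable_completion)
    then show ?thesis unfolding f_def using \<mu>m by measurable
  qed
  have "emeasure l (\<Delta> \<inter> ball \<zeta> r) \<le> ennreal (C' * r)" if \<zeta>: "cmod \<zeta> = 1" and r: "0 < r" for \<zeta> r
  proof -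
    have m: "\<Delta> \<inter> ball \<zeta> r \<in> sets (lebesgue_on \<Delta>)" by (subst sets_restrict_space_iff) auto
    have "emeasure l (\<Delta> \<inter> ball \<zeta> r) = (\<integral>\<^sup>+z. f z * indicator (\<Delta> \<inter> ball \<zeta> r) z \<partial>lebesgue_on \<Delta>)"
      unfolding l_def by (rule emeasure_density[OF fm m])
    also have "\<dots> = (\<integral>\<^sup>+z. f z * indicator (\<Delta> \<inter> ball \<zeta> r) z * indicator \<Delta> z \<partial>lebesgue)"
      by (rule nn_integral_restrict_space) simp
    also have "\<dots> = (\<integral>\<^sup>+z\<in>\<Delta> \<inter> ball \<zeta> r. \<phi> z \<partial>lebesgue)"
    proof (intro nn_integral_cong)
      fix z
      show "f z * indicator (\<Delta> \<inter> ball \<zeta> r) z * indicator \<Delta> z = \<phi> z * indicator (\<Delta> \<inter> ball \<zeta> r) z"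
      proof (cases "z \<in> \<Delta> \<inter> ball \<zeta> r")
        case True
        then have "u z = (cmod (\<mu> z))\<^sup>2" unfolding u_def by simp
        then show ?thesis using True by (simp add: f_def \<phi>_def)
      qed simp
    qed
    also have "\<dots> = emeasure \<nu> (\<Delta> \<inter> ball \<zeta> r)" by (rule emeasure_\<nu>[symmetric]) auto
    also have "\<dots> \<le> ennreal (C' * r)" by (rule C'[OF \<zeta> r])
    finally show ?thesis .
  qed
  then have "\<forall>\<zeta>\<in>sphere 0 1. \<forall>r. 0 < r \<and> r < 2 \<longrightarrow> emeasure l (\<Delta> \<inter> ball \<zeta> r) \<le> ennreal (C' * r)" by simp
  moreover have "space l = \<Delta>" unfolding l_def by simp
  moreover have "sets (restrict_space borel \<Delta>) \<subseteq> sets l"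
    unfolding l_def by (auto simp: sets_restrict_space)
  ultimately have "l \<in> CM" unfolding CM_def by (intro CollectI conjI exI[of _ C'])
  then show ?thesis unfolding CM_star_def l_def f_def using \<mu>m by blast
qed

end
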